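(* Let $\alpha\in\mathcal O^\ast\setminus\mathcal O$. Suppose $\mathcal P$ and $\mathcal N$ are countable collections of $\alpha$-ranked labeled Borel codes, each enumerable in $\mathrm{HYP}$ (i.e. there are hyperarithmetic sequences $\langle P_n\rangle_n$, $\langle N_n\rangle_n$ with $\mathcal P=\{P_n\}$, $\mathcal N=\{N_n\}$), such that for each $X\in\mathrm{HYP}$ there is a unique $Q\in\mathcal P_{\mathcal O}\cup\mathcal N_{\mathcal O}$ with $X\in|Q|$. Then there is a computable $\alpha$-ranked labeled Borel code $T$ such that, in $\mathrm{HYP}$, $\mathrm{Decorate}(T,\mathcal P,\mathcal N)$ is completely determined and $|\mathrm{Decorate}(T,\mathcal P,\mathcal N)|=\bigcup_{P\in\mathcal P_{\mathcal O}}|P|$ (as subsets of $\mathrm{HYP}\cap 2^\omega$).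
   Context: $\mathrm{HYP}$ is the $\omega$-model of hyperarithmetic sets; $\mathcal O^\ast$ is the set of ordinal notations in $\mathrm{HYP}$ (notations with no hyperarithmetic descending sequence) with computable order $<_\ast$, and $\mathcal O\subseteq\mathcal O^\ast$ the notations for genuine ordinals. A labeled Borel code is a tree $T\subseteq\omega^{<\omega}$ whose interior nodes are labeled $\bigcup$ (union) or $\bigcap$ (intersection) and whose leaves are labeled with codes for clopen subsets of $2^\omega$. For $\alpha\in\mathcal O^\ast$, $T$ is $\alpha$-ranked by $\rho:T\to\{\beta\in\mathcal O^\ast:\beta\le_\ast\alpha\}$ if $\rho(\sigma^\frown n)<_\ast\rho(\sigma)$ whenever $\sigma^\frown n\in T$; its rank is $\rho(\langle\rangle)$. $\mathcal P_{\mathcal O}$ (resp. $\mathcal N_{\mathcal O}$) is the set of codes in $\mathcal P$ (resp. $\mathcal N$) whose rank is in $\mathcal O$. An evaluation map for $X$ in $T$ is $f:T\to\{0,1\}$ with $f(\eta)=1$ iff $X\in\ell(\eta)$ at leaves, $f(\sigma)=1$ iff some child is 1 at union nodes, $f(\sigma)=1$ iff all children are 1 at intersection nodes; $X\in|T|$ means an evaluation map with $f(\langle\rangle)=1$ exists (in $\mathrm{HYP}$ when working in $\mathrm{HYP}$). In $\mathrm{HYP}$, $T$ is completely determined if every $X\in\mathrm{HYP}$ has a hyperarithmetic evaluation map in $T$. $\neg T$ swaps $\bigcup$ and $\bigcap$ and complements each leaf's clopen set. $T_n=\{\sigma:\langle n\rangle^\frown\sigma\in T\}$. $\mathrm{Decorate}(T,\mathcal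 P,\mathcal N)$ is defined recursively: a leaf is unchanged; otherwise the root keeps its label and has as children $\mathrm{Decorate}(T_n,\mathcal P,\mathcal N)$ for each child $T_n$, plus, if the root is a union node, $\mathrm{Decorate}(P,\mathcal P,\mathcal N)$ for each $P\in\mathcal P$ of rank $<_\ast\rho(\langle\rangle)$, and, if it is an intersection node, $\mathrm{Decorate}(\neg N,\mathcal P,\mathcal N)$ for each $N\in\mathcal N$ of rank $<_\ast\rho(\langle\rangle)$. *)

theory Defs
  imports Main "HOL-Library.Nat_Bijection"
begin

section \<open>Oracle computability\<close>

text \<open>Partial recursive functions relative to an oracle, presented as unary functions on the
  naturals; several arguments are packed with \<^const>\<open>prod_encode\<close>.\<close>

datatype prog =
    Zero | Succ | Ident | Fst | Snd | Query
  | Comp prog prog | Pair prog prog | Rec prog prog | Mu prog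

inductive run :: "nat set \<Rightarrow> prog \<Rightarrow> nat \<Rightarrow> nat \<Rightarrow> bool" for A :: "nat set" where
  run_Zero: "run A Zero x 0"
| run_Succ: "run A Succ x (Suc x)"
| run_Ident: "run A Ident x x"
| run_Fst: "run A Fst x (fst (prod_decode x))"
| run_Snd: "run A Snd x (snd (prod_decode x))"
| run_Query: "run A Query x (of_bool (x \<in> A))"
| run_Comp: "run A q x y \<Longrightarrow> run A p y z \<Longrightarrow> run A (Comp p q) x z"
| run_Pair: "run A p x y \<Longrightarrow> run A q x z \<Longrightarrow> run A (Pair p q) x (prod_encode (y, z))"
| run_Rec_0: "run A p x y \<Longrightarrow> run A (Rec p q) (prod_encode (x, 0)) y"
| run_Rec_Suc: "run A (Rec p q) (prod_encode (x, n)) y \<Longrightarrow>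
    run A q (prod_encode (x, prod_encode (n, y))) z \<Longrightarrow>
    run A (Rec p q) (prod_encode (x, Suc n)) z"
| run_Mu: "(\<And>i. i < n \<Longrightarrow> \<exists>y. run A p (prod_encode (x, i)) (Suc y)) \<Longrightarrow>
    run A p (prod_encode (x, n)) 0 \<Longrightarrow> run A (Mu p) x n"

inductive_cases run_elims:
  "run A Zero x y" "run A Succ x y" "run A Ident x y" "run A Fst x y" "run A Snd x y"
  "run A Query x y" "run A (Comp p q) x y" "run A (Pair p q) x y" "run A (Rec p q) x y"
  "run A (Mu p) x y"

lemma run_deterministic: "run A p x y \<Longrightarrow> run A p x z \<Longrightarrow> y = z"
proof (induction arbitrary: z rule: run.induct)
  case (run_Comp q x y p z')
  from run_Comp.prems show ?case
    by (rule run_elims(7)) (use run_Comp.IH in blast)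
next
  case (run_Pair p x y q z')
  from run_Pair.prems show ?case
    by (rule run_elims(8)) (use run_Pair.IH in blast)
next
  case (run_Rec_0 p x y q)
  from run_Rec_0.prems show ?case
  proof (rule run_elims(9))
    fix x'
    assume "prod_encode (x, 0) = prod_encode (x', 0)" "run A p x' z"
    then show ?thesis using run_Rec_0.IH by simp
  qed simp
next
  case (run_Rec_Suc p q x n y z')
  from run_Rec_Suc.prems show ?case
  proof (rule run_elims(9))
    fix x' n' y'
    assume *: "prod_encode (x, Suc n) = prod_encode (x', Suc n')"
      "run A (Rec p q) (prod_encode (x', n')) y'"
      "run A q (prod_encode (x', prod_encode (n', y'))) z"
    then have "x' = x" "n' = n" by simp_all
    with * run_Rec_Suc.IH show ?thesis by blast
  qed simp
next
  case (run_Mu n p x)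
  from run_Mu.prems obtain "\<forall>i<z. \<exists>y. run A p (prod_encode (x, i)) (Suc y)"
      and z0: "run A p (prod_encode (x, z)) 0"
    by (rule run_elims(10)) blast
  then have "\<not> n < z" using run_Mu.IH(2) by blast
  moreover have "\<not> z < n" using run_Mu.IH(1) z0 by blast
  ultimately show ?case by simp
qed (erule run_elims; simp)+

primrec prog_code :: "prog \<Rightarrow> nat" where
  "prog_code Zero = 0"
| "prog_code Succ = 1"
| "prog_code Ident = 2"
| "prog_code Fst = 3"
| "prog_code Snd = 4"
| "prog_code Query = 5"
| "prog_code (Comp p q) = 6 + 4 * prod_encode (prog_code p, prog_code q)"
| "prog_code (Pair p q) = 7 + 4 * prod_encode (prog_code p, prog_code q)"
| "prog_code (Rec p q) = 8 + 4 * prod_encode (prog_code p, prog_code q)"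
| "prog_code (Mu p) = 9 + 4 * prog_code p"

lemma prog_code_inject: "prog_code p = prog_code q \<Longrightarrow> p = q"
proof (induction p arbitrary: q)
  case (Comp p1 p2) then show ?case by (cases q; simp; presburger?)
next
  case (Pair p1 p2) then show ?case by (cases q; simp; presburger?)
next
  case (Rec p1 p2) then show ?case by (cases q; simp; presburger?)
next
  case (Mu p) then show ?case by (cases q; simp; presburger?)
qed (case_tac q; simp)+

definition oracle_phi :: "nat set \<Rightarrow> nat \<Rightarrow> nat \<Rightarrow> nat \<Rightarrow> bool" where
  "oracle_phi A e x y \<longleftrightarrow> (\<exists>p. prog_code p = e \<and> run A p x y)"

abbreviation phi :: "nat \<Rightarrow> nat \<Rightarrow> nat \<Rightarrow> bool" where
  "phi \<equiv> oracle_phi {}"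

lemma oracle_phi_deterministic: "oracle_phi A e x y \<Longrightarrow> oracle_phi A e x z \<Longrightarrow> y = z"
  unfolding oracle_phi_def using prog_code_inject run_deterministic by blast

definition computable_from :: "nat set \<Rightarrow> (nat \<Rightarrow> nat) \<Rightarrow> bool" where
  "computable_from A g \<longleftrightarrow> (\<exists>e. \<forall>x. oracle_phi A e x (g x))"

definition jump :: "nat set \<Rightarrow> nat set" where
  "jump A = {e. \<exists>y. oracle_phi A e e y}"


section \<open>Ordinal notations and hyperarithmetic sets\<close>

text \<open>Kleene's coding: 1 denotes zero, \<open>2 ^ a\<close> the successor of \<open>a\<close>, and \<open>3 * 5 ^ e\<close> the limit of
  the sequence enumerated by the \<open>e\<close>-th computable function.  The guard \<open>a \<noteq> 0\<close> keeps
  \<open>2 ^ 0 = 1\<close> minimal.\<close>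

inductive star_step :: "nat \<Rightarrow> nat \<Rightarrow> bool" where
  star_succ: "a \<noteq> 0 \<Longrightarrow> star_step a (2 ^ a)"
| star_lim: "phi e n b \<Longrightarrow> star_step b (3 * 5 ^ e)"

definition less_star :: "nat \<Rightarrow> nat \<Rightarrow> bool" (infix "<\<^sub>*" 50) where
  "a <\<^sub>* b \<longleftrightarrow> star_step\<^sup>+\<^sup>+ a b"

definition le_star :: "nat \<Rightarrow> nat \<Rightarrow> bool" (infix "\<le>\<^sub>*" 50) where
  "a \<le>\<^sub>* b \<longleftrightarrow> a = b \<or> a <\<^sub>* b"

inductive_set KO :: "nat set" where
  KO_one: "1 \<in> KO"
| KO_succ: "a \<in> KO \<Longrightarrow> 2 ^ a \<in> KO"
| KO_lim: "(\<And>n. phi e n (s n)) \<Longrightarrow> (\<And>n. s n \<in> KO) \<Longrightarrow> (\<And>n. s n <\<^sub>* s (Suc n)) \<Longrightarrow>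
    3 * 5 ^ e \<in> KO"

text \<open>\<open>Hset a A\<close> says that \<open>A\<close> is the set \<open>H\<^sub>a\<close> of the transfinite jump hierarchy along Kleene's
  notations.\<close>

inductive Hset :: "nat \<Rightarrow> nat set \<Rightarrow> bool" where
  Hset_one: "Hset 1 {}"
| Hset_succ: "a \<in> KO \<Longrightarrow> Hset a A \<Longrightarrow> Hset (2 ^ a) (jump A)"
| Hset_lim: "3 * 5 ^ e \<in> KO \<Longrightarrow> (\<And>n. phi e n (s n)) \<Longrightarrow> (\<And>n. Hset (s n) (A n)) \<Longrightarrow>
    Hset (3 * 5 ^ e) {prod_encode (x, n) | x n. x \<in> A n}"

definition hyp_fun :: "(nat \<Rightarrow> nat) \<Rightarrow> bool" where
  "hyp_fun g \<longleftrightarrow> (\<exists>a\<in>KO. \<exists>A. Hset a A \<and> computable_from A g)"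

definition HYP :: "nat set set" where
  "HYP = {X. hyp_fun (\<lambda>n. of_bool (n \<in> X))}"

text \<open>A number is a (pseudo-)notation if it and everything \<open><\<^sub>*\<close>-below it obeys Kleene's formation
  clauses; elements of \<open>KO_star\<close> are those that \<^const>\<open>HYP\<close> believes to be well-founded.\<close>

definition well_formed :: "nat \<Rightarrow> bool" where
  "well_formed b \<longleftrightarrow> b = 1 \<or> (\<exists>c. c \<noteq> 0 \<and> b = 2 ^ c) \<or>
    (\<exists>e s. b = 3 * 5 ^ e \<and> (\<forall>n. phi e n (s n) \<and> s n <\<^sub>* s (Suc n)))"

definition KO_star :: "nat set" where
  "KO_star = {a. (\<forall>b. b \<le>\<^sub>* a \<longrightarrow> well_formed b) \<and>
    \<not> (\<exists>d. hyp_fun d \<and> d 0 \<le>\<^sub>* a \<and> (\<forall>n. d (Suc n) <\<^sub>* d n))}"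

lemma two_power_neq_lim: "(2::nat) ^ a \<noteq> 3 * 5 ^ e"
proof (cases a)
  case (Suc n)
  then have "even ((2::nat) ^ a)" by simp
  moreover have "odd (3 * (5::nat) ^ e)" by simp
  ultimately show ?thesis by metis
qed simp

lemma KO_nonzero: "a \<in> KO \<Longrightarrow> a \<noteq> 0"
  by (induction rule: KO.induct) auto

lemma star_step_one: "\<not> star_step b 1"
proof
  assume "star_step b 1"
  then show False
  proof cases
    case star_succ
    then show False using less_exp[of b] by simp
  next
    case (star_lim e n)
    then show False using two_power_neq_lim[of 0 e] by simp
  qed
qed

lemma star_step_power: "star_step b (2 ^ a) \<Longrightarrow> b = a"
  using two_power_neq_lim[of a] by (auto elim!: star_step.cases)

lemma star_step_lim: "star_step b (3 * 5 ^ e) \<Longrightarrow> \<exists>n. phi e n b"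
  using two_power_neq_lim[of b e] by (auto elim!: star_step.cases)

lemma KO_step: "a \<in> KO \<Longrightarrow> star_step b a \<Longrightarrow> b \<in> KO"
proof (induction rule: KO.cases)
  case KO_one then show ?case using star_step_one by simp
next
  case (KO_succ a) then show ?case using star_step_power by blast
next
  case (KO_lim e s) then show ?case using star_step_lim oracle_phi_deterministic by metis
qed

lemma KO_less: "b <\<^sub>* a \<Longrightarrow> a \<in> KO \<Longrightarrow> b \<in> KO"
  unfolding less_star_def by (induction rule: tranclp_induct) (auto intro: KO_step)

lemma KO_accp: "a \<in> KO \<Longrightarrow> Wellfounded.accp star_step a"
proof (induction rule: KO.induct)
  case KO_one then show ?case using star_step_one by (auto intro: accp.accI)
next
  case (KO_succ a) then show ?case by (auto intro: accp.accI dest: star_step_power)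
next
  case (KO_lim e s) then show ?case
    by (metis accp.accI star_step_lim oracle_phi_deterministic)
qed

lemma KO_well_formed: "a \<in> KO \<Longrightarrow> well_formed a"
proof (induction rule: KO.cases)
  case (KO_succ b)
  then show ?case using KO_nonzero by (auto simp: well_formed_def)
next
  case (KO_lim e s)
  then show ?case unfolding well_formed_def by blast
qed (simp add: well_formed_def)

lemma KO_subset_KO_star: "KO \<subseteq> KO_star"
proof
  fix a assume a: "a \<in> KO"
  have desc: "Wellfounded.accp star_step x \<Longrightarrow> d 0 = x \<or> d 0 <\<^sub>* x \<Longrightarrow>
      \<not> (\<forall>n. d (Suc n) <\<^sub>* d n)" for x d
  proof (induction arbitrary: d rule: accp.induct)
    case (accI x)
    show ?case
    proof
      assume d: "\<forall>n. d (Suc n) <\<^sub>* d n"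
      then have "d 1 <\<^sub>* d 0" by simp
      then have "d 1 <\<^sub>* x"
        using accI.prems unfolding less_star_def by (auto intro: tranclp_trans)
      then obtain y where y: "star_step y x" "d 1 = y \<or> d 1 <\<^sub>* y"
        unfolding less_star_def by (cases rule: tranclp.cases) auto
      have "\<not> (\<forall>n. d (Suc (Suc n)) <\<^sub>* d (Suc n))"
        using accI.IH[OF y(1), of "\<lambda>n. d (Suc n)"] y(2) by simp
      then show False using d by blast
    qed
  qed
  have "\<not> (d 0 \<le>\<^sub>* a \<and> (\<forall>n. d (Suc n) <\<^sub>* d n))" for d
    using desc[OF KO_accp[OF a], of d] unfolding le_star_def by blast
  then show "a \<in> KO_star"
    using a KO_less KO_well_formed unfolding KO_star_def le_star_def by blast
qed

lemma Hset_total: "a \<in> KO \<Longrightarrow> \<exists>A. Hset a A"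
proof (induction rule: KO.induct)
  case KO_one then show ?case using Hset_one by blast
next
  case (KO_succ a) then show ?case using Hset_succ by blast
next
  case (KO_lim e s)
  then obtain A where "\<And>n. Hset (s n) (A n)" by metis
  moreover have "3 * 5 ^ e \<in> KO" using KO_lim.hyps by (rule KO.KO_lim)
  ultimately show ?case using Hset_lim[of e s A] KO_lim.hyps(1) by blast
qed

lemma Hset_unique: "Hset a A \<Longrightarrow> Hset a B \<Longrightarrow> A = B"
proof (induction arbitrary: B rule: Hset.induct)
  case Hset_one
  from Hset_one.prems show ?case
  proof (cases rule: Hset.cases)
    case (Hset_succ a A)
    then show ?thesis using KO_nonzero[of a] less_exp[of a] by simp
  next
    case (Hset_lim e s A)
    then show ?thesis using two_power_neq_lim[of 0 e] by simp
  qed simp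
next
  case (Hset_succ a A)
  from Hset_succ.prems show ?case
  proof (cases rule: Hset.cases)
    case Hset_one
    then show ?thesis using KO_nonzero[OF \<open>a \<in> KO\<close>] by simp
  next
    case (Hset_succ a' A')
    then have "a' = a" by simp
    then have "Hset a A'" using Hset_succ by simp
    then have "A = A'" by (rule \<open>\<And>B. Hset a B \<Longrightarrow> A = B\<close>)
    then show ?thesis using Hset_succ by simp
  next
    case (Hset_lim e s A')
    then show ?thesis using two_power_neq_lim by blast
  qed
next
  case (Hset_lim e s A)
  note lim_hyps = Hset_lim.hyps and lim_IH = Hset_lim.IH
  from Hset_lim.prems show ?case
  proof (cases rule: Hset.cases)
    case Hset_one
    then show ?thesis using two_power_neq_lim[of 0 e] by simp
  next
    case (Hset_succ a' A')
    then show ?thesis using two_power_neq_lim[of a' e] by simp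
  next
    case (Hset_lim e' s' A')
    then have "e' = e" by simp
    then have "s' n = s n" for n
      using Hset_lim(4)[of n] lim_hyps(2)[of n] oracle_phi_deterministic by blast
    then have "Hset (s n) (A' n)" for n using Hset_lim(5)[of n] by simp
    then have "A n = A' n" for n by (rule lim_IH)
    then show ?thesis using Hset_lim(2) by simp
  qed
qed


section \<open>Ranked labeled Borel codes\<close>

text \<open>A number encodes a pair \<open>(k, F)\<close> with \<open>F\<close> a finite set; it stands for the clopen set of all \<open>X\<close>
  whose restriction to \<open>k\<close> bits, read as a binary number, lies in \<open>F\<close>.  Points of Cantor space are
  identified with sets of naturals.\<close>

definition clopen_set :: "nat \<Rightarrow> nat set set" where
  "clopen_set c = (case prod_decode c of (k, m) \<Rightarrow>
    {X. set_encode (X \<inter> {..<k}) \<in> set_decode m})"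

definition clopen_compl :: "nat \<Rightarrow> nat" where
  "clopen_compl c = (case prod_decode c of (k, m) \<Rightarrow>
    prod_encode (k, set_encode ({..<2 ^ k} - set_decode m)))"

lemma set_encode_less: "set_encode (X \<inter> {..<k}) < 2 ^ k"
proof -
  have "set_encode (X \<inter> {..<k}) \<le> (\<Sum>i<k. 2 ^ i)"
    unfolding set_encode_def by (rule sum_mono2) auto
  also have "\<dots> < 2 ^ k" by (induction k) auto
  finally show ?thesis .
qed

lemma clopen_set_compl: "clopen_set (clopen_compl c) = - clopen_set c"
  by (auto simp: clopen_set_def clopen_compl_def set_encode_less split: prod.splits)

datatype label = Union | Inter | Clopen nat

text \<open>A code is a partial function whose domain is the tree and which assigns to each node its label
  and its rank, so that equality of codes is equality of trees, labels and ranks.\<close>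

type_synonym code = "nat list \<rightharpoonup> label \<times> nat"

definition lab :: "code \<Rightarrow> nat list \<Rightarrow> label" where
  "lab T \<sigma> = fst (the (T \<sigma>))"

definition rk :: "code \<Rightarrow> nat list \<Rightarrow> nat" where
  "rk T \<sigma> = snd (the (T \<sigma>))"

abbreviation rank :: "code \<Rightarrow> nat" where
  "rank T \<equiv> rk T []"

definition labeled_Borel_code :: "code \<Rightarrow> bool" where
  "labeled_Borel_code T \<longleftrightarrow>
    [] \<in> dom T \<and>
    (\<forall>\<sigma> n. \<sigma> @ [n] \<in> dom T \<longrightarrow> \<sigma> \<in> dom T) \<and>
    (\<forall>\<sigma>\<in>dom T. if \<exists>n. \<sigma> @ [n] \<in> dom T then lab T \<sigma> \<in> {Union, Inter}
                 else lab T \<sigma> \<in> range Clopen)"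

definition ranked_Borel_code :: "nat \<Rightarrow> code \<Rightarrow> bool" where
  "ranked_Borel_code \<alpha> T \<longleftrightarrow>
    labeled_Borel_code T \<and>
    (\<forall>\<sigma>\<in>dom T. rk T \<sigma> \<in> KO_star \<and> rk T \<sigma> \<le>\<^sub>* \<alpha>) \<and>
    (\<forall>\<sigma> n. \<sigma> @ [n] \<in> dom T \<longrightarrow> rk T (\<sigma> @ [n]) <\<^sub>* rk T \<sigma>)"

text \<open>Partial functions on strings as total functions on the naturals, with value 0 outside the
  domain.\<close>

definition string_fun :: "('a \<Rightarrow> nat) \<Rightarrow> (nat list \<rightharpoonup> 'a) \<Rightarrow> nat \<Rightarrow> nat" where
  "string_fun enc f s = (case f (list_decode s) of None \<Rightarrow> 0 | Some v \<Rightarrow> Suc (enc v))"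

primrec label_encode :: "label \<Rightarrow> nat" where
  "label_encode Union = 0"
| "label_encode Inter = 1"
| "label_encode (Clopen c) = c + 2"

definition code_fun :: "code \<Rightarrow> nat \<Rightarrow> nat" where
  "code_fun = string_fun (\<lambda>(l, r). prod_encode (label_encode l, r))"

definition computable_code :: "code \<Rightarrow> bool" where
  "computable_code T \<longleftrightarrow> computable_from {} (code_fun T)"

definition hyp_code_seq :: "(nat \<Rightarrow> code) \<Rightarrow> bool" where
  "hyp_code_seq P \<longleftrightarrow> hyp_fun (\<lambda>x. case prod_decode x of (n, s) \<Rightarrow> code_fun (P n) s)"


section \<open>Evaluation in HYP\<close>

definition evaluation_map :: "nat set \<Rightarrow> code \<Rightarrow> (nat list \<rightharpoonup> bool) \<Rightarrow> bool" where
  "evaluation_map X T f \<longleftrightarrow> dom f = dom T \<and>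
    (\<forall>\<sigma>\<in>dom T. f \<sigma> = Some True \<longleftrightarrow>
      (case lab T \<sigma> of
        Clopen c \<Rightarrow> X \<in> clopen_set c
      | Union \<Rightarrow> \<exists>n. \<sigma> @ [n] \<in> dom T \<and> f (\<sigma> @ [n]) = Some True
      | Inter \<Rightarrow> \<forall>n. \<sigma> @ [n] \<in> dom T \<longrightarrow> f (\<sigma> @ [n]) = Some True))"

definition HYP_evaluation_map :: "nat set \<Rightarrow> code \<Rightarrow> (nat list \<rightharpoonup> bool) \<Rightarrow> bool" where
  "HYP_evaluation_map X T f \<longleftrightarrow> evaluation_map X T f \<and> hyp_fun (string_fun of_bool f)"

definition HYP_interp :: "code \<Rightarrow> nat set set" where
  "HYP_interp T = {X \<in> HYP. \<exists>f. HYP_evaluation_map X T f \<and> f [] = Some True}"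

definition HYP_completely_determined :: "code \<Rightarrow> bool" where
  "HYP_completely_determined T \<longleftrightarrow> (\<forall>X\<in>HYP. \<exists>f. HYP_evaluation_map X T f)"


section \<open>Decoration\<close>

primrec neg_label :: "label \<Rightarrow> label" where
  "neg_label Union = Inter"
| "neg_label Inter = Union"
| "neg_label (Clopen c) = Clopen (clopen_compl c)"

definition neg_code :: "code \<Rightarrow> code" where
  "neg_code T = (\<lambda>\<sigma>. map_option (\<lambda>(l, r). (neg_label l, r)) (T \<sigma>))"

definition subtree :: "code \<Rightarrow> nat \<Rightarrow> code" where
  "subtree T n = (\<lambda>\<sigma>. T (n # \<sigma>))"

text \<open>The recursion is on the node, as the tree may be ill-founded.  Child \<open>2 * n\<close> of the root is the
  decoration of the \<open>n\<close>-th child, if present; child \<open>2 * n + 1\<close> is the decoration of \<open>P n\<close> or of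
  the negation of \<open>N n\<close>.\<close>

fun decorate :: "(nat \<Rightarrow> code) \<Rightarrow> (nat \<Rightarrow> code) \<Rightarrow> code \<Rightarrow> code" where
  "decorate P N T [] = T []"
| "decorate P N T (m # \<sigma>) = (case T [] of
      None \<Rightarrow> None
    | Some (Clopen c, r) \<Rightarrow> None
    | Some (l, r) \<Rightarrow>
        if even m then
          (if [m div 2] \<in> dom T then decorate P N (subtree T (m div 2)) \<sigma> else None)
        else if l = Union then
          (if rank (P (m div 2)) <\<^sub>* r then decorate P N (P (m div 2)) \<sigma> else None)
        else
          (if rank (N (m div 2)) <\<^sub>* r then decorate P N (neg_code (N (m div 2))) \<sigma> else None))"

definition with_rank_in_KO :: "code set \<Rightarrow> code set" where
  "with_rank_in_KO \<Q> = {Q \<in> \<Q>. rank Q \<in> KO}"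

end

theory Submission
  imports Defs
begin

text \<open>
  Choose a pseudo-notation \<open>\<delta>\<close> below \<open>\<alpha>\<close> and let \<open>T\<close> be a single union node of rank \<open>\<delta>\<close> over an empty
  leaf.  If \<open>X\<close> is decided by a code of rank \<open>\<gamma>\<close> in \<^const>\<open>KO\<close>, then below rank \<open>\<gamma>\<close> the decorations are
  neutral, while above \<open>\<gamma>\<close> the deciding code fixes the value of every union node (if it lies in \<open>P\<close>) or
  of every intersection node (if it lies in \<open>N\<close>); nodes of the other kind are settled by following
  them down to nodes whose value is already known.  This evaluation map is hyperarithmetic, and it is
  the only one, because the least rank of a disagreement would exist.  The root gets the right value
  provided that no code in \<open>P\<close> of rank below \<open>\<delta>\<close> is inductively true at a point decided by \<open>N\<close>.
  Uniqueness gives this for all ranks in \<^const>\<open>KO\<close>, and it overspills to some \<open>\<delta>\<close> outside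
  \<^const>\<open>KO\<close>.

  All definability is carried by open games with computable moves: the predicates \<open>R\<close> such that
  \<open>R x\<close> means that a certain player wins are closed under quantifiers and inductive
  definitions, and include \<^const>\<open>KO\<close> and the jump hierarchy.  If both \<open>R\<close> and its negation have such
  games, then \<open>R\<close> is hyperarithmetic: let two players build strategies against the two games in
  turn; this is a game of finite plays, whose value is computed along a notation in \<^const>\<open>KO\<close>.
\<close>

text \<open>No rank in \<open>KO\<close> is sure to exceed the ranks of all codes to be collected,
  so the root gets a rank outside \<open>KO\<close> and the decorated tree may be ill-founded. Truth
  in such a tree has no recursive definition, but an evaluation map only has to satisfy the local
  clauses. That leaves room to prescribe it, and the code that decides \<open>X\<close> tells what
  to prescribe. The map depends on \<open>X\<close> through the rank and the side of that code,
  which is harmless since each point may have a map of its own.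

  The root also attaches codes of rank outside \<open>KO\<close>, about which the uniqueness
  hypothesis says nothing directly. For them truth is replaced by derivability \<open>evt\<close>,
  which makes sense for every rank, is Pi-1-1 uniformly in an index of \<open>X\<close>, and is
  truth for ranks in \<open>KO\<close>. So a conflict between derivable codes is a Pi-1-1 event, and
  this is what overspill can push beyond \<open>KO\<close>.\<close>

abbreviation p1 :: "nat \<Rightarrow> nat" where "p1 x \<equiv> fst (prod_decode x)"
abbreviation p2 :: "nat \<Rightarrow> nat" where "p2 x \<equiv> snd (prod_decode x)"
abbreviation pr :: "nat \<Rightarrow> nat \<Rightarrow> nat" where "pr x y \<equiv> prod_encode (x, y)"

section \<open>Total recursive functions\<close>

text \<open>One program serves for all oracles, so an index obtained here can be used relative to
  every set of the jump hierarchy.\<close>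

definition recfn :: "(nat \<Rightarrow> nat) \<Rightarrow> bool" where
  "recfn f \<longleftrightarrow> (\<exists>p. \<forall>A x. run A p x (f x))"

definition recpred :: "(nat \<Rightarrow> bool) \<Rightarrow> bool" where
  "recpred P \<longleftrightarrow> recfn (\<lambda>x. of_bool (P x))"

named_theorems rec_intros

lemma recfn_comp: "recfn f \<Longrightarrow> recfn g \<Longrightarrow> recfn (\<lambda>x. f (g x))"
  unfolding recfn_def using run_Comp by blast

lemma recfn_id [rec_intros]: "recfn (\<lambda>x. x)"
  unfolding recfn_def using run_Ident by blast

lemma recfn_Suc [rec_intros]: "recfn f \<Longrightarrow> recfn (\<lambda>x. Suc (f x))"
  by (rule recfn_comp[of Suc]) (use run_Succ in \<open>auto simp: recfn_def\<close>)

lemma recfn_p1 [rec_intros]: "recfn f \<Longrightarrow> recfn (\<lambda>x. p1 (f x))"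
  by (rule recfn_comp[of p1]) (use run_Fst in \<open>auto simp: recfn_def\<close>)

lemma recfn_p2 [rec_intros]: "recfn f \<Longrightarrow> recfn (\<lambda>x. p2 (f x))"
  by (rule recfn_comp[of p2]) (use run_Snd in \<open>auto simp: recfn_def\<close>)

lemma recfn_pr [rec_intros]: "recfn f \<Longrightarrow> recfn g \<Longrightarrow> recfn (\<lambda>x. pr (f x) (g x))"
  unfolding recfn_def using run_Pair by blast

lemma recfn_const [rec_intros]: "recfn (\<lambda>x. c)"
proof (induction c)
  case 0 then show ?case unfolding recfn_def using run_Zero by blast
next
  case (Suc c) then show ?case by (rule recfn_Suc)
qed

lemma run_Rec:
  assumes "\<And>x. run A p x (b x)" "\<And>x n y. run A q (pr x (pr n y)) (s x n y)"
  shows "run A (Rec p q) (pr x n) (rec_nat (b x) (s x) n)"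
  by (induction n) (auto intro: run_Rec_0 run_Rec_Suc assms)

lemma recfn_rec [rec_intros]:
  assumes "recfn b" "recfn (\<lambda>z. s (p1 z) (p1 (p2 z)) (p2 (p2 z)))" "recfn h"
  shows "recfn (\<lambda>x. rec_nat (b x) (s x) (h x))"
proof -
  obtain p where p: "\<And>A x. run A p x (b x)" using assms(1) unfolding recfn_def by blast
  obtain q where "\<And>A z. run A q z (s (p1 z) (p1 (p2 z)) (p2 (p2 z)))"
    using assms(2) unfolding recfn_def by blast
  from this[of _ "pr _ (pr _ _)"] have q: "\<And>A x n y. run A q (pr x (pr n y)) (s x n y)" by simp
  have "recfn (\<lambda>x. rec_nat (b (p1 x)) (s (p1 x)) (p2 x))"
    unfolding recfn_def
  proof (intro exI allI)
    fix A x
    show "run A (Rec p q) x (rec_nat (b (p1 x)) (s (p1 x)) (p2 x))"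
      using run_Rec[of A p b q s "p1 x" "p2 x", OF p q] by simp
  qed
  then have "recfn (\<lambda>x. (\<lambda>x. rec_nat (b (p1 x)) (s (p1 x)) (p2 x)) (pr x (h x)))"
    by (rule recfn_comp) (intro rec_intros assms)
  then show ?thesis by simp
qed

lemma recfn_binary:
  assumes "recfn (\<lambda>z. h (p1 z) (p2 z))" "recfn f" "recfn g"
  shows "recfn (\<lambda>x. h (f x) (g x))"
  using recfn_comp[OF assms(1) recfn_pr[OF assms(2,3)]] by simp

lemma recfn_add [rec_intros]: "recfn f \<Longrightarrow> recfn g \<Longrightarrow> recfn (\<lambda>x. f x + g x)"
proof -
  have "m + n = rec_nat m (\<lambda>_. Suc) n" for m n by (induction n) auto
  then show "recfn f \<Longrightarrow> recfn g \<Longrightarrow> recfn (\<lambda>x. f x + g x)"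
    by (simp, intro rec_intros)
qed

lemma recfn_mult [rec_intros]: "recfn f \<Longrightarrow> recfn g \<Longrightarrow> recfn (\<lambda>x. f x * g x)"
proof -
  have "m * n = rec_nat 0 (\<lambda>_ y. y + m) n" for m n by (induction n) auto
  then have "recfn (\<lambda>z. p1 z * p2 z)" by (simp only:) (intro rec_intros)
  from recfn_binary[OF this] show "recfn f \<Longrightarrow> recfn g \<Longrightarrow> recfn (\<lambda>x. f x * g x)" .
qed

lemma recfn_power [rec_intros]: "recfn f \<Longrightarrow> recfn g \<Longrightarrow> recfn (\<lambda>x. f x ^ g x)"
proof -
  have "m ^ n = rec_nat 1 (\<lambda>_ y. y * m) n" for m n :: nat by (induction n) auto
  then have "recfn (\<lambda>z. p1 z ^ p2 z)" by (simp only:) (intro rec_intros)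
  from recfn_binary[OF this] show "recfn f \<Longrightarrow> recfn g \<Longrightarrow> recfn (\<lambda>x. f x ^ g x)" .
qed

lemma recfn_minus [rec_intros]: "recfn f \<Longrightarrow> recfn g \<Longrightarrow> recfn (\<lambda>x. f x - g x)"
proof -
  have 1: "n - 1 = rec_nat 0 (\<lambda>k _. k) n" for n by (induction n) auto
  have 2: "m - n = rec_nat m (\<lambda>_ y. y - 1) n" for m n by (induction n) auto
  have "recfn f \<Longrightarrow> recfn (\<lambda>x. f x - 1)" for f
    unfolding 1 by (intro rec_intros)
  note [rec_intros] = this
  assume "recfn f" "recfn g"
  then have "recfn (\<lambda>x. rec_nat (f x) (\<lambda>_ y. y - 1) (g x))" by (intro rec_intros)
  then show "recfn (\<lambda>x. f x - g x)" by (simp only: 2[symmetric])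
qed

lemma recpred_le [rec_intros]: "recfn f \<Longrightarrow> recfn g \<Longrightarrow> recpred (\<lambda>x. f x \<le> g x)"
proof -
  have "of_bool (m \<le> n) = 1 - (m - n)" for m n :: nat by auto
  then show "recfn f \<Longrightarrow> recfn g \<Longrightarrow> recpred (\<lambda>x. f x \<le> g x)"
    unfolding recpred_def by (simp only:) (intro rec_intros)
qed

lemma recpred_not [rec_intros]: "recpred P \<Longrightarrow> recpred (\<lambda>x. \<not> P x)"
proof -
  have "of_bool (\<not> b) = (1::nat) - of_bool b" for b by auto
  then show "recpred P \<Longrightarrow> recpred (\<lambda>x. \<not> P x)"
    unfolding recpred_def by (simp only:) (intro rec_intros)
qed

lemma recpred_conj [rec_intros]: "recpred P \<Longrightarrow> recpred Q \<Longrightarrow> recpred (\<lambda>x. P x \<and> Q x)"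
  unfolding recpred_def of_bool_conj by (intro rec_intros)

lemma recpred_disj [rec_intros]: "recpred P \<Longrightarrow> recpred Q \<Longrightarrow> recpred (\<lambda>x. P x \<or> Q x)"
  using recpred_not[OF recpred_conj[OF recpred_not recpred_not], of P Q] by simp

lemma recpred_less [rec_intros]: "recfn f \<Longrightarrow> recfn g \<Longrightarrow> recpred (\<lambda>x. f x < g x)"
  unfolding less_eq_Suc_le by (intro rec_intros)

lemma recpred_eq [rec_intros]: "recfn f \<Longrightarrow> recfn g \<Longrightarrow> recpred (\<lambda>x. f x = g x)"
  using recpred_conj[OF recpred_le recpred_le, of f g g f] by (simp add: order_eq_iff)

lemma recpred_const [rec_intros]: "recpred (\<lambda>x. c)"
  unfolding recpred_def by (intro rec_intros)

lemma recfn_if [rec_intros]: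
  "recpred P \<Longrightarrow> recfn f \<Longrightarrow> recfn g \<Longrightarrow> recfn (\<lambda>x. if P x then f x else g x)"
proof -
  have "(if b then m else n) = rec_nat n (\<lambda>_ _. m) (of_bool b)" for b and m n :: nat by auto
  note if_eq = this
  assume P: "recpred P" and f: "recfn f" and g: "recfn g"
  have "recfn (\<lambda>x. rec_nat (g x) (\<lambda>_ _. f x) (of_bool (P x)))"
    using P recfn_comp[OF f] by (intro rec_intros g) (auto simp: recpred_def intro: rec_intros)
  then show "recfn (\<lambda>x. if P x then f x else g x)" by (simp only: if_eq[symmetric])
qed

lemma recpred_comp: "recpred P \<Longrightarrow> recfn f \<Longrightarrow> recpred (\<lambda>x. P (f x))"
  unfolding recpred_def by (rule recfn_comp)

lemma recpred_if [rec_intros]: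
  "recpred P \<Longrightarrow> recpred Q \<Longrightarrow> recpred R \<Longrightarrow> recpred (\<lambda>x. if P x then Q x else R x)"
  unfolding recpred_def if_distrib[of of_bool] by (intro rec_intros) (auto simp: recpred_def)

lemma recfn_mod [rec_intros]: "recfn f \<Longrightarrow> recfn g \<Longrightarrow> recfn (\<lambda>x. f x mod g x)"
proof -
  have eq: "m mod n = rec_nat 0 (\<lambda>_ y. if Suc y = n then 0 else Suc y) m" for m n
    by (induction m) (auto simp: mod_Suc)
  have "recfn (\<lambda>z. p1 z mod p2 z)"
    unfolding eq by (intro rec_intros)
  from recfn_binary[OF this] show "recfn f \<Longrightarrow> recfn g \<Longrightarrow> recfn (\<lambda>x. f x mod g x)" .
qed

lemma recfn_div [rec_intros]: "recfn f \<Longrightarrow> recfn g \<Longrightarrow> recfn (\<lambda>x. f x div g x)"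
proof -
  have eq: "m div n = rec_nat 0 (\<lambda>k y. if Suc k mod n = 0 then Suc y else y) m" for m n
    by (induction m) (auto simp: div_Suc)
  have "recfn (\<lambda>z. p1 z div p2 z)"
    unfolding eq by (intro rec_intros)
  from recfn_binary[OF this] show "recfn f \<Longrightarrow> recfn g \<Longrightarrow> recfn (\<lambda>x. f x div g x)" .
qed

lemma recpred_even [rec_intros]: "recfn f \<Longrightarrow> recpred (\<lambda>x. even (f x))"
  unfolding even_iff_mod_2_eq_zero by (intro rec_intros)

section \<open>Coded sequences\<close>

definition ccons :: "nat \<Rightarrow> nat \<Rightarrow> nat" where "ccons x l = Suc (pr x l)"
definition chd :: "nat \<Rightarrow> nat" where "chd l = p1 (l - 1)"
definition ctl :: "nat \<Rightarrow> nat" where "ctl l = (if l = 0 then 0 else p2 (l - 1))"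
definition cnth :: "nat \<Rightarrow> nat \<Rightarrow> nat" where "cnth l i = chd (rec_nat l (\<lambda>_. ctl) i)"

lemma ccons_simps [simp]: "chd (ccons x l) = x" "ctl (ccons x l) = l" "ccons x l \<noteq> 0"
  by (simp_all add: ccons_def chd_def ctl_def)

lemma rec_ctl_Suc: "rec_nat l (\<lambda>_. ctl) (Suc i) = rec_nat (ctl l) (\<lambda>_. ctl) i"
  by (induction i) auto

lemma cnth_simps [simp]: "cnth (ccons x l) 0 = x" "cnth (ccons x l) (Suc i) = cnth l i"
  unfolding cnth_def rec_ctl_Suc by simp_all

lemma recfn_ccons [rec_intros]: "recfn f \<Longrightarrow> recfn g \<Longrightarrow> recfn (\<lambda>x. ccons (f x) (g x))"
  unfolding ccons_def by (intro rec_intros)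

lemma recfn_chd [rec_intros]: "recfn f \<Longrightarrow> recfn (\<lambda>x. chd (f x))"
  unfolding chd_def by (intro rec_intros)

lemma recfn_ctl [rec_intros]: "recfn f \<Longrightarrow> recfn (\<lambda>x. ctl (f x))"
  unfolding ctl_def by (intro rec_intros)

lemma recfn_cnth [rec_intros]: "recfn f \<Longrightarrow> recfn g \<Longrightarrow> recfn (\<lambda>x. cnth (f x) (g x))"
  unfolding cnth_def by (intro rec_intros)

text \<open>Turns a quantifier over finite sequences into a quantifier over numbers.\<close>

lemma cnth_exists: "\<exists>l. \<forall>i\<le>n. cnth l i = f i"
proof (induction n arbitrary: f)
  case 0
  have "cnth (ccons (f 0) 0) 0 = f 0" by simp
  then show ?case by blast
next
  case (Suc n)
  from Suc[of "\<lambda>i. f (Suc i)"] obtain l where l: "\<forall>i\<le>n. cnth l i = f (Suc i)" by blast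
  have "cnth (ccons (f 0) l) i = f i" if "i \<le> Suc n" for i
    using that l by (cases i) auto
  then show ?case by blast
qed

text \<open>The argument bounds the number of rounds: the code of a list is at least its length, and
  once the first component is \<open>0\<close> nothing changes. Reversal gives access to the end of
  a path, where children are appended.\<close>

definition crev :: "nat \<Rightarrow> nat" where
  "crev l = p2 (rec_nat (pr l 0)
     (\<lambda>_ z. if p1 z = 0 then z else pr (ctl (p1 z)) (ccons (chd (p1 z)) (p2 z))) l)"

definition csnoc :: "nat \<Rightarrow> nat \<Rightarrow> nat" where
  "csnoc l m = crev (ccons m (crev l))"

lemma ccons_list_encode: "ccons x (list_encode xs) = list_encode (x # xs)"
  by (simp add: ccons_def)

lemma length_le_list_encode: "length xs \<le> list_encode xs"
proof (induction xs)
  case (Cons x xs)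
  then show ?case using le_prod_encode_2[of "list_encode xs" x] by simp
qed simp

lemma crev_list_encode: "crev (list_encode xs) = list_encode (rev xs)"
proof -
  have "rec_nat (pr (list_encode xs) 0)
     (\<lambda>_ z. if p1 z = 0 then z else pr (ctl (p1 z)) (ccons (chd (p1 z)) (p2 z))) n
     = pr (list_encode (drop n xs)) (list_encode (rev (take n xs)))" for n
  proof (induction n)
    case (Suc n)
    show ?case
    proof (cases "n < length xs")
      case True
      then have d: "drop n xs = xs ! n # drop (Suc n) xs" by (simp add: Cons_nth_drop_Suc)
      have e: "list_encode (drop n xs) = ccons (xs ! n) (list_encode (drop (Suc n) xs))"
        unfolding d by (simp add: ccons_list_encode)
      show ?thesis using True
        by (simp add: Suc e take_Suc_conv_app_nth flip: ccons_list_encode del: list_encode.simps)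
    next
      case False
      then show ?thesis by (simp add: Suc)
    qed
  qed simp
  then show ?thesis unfolding crev_def using length_le_list_encode[of xs] by simp
qed

lemma csnoc_list_encode: "csnoc (list_encode xs) m = list_encode (xs @ [m])"
  by (simp add: csnoc_def crev_list_encode ccons_list_encode del: list_encode.simps)

lemma recfn_csnoc [rec_intros]: "recfn f \<Longrightarrow> recfn g \<Longrightarrow> recfn (\<lambda>x. csnoc (f x) (g x))"
proof -
  have "recfn f \<Longrightarrow> recfn (\<lambda>x. crev (f x))" for f
    unfolding crev_def by (intro rec_intros)
  note [rec_intros] = this
  show "recfn f \<Longrightarrow> recfn g \<Longrightarrow> recfn (\<lambda>x. csnoc (f x) (g x))"
    unfolding csnoc_def by (intro rec_intros)
qed

section \<open>Program codes and the recursion theorem\<close>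

primrec const_prog :: "nat \<Rightarrow> prog" where
  "const_prog 0 = Zero"
| "const_prog (Suc n) = Comp Succ (const_prog n)"

lemma run_const_prog: "run A (const_prog n) x n"
  by (induction n) (auto intro: run.intros)

text \<open>The numbers below \<open>6\<close> and the four residues above them exhaust everything,
  so every number is an index and \<open>prog_of\<close> inverts the coding.\<close>

lemma prog_code_surj: "\<exists>p. prog_code p = c"
proof (induction c rule: less_induct)
  case (less c)
  show ?case
  proof (cases "c < 6")
    case True
    then have "c = 0 \<or> c = 1 \<or> c = 2 \<or> c = 3 \<or> c = 4 \<or> c = 5" by auto
    then show ?thesis by (metis prog_code.simps(1-6))
  next
    case False
    define k where "k = (c - 6) div 4"
    have k: "p1 k \<le> k" "p2 k \<le> k"
      using le_prod_encode_1[of "p1 k" "p2 k"] le_prod_encode_2[of "p2 k" "p1 k"] by simp_all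
    have "k < c" using False by (simp add: k_def)
    then obtain p q r where "prog_code p = p1 k" "prog_code q = p2 k" "prog_code r = k"
      using less k by (meson le_less_trans)
    moreover have "c = 6 + 4 * k \<or> c = 7 + 4 * k \<or> c = 8 + 4 * k \<or> c = 9 + 4 * k"
      unfolding k_def using False by presburger
    ultimately have "prog_code (Comp p q) = c \<or> prog_code (Pair p q) = c \<or>
        prog_code (Rec p q) = c \<or> prog_code (Mu r) = c"
      by auto
    then show ?thesis by blast
  qed
qed

definition prog_of :: "nat \<Rightarrow> prog" where
  "prog_of c = (SOME p. prog_code p = c)"

lemma prog_code_prog_of [simp]: "prog_code (prog_of c) = c"
  unfolding prog_of_def using someI_ex[OF prog_code_surj] .

lemma prog_of_prog_code [simp]: "prog_of (prog_code p) = p"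
  by (rule prog_code_inject) simp

definition recprog :: "(nat \<Rightarrow> prog) \<Rightarrow> bool" where
  "recprog F \<longleftrightarrow> recfn (\<lambda>x. prog_code (F x))"

lemma recprog_intros [rec_intros]:
  "recprog (\<lambda>x. p)"
  "recprog F \<Longrightarrow> recprog G \<Longrightarrow> recprog (\<lambda>x. Comp (F x) (G x))"
  "recprog F \<Longrightarrow> recprog G \<Longrightarrow> recprog (\<lambda>x. Pair (F x) (G x))"
  "recprog F \<Longrightarrow> recprog G \<Longrightarrow> recprog (\<lambda>x. Rec (F x) (G x))"
  "recprog F \<Longrightarrow> recprog (\<lambda>x. Mu (F x))"
  "recfn f \<Longrightarrow> recprog (\<lambda>x. prog_of (f x))"
  unfolding recprog_def prog_code.simps prog_code_prog_of by (intro rec_intros; assumption)+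

lemma recprog_const_prog [rec_intros]: "recfn f \<Longrightarrow> recprog (\<lambda>x. const_prog (f x))"
proof -
  have "prog_code (const_prog n) = rec_nat 0 (\<lambda>_ y. 6 + 4 * pr 1 y) n" for n
    by (induction n) auto
  then show "recfn f \<Longrightarrow> recprog (\<lambda>x. const_prog (f x))"
    unfolding recprog_def by (simp only:) (intro rec_intros)
qed

lemma recfn_prog_code [rec_intros]: "recprog F \<Longrightarrow> recfn (\<lambda>x. prog_code (F x))"
  by (simp add: recprog_def)

text \<open>\<open>d c\<close> runs program \<open>c\<close> on the pair of \<open>c\<close> and the
  input, a self-application. If \<open>r\<close> sends \<open>(c, x)\<close> to the value of
  \<open>F\<close> at the code of \<open>d c\<close> and \<open>x\<close>, then \<open>d\<close> at
  the code of \<open>r\<close> is the fixed point.\<close>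

theorem recursion_theorem:
  assumes "recfn (\<lambda>z. F (p1 z) (p2 z))"
  shows "\<exists>p. \<forall>A x. run A p x (F (prog_code p) x)"
proof -
  define d where "d c = Comp (prog_of c) (Pair (const_prog c) Ident)" for c
  have "recfn (\<lambda>z. F (prog_code (d (p1 z))) (p2 z))"
    unfolding d_def by (rule recfn_binary[OF assms]) (intro rec_intros)+
  then obtain r where r: "\<And>A z. run A r z (F (prog_code (d (p1 z))) (p2 z))"
    unfolding recfn_def by blast
  have "run A (d (prog_code r)) x (F (prog_code (d (prog_code r))) x)" for A x
  proof -
    have "run A (Pair (const_prog (prog_code r)) Ident) x (pr (prog_code r) x)"
      by (intro run.intros run_const_prog)
    moreover have "run A r (pr (prog_code r) x) (F (prog_code (d (prog_code r))) x)"
      using r[of A "pr (prog_code r) x"] by simp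
    ultimately show ?thesis unfolding d_def by (auto intro: run_Comp)
  qed
  then show ?thesis by blast
qed

section \<open>Values of well-founded games are hyperarithmetic\<close>

text \<open>The value \<open>True\<close> means that the player to move loses; at a leaf the other
  one has just lost. A position with an infinite play below it gets no value.\<close>

inductive game_value :: "(nat \<Rightarrow> bool) \<Rightarrow> (nat \<Rightarrow> nat \<Rightarrow> nat) \<Rightarrow> nat \<Rightarrow> bool \<Rightarrow> bool"
  for leaf mv where
  game_value_leaf: "leaf t \<Longrightarrow> game_value leaf mv t False"
| game_value_step: "\<not> leaf t \<Longrightarrow> (\<And>n. game_value leaf mv (mv t n) (b n)) \<Longrightarrow>
    game_value leaf mv t (\<forall>n. \<not> b n)"

lemma less_star_trans: "a <\<^sub>* b \<Longrightarrow> b <\<^sub>* c \<Longrightarrow> a <\<^sub>* c"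
  unfolding less_star_def by (rule tranclp_trans)

lemma le_less_star_trans: "a \<le>\<^sub>* b \<Longrightarrow> b <\<^sub>* c \<Longrightarrow> a <\<^sub>* c"
  unfolding le_star_def using less_star_trans by blast

lemma less_le_star_trans: "a <\<^sub>* b \<Longrightarrow> b \<le>\<^sub>* c \<Longrightarrow> a <\<^sub>* c"
  unfolding le_star_def using less_star_trans by blast

lemma le_star_trans: "a \<le>\<^sub>* b \<Longrightarrow> b \<le>\<^sub>* c \<Longrightarrow> a \<le>\<^sub>* c"
  unfolding le_star_def using less_star_trans by blast

lemma less_star_succ: "a \<noteq> 0 \<Longrightarrow> a <\<^sub>* 2 ^ a"
  unfolding less_star_def using star_succ by blast

lemma less_star_lim: "phi e n b \<Longrightarrow> b <\<^sub>* 3 * 5 ^ e"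
  unfolding less_star_def using star_lim by blast

text \<open>Along a sequence of games, the notation reached so far serves as the base for the next game:
  this makes the fundamental sequence increasing without addition of notations.\<close>

definition stage_prog :: "prog \<Rightarrow> prog \<Rightarrow> prog \<Rightarrow> nat \<Rightarrow> prog" where
  "stage_prog pw k c a = Comp (Rec Ident (Comp pw (Comp Fst (Comp k (Pair (Comp Snd Snd)
     (Comp c (Comp Fst Snd))))))) (Pair (const_prog a) Ident)"

text \<open>Column \<open>Suc n\<close> of the set at the limit is the set of stage
  \<open>Suc n\<close>, and this stage is the successor of the notation returned for game
  \<open>n\<close>; hence \<open>Succ\<close> in the second component.\<close>

definition query_prog :: "prog \<Rightarrow> prog \<Rightarrow> prog \<Rightarrow> nat \<Rightarrow> prog" where
  "query_prog pw k c a = Comp Query (Pair (Comp Snd (Comp k (Pair (stage_prog pw k c a) c))) Succ)"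

definition search_prog :: "prog \<Rightarrow> prog \<Rightarrow> prog \<Rightarrow> prog \<Rightarrow> nat \<Rightarrow> prog" where
  "search_prog pw iz k c a = Mu (Comp iz (Comp (query_prog pw k c a) Snd))"

definition refute_prog :: "nat \<Rightarrow> prog" where
  "refute_prog q = Mu (Comp Query (const_prog q))"

lemma run_Mu_iff: "run A (Mu p) x n \<longleftrightarrow>
    (\<forall>i<n. \<exists>y. run A p (pr x i) (Suc y)) \<and> run A p (pr x n) 0"
  by (auto elim: run_elims intro: run_Mu)

lemma Mu_halts_iff:
  assumes "\<And>i. run A p (pr x i) (f i)"
  shows "(\<exists>n. run A (Mu p) x n) \<longleftrightarrow> (\<exists>i. f i = 0)"
proof -
  have eq: "run A p (pr x i) y \<longleftrightarrow> y = f i" for i y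
    using assms run_deterministic by blast
  show ?thesis unfolding run_Mu_iff eq
  proof
    assume "\<exists>i. f i = 0"
    then have "f (LEAST i. f i = 0) = 0" by (rule LeastI_ex)
    moreover have "\<exists>y. Suc y = f i" if "i < (LEAST i. f i = 0)" for i
      using not_less_Least[OF that] by (cases "f i") auto
    ultimately show "\<exists>n. (\<forall>i<n. \<exists>y. Suc y = f i) \<and> 0 = f n" by metis
  qed metis
qed

lemma jump_prog_code: "prog_code p \<in> jump A \<longleftrightarrow> (\<exists>y. run A p (prog_code p) y)"
  unfolding jump_def oracle_phi_def using prog_code_inject by blast

lemma refute_prog_jump: "prog_code (refute_prog q) \<in> jump A \<longleftrightarrow> q \<notin> A"
proof -
  have "run A (Comp Query (const_prog q)) z (of_bool (q \<in> A))" for z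
    by (rule run_Comp[OF run_const_prog run_Query])
  from Mu_halts_iff[OF this] show ?thesis
    unfolding jump_prog_code refute_prog_def by simp
qed

text \<open>One position with children \<open>ch n\<close> of values \<open>b n\<close>. Assumption
  \<open>K\<close> is the induction hypothesis: from any base \<open>a\<close>, program
  \<open>k\<close> finds a notation at least \<open>a\<close> and an index that lies in the set one
  successor higher exactly if the child has value \<open>True\<close>.\<close>

locale game_stages =
  fixes pw iz k c :: prog and K :: "nat \<Rightarrow> nat \<Rightarrow> nat" and ch :: "nat \<Rightarrow> nat" and b :: "nat \<Rightarrow> bool"
  assumes pw: "\<And>A x. run A pw x (2 ^ x)"
    and iz: "\<And>A x. run A iz x (1 - x)"
    and k: "\<And>A a t. run A k (pr a t) (K a t)"
    and c: "\<And>A n. run A c n (ch n)"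
    and K: "\<And>n a. a \<in> KO \<Longrightarrow> p1 (K a (ch n)) \<in> KO \<and> a \<le>\<^sub>* p1 (K a (ch n)) \<and>
       (\<forall>A. Hset (2 ^ p1 (K a (ch n))) A \<longrightarrow> (p2 (K a (ch n)) \<in> A \<longleftrightarrow> b n))"
begin

definition stage :: "nat \<Rightarrow> nat \<Rightarrow> nat" where
  "stage a n = rec_nat a (\<lambda>n y. 2 ^ p1 (K y (ch n))) n"

definition limit :: "nat \<Rightarrow> nat" where
  "limit a = 3 * 5 ^ prog_code (stage_prog pw k c a)"

lemma run_stage: "run A (stage_prog pw k c a) n (stage a n)"
proof -
  have "run A (Rec Ident (Comp pw (Comp Fst (Comp k (Pair (Comp Snd Snd)
     (Comp c (Comp Fst Snd))))))) (pr a n) (rec_nat a (\<lambda>n y. 2 ^ p1 (K y (ch n))) n)"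
  proof (rule run_Rec)
    fix x n y
    let ?z = "pr x (pr n y)"
    have "run A (Pair (Comp Snd Snd) (Comp c (Comp Fst Snd))) ?z (pr (p2 (p2 ?z)) (ch (p1 (p2 ?z))))"
      by (rule run_Pair[OF run_Comp[OF run_Snd run_Snd] run_Comp[OF run_Comp[OF run_Snd run_Fst] c]])
    then have "run A (Pair (Comp Snd Snd) (Comp c (Comp Fst Snd))) ?z (pr y (ch n))" by simp
    from run_Comp[OF run_Comp[OF run_Comp[OF this k] run_Fst] pw]
    show "run A (Comp pw (Comp Fst (Comp k (Pair (Comp Snd Snd) (Comp c (Comp Fst Snd))))))
      (pr x (pr n y)) (2 ^ p1 (K y (ch n)))" .
  qed (rule run_Ident)
  from run_Comp[OF run_Pair[OF run_const_prog run_Ident] this]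
  show ?thesis unfolding stage_prog_def stage_def .
qed

lemma phi_stage: "phi (prog_code (stage_prog pw k c a)) n (stage a n)"
  unfolding oracle_phi_def using run_stage by blast

lemma stage_KO: "a \<in> KO \<Longrightarrow> stage a n \<in> KO"
  unfolding stage_def by (induction n) (use K in \<open>auto intro: KO_succ\<close>)

lemma stage_Suc: "stage a (Suc n) = 2 ^ p1 (K (stage a n) (ch n))"
  by (simp add: stage_def)

lemma stage_less: "a \<in> KO \<Longrightarrow> stage a n <\<^sub>* stage a (Suc n)"
  unfolding stage_Suc using K[OF stage_KO] KO_nonzero le_less_star_trans less_star_succ by blast

lemma limit_KO: "a \<in> KO \<Longrightarrow> limit a \<in> KO"
  unfolding limit_def by (rule KO_lim) (use phi_stage stage_KO stage_less in blast)+

lemma less_limit: "a <\<^sub>* limit a"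
  unfolding limit_def using less_star_lim[OF phi_stage, of a 0] by (simp add: stage_def)

lemma Hset_limit:
  assumes "a \<in> KO" "Hset (limit a) A"
  shows "pr (p2 (K (stage a n) (ch n))) (Suc n) \<in> A \<longleftrightarrow> b n"
proof -
  obtain B where B: "\<And>n. Hset (stage a n) (B n)" using Hset_total[OF stage_KO[OF assms(1)]] by metis
  have "Hset (limit a) {pr x n | x n. x \<in> B n}"
    using Hset_lim[OF limit_KO[OF assms(1), unfolded limit_def] phi_stage B] unfolding limit_def .
  then have "A = {pr x n | x n. x \<in> B n}" using Hset_unique assms(2) by blast
  then have "pr (p2 (K (stage a n) (ch n))) (Suc n) \<in> A \<longleftrightarrow> p2 (K (stage a n) (ch n)) \<in> B (Suc n)"
    by auto
  also have "\<dots> \<longleftrightarrow> b n" using K[OF stage_KO[OF assms(1)]] B[of "Suc n"] stage_Suc by metis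
  finally show ?thesis .
qed

lemma run_query:
  assumes "a \<in> KO" "Hset (limit a) A"
  shows "run A (query_prog pw k c a) n (of_bool (b n))"
proof -
  have "run A (Pair (Comp Snd (Comp k (Pair (stage_prog pw k c a) c))) Succ) n
      (pr (p2 (K (stage a n) (ch n))) (Suc n))"
    by (intro run_Pair run_Succ run_Comp[OF _ run_Snd] run_Comp[OF _ k] run_stage c)
  from run_Comp[OF this run_Query] show ?thesis
    unfolding query_prog_def by (simp add: Hset_limit[OF assms])
qed

text \<open>Finding a child of value \<open>True\<close> costs one jump above the limit, refuting
  its existence a second one.\<close>

lemma search_refute:
  assumes "a \<in> KO" "Hset (2 ^ 2 ^ limit a) A"
  shows "prog_code (refute_prog (prog_code (search_prog pw iz k c a))) \<in> A \<longleftrightarrow> (\<forall>n. \<not> b n)"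
proof -
  obtain B where B: "Hset (limit a) B" using Hset_total[OF limit_KO[OF assms(1)]] by blast
  have "Hset (2 ^ 2 ^ limit a) (jump (jump B))"
    by (intro Hset_succ KO_succ limit_KO assms B)
  then have A: "A = jump (jump B)" using assms(2) Hset_unique by blast
  have "run B (Comp iz (Comp (query_prog pw k c a) Snd)) (pr x n) (1 - of_bool (b n))" for x n
    using run_Comp[OF run_Comp[OF run_Snd[of B "pr x n"]] iz] run_query[OF assms(1) B, of n] by simp
  from Mu_halts_iff[OF this]
  have "prog_code (search_prog pw iz k c a) \<in> jump B \<longleftrightarrow> (\<exists>n. b n)"
    unfolding jump_prog_code search_prog_def by simp
  then show ?thesis unfolding A refute_prog_jump by simp
qed

end

text \<open>Effective transfinite recursion: a program that knows its own code turns the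
  well-foundedness of the game into notations, and its correctness is an induction on
  \<open>game_value\<close>.\<close>

theorem hyp_game_value:
  assumes "recpred leaf" and mv: "recfn (\<lambda>z. mv (p1 z) (p2 z))" and f: "recfn f"
    and val: "\<And>x. game_value leaf mv (f x) (X x)"
  shows "\<exists>a\<in>KO. \<exists>A p. Hset a A \<and> (\<forall>x. run A p x (of_bool (X x)))"
proof -
  have "recfn (\<lambda>x. 2 ^ x)" "recfn (\<lambda>x. 1 - x)" by (intro rec_intros)+
  then obtain pw iz where pw: "\<And>A x. run A pw x (2 ^ x)" and iz: "\<And>A x. run A iz x (1 - x)"
    unfolding recfn_def by blast
  obtain pm where "\<And>A z. run A pm z (mv (p1 z) (p2 z))" using mv unfolding recfn_def by blast
  from this[of _ "pr _ _"] have pm: "\<And>A t n. run A pm (pr t n) (mv t n)" by simp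
  obtain pf where pf: "\<And>A x. run A pf x (f x)" using f unfolding recfn_def by blast
  define cp where "cp t = Comp pm (Pair (const_prog t) Ident)" for t
  have cp: "run A (cp t) n (mv t n)" for A t n
    unfolding cp_def by (rule run_Comp[OF run_Pair[OF run_const_prog run_Ident] pm])
  \<comment> \<open>\<open>Mu Succ\<close> never halts, so its code is in no jump and represents the
    value \<open>False\<close> of a leaf. The recursion theorem will make \<open>prog_of k\<close>
    the program being defined.\<close>
  define F where "F k z = (if leaf (p2 z) then pr (p1 z) (prog_code (Mu Succ))
    else pr (2 ^ (3 * 5 ^ prog_code (stage_prog pw (prog_of k) (cp (p2 z)) (p1 z))))
      (prog_code (refute_prog (prog_code (search_prog pw iz (prog_of k) (cp (p2 z)) (p1 z))))))" for k z
  have "recfn (\<lambda>z. F (p1 z) (p2 z))"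
    unfolding F_def refute_prog_def search_prog_def query_prog_def stage_prog_def cp_def
    by (intro rec_intros recpred_comp[OF assms(1)])
  then obtain k where k: "\<And>A x. run A k x (F (prog_code k) x)" using recursion_theorem by blast
  define K where "K a t = F (prog_code k) (pr a t)" for a t
  have kK: "run A k (pr a t) (K a t)" for A a t using k unfolding K_def .
  have key: "p1 (K a t) \<in> KO \<and> a \<le>\<^sub>* p1 (K a t) \<and>
       (\<forall>A. Hset (2 ^ p1 (K a t)) A \<longrightarrow> (p2 (K a t) \<in> A \<longleftrightarrow> b))"
    if "game_value leaf mv t b" "a \<in> KO" for t b a
    using that
  proof (induction arbitrary: a rule: game_value.induct)
    case (game_value_leaf t)
    have "prog_code (Mu Succ) \<notin> A" if "Hset (2 ^ a) A" for A
    proof -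
      obtain B where "Hset a B" using Hset_total[OF game_value_leaf(2)] by blast
      then have "A = jump B" using Hset_succ game_value_leaf(2) Hset_unique that by blast
      then show ?thesis using Mu_halts_iff[OF run_Succ] by (simp add: jump_prog_code del: prog_code.simps)
    qed
    then show ?case using game_value_leaf by (simp add: K_def F_def le_star_def)
  next
    case (game_value_step t b)
    interpret game_stages pw iz k "cp t" K "mv t" b
      by unfold_locales (use pw iz kK cp game_value_step.IH in blast)+
    have K: "K a t = pr (2 ^ limit a) (prog_code (refute_prog (prog_code (search_prog pw iz k (cp t) a))))"
      using game_value_step(1) by (simp add: K_def F_def limit_def)
    have "a <\<^sub>* 2 ^ limit a"
      using less_limit[of a] less_star_succ KO_nonzero[OF limit_KO] game_value_step.prems
        less_star_trans by blast
    then show ?case unfolding K using limit_KO KO_succ search_refute game_value_step.prems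
      by (simp add: le_star_def)
  qed
  \<comment> \<open>One more limit, from base \<open>1\<close>, brings the games of all
    \<open>x\<close> under a single oracle.\<close>
  interpret game_stages pw iz k pf K f X
    by unfold_locales (use pw iz kK pf key[OF val] in blast)+
  obtain A where "Hset (limit 1) A" using Hset_total[OF limit_KO[OF KO_one]] by blast
  then show ?thesis using run_query[OF KO_one] limit_KO[OF KO_one] by blast
qed

section \<open>Positive operators presented by open games\<close>

definition call :: "nat \<Rightarrow> nat" where "call m = 2 * m + 1"
definition node :: "nat \<Rightarrow> nat" where "node m = 2 * m + 2"

lemma position_simps [simp]:
  "call m = call n \<longleftrightarrow> m = n" "node m = node n \<longleftrightarrow> m = n" "call m \<noteq> node n" "node n \<noteq> call m"
  "call m \<noteq> 0" "node m \<noteq> 0"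
  unfolding call_def node_def by presburger+

lemma recfn_position [rec_intros]:
  "recfn f \<Longrightarrow> recfn (\<lambda>x. call (f x))" "recfn f \<Longrightarrow> recfn (\<lambda>x. node (f x))"
  unfolding call_def node_def by (intro rec_intros; assumption)+

lemma position_cases:
  obtains "t = 0" | m where "t = call m" | m where "t = node m"
proof (cases "t = 0 \<or> odd t")
  case True
  then show ?thesis using that(1,2) oddE unfolding call_def by metis
next
  case False
  then have "t = node (t div 2 - 1)" unfolding node_def by presburger
  then show ?thesis using that(3) by metis
qed

text \<open>Besides the won position \<open>0\<close>, a position is \<^term>\<open>call m\<close>, won if the parameter \<open>Q\<close> holds at
  \<open>m\<close>, or \<^term>\<open>node m\<close>, where the player moves if \<open>k m\<close> and the opponent moves otherwise.\<close>

inductive win :: "(nat \<Rightarrow> bool) \<Rightarrow> (nat \<Rightarrow> nat \<Rightarrow> nat) \<Rightarrow> (nat \<Rightarrow> bool) \<Rightarrow> nat \<Rightarrow> bool" for k s Q where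
  win_done: "win k s Q 0"
| win_call: "Q m \<Longrightarrow> win k s Q (call m)"
| win_or: "k m \<Longrightarrow> win k s Q (s m i) \<Longrightarrow> win k s Q (node m)"
| win_and: "\<not> k m \<Longrightarrow> (\<And>i. win k s Q (s m i)) \<Longrightarrow> win k s Q (node m)"

lemma win_call_iff: "win k s Q (call m) \<longleftrightarrow> Q m"
  by (auto elim: win.cases intro: win_call)

lemma win_node_iff:
  "win k s Q (node m) \<longleftrightarrow> (if k m then \<exists>i. win k s Q (s m i) else \<forall>i. win k s Q (s m i))"
proof
  assume "win k s Q (node m)"
  then show "if k m then \<exists>i. win k s Q (s m i) else \<forall>i. win k s Q (s m i)" by cases auto
qed (auto intro: win_or win_and split: if_splits)

lemma win_mono: "win k s Q t \<Longrightarrow> (\<And>m. Q m \<Longrightarrow> R m) \<Longrightarrow> win k s R t"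
  by (induction rule: win.induct) (auto intro: win.intros)

text \<open>The game is the same for all \<open>Q\<close>, which enters only through the calls it
  makes won; this is what makes the operator positive.\<close>

definition posop :: "((nat \<Rightarrow> bool) \<Rightarrow> nat \<Rightarrow> bool) \<Rightarrow> bool" where
  "posop \<Phi> \<longleftrightarrow> (\<exists>k s f. recpred k \<and> recfn (\<lambda>z. s (p1 z) (p2 z)) \<and> recfn f \<and>
     (\<forall>Q x. \<Phi> Q x \<longleftrightarrow> win k s Q (f x)))"

text \<open>The Pi-1-1 predicates on numbers, in their game form.\<close>

definition pi11 :: "(nat \<Rightarrow> bool) \<Rightarrow> bool" where
  "pi11 P \<longleftrightarrow> posop (\<lambda>_. P)"

named_theorems pos_intros

lemma posop_recpred:
  assumes "recpred P"
  shows "posop (\<lambda>Q. P)"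
proof -
  \<comment> \<open>A position that only leads back to itself is never won, since \<open>win\<close>
    is inductive.\<close>
  have "\<not> win (\<lambda>_. True) (\<lambda>_ _. node 0) Q t" if "t = node 0" for Q t
  proof
    assume "win (\<lambda>_. True) (\<lambda>_ _. node 0) Q t"
    then show False using that by (induction rule: win.induct) auto
  qed
  then have "\<forall>Q x. P x \<longleftrightarrow> win (\<lambda>_. True) (\<lambda>_ _. node 0) Q (if P x then 0 else node 0)"
    by (auto intro: win_done)
  moreover have "recfn (\<lambda>x. if P x then 0 else node 0)" by (intro rec_intros assms)
  ultimately show ?thesis unfolding posop_def
    by (intro exI[of _ "\<lambda>_. True"] exI[of _ "\<lambda>_ _. node 0"]) (auto intro: rec_intros)
qed

lemma posop_call [pos_intros]:
  assumes "recfn g"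
  shows "posop (\<lambda>Q x. Q (g x))"
proof -
  have "recfn (\<lambda>x. call (g x))" by (intro rec_intros assms)
  then show ?thesis unfolding posop_def
    by (intro exI[of _ "\<lambda>_. True"] exI[of _ "\<lambda>_ _. 0"] exI[of _ "\<lambda>x. call (g x)"])
      (simp only: win_call_iff, auto intro: rec_intros)
qed

lemma posop_comp: "posop \<Phi> \<Longrightarrow> recfn g \<Longrightarrow> posop (\<lambda>Q x. \<Phi> Q (g x))"
  unfolding posop_def using recfn_comp by fast

definition embed :: "(nat \<Rightarrow> nat) \<Rightarrow> nat \<Rightarrow> nat" where
  "embed g t = (if t = 0 \<or> odd t then t else node (g (t div 2 - 1)))"

lemma embed_simps: "embed g 0 = 0" "embed g (call m) = call m" "embed g (node m) = node (g m)"
  by (simp_all add: embed_def) (simp_all add: call_def node_def)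

text \<open>Lets several games share one move function: nodes are renamed injectively, calls and the
  won position are kept.\<close>

lemma win_embed:
  assumes "inj g" "\<And>m. k' (g m) = k m" "\<And>m i. s' (g m) i = embed g (s m i)"
  shows "win k' s' Q (embed g t) \<longleftrightarrow> win k s Q t"
proof
  assume "win k' s' Q (embed g t)"
  then show "win k s Q t"
  proof (induction "embed g t" arbitrary: t rule: win.induct)
    case win_done
    then show ?case by (cases t rule: position_cases) (auto simp: embed_simps intro: win.win_done)
  next
    case (win_call m)
    then show ?case
      by (cases t rule: position_cases) (auto simp: embed_simps win_call_iff)
  next
    case (win_or m i)
    obtain m' where m': "t = node m'"
      using win_or(4) by (cases t rule: position_cases) (auto simp: embed_simps)
    then have "m = g m'" using win_or(4) by (simp add: embed_simps)
    then show ?case using win_or assms unfolding m' by (auto intro: win.win_or)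
  next
    case (win_and m)
    obtain m' where m': "t = node m'"
      using win_and(4) by (cases t rule: position_cases) (auto simp: embed_simps)
    then have "m = g m'" using win_and(4) by (simp add: embed_simps)
    then show ?case using win_and assms unfolding m' by (auto intro: win.win_and)
  qed
next
  assume "win k s Q t"
  then show "win k' s' Q (embed g t)"
  proof (induction rule: win.induct)
    case (win_or m i)
    then show ?case unfolding embed_simps by (intro win.win_or[of _ _ _ _ i]) (simp_all add: assms)
  next
    case (win_and m)
    then show ?case unfolding embed_simps by (intro win.win_and) (simp_all add: assms)
  qed (simp_all only: embed_simps win_call_iff win.win_done)
qed

lemma recfn_embed: assumes "recfn g" "recfn f" shows "recfn (\<lambda>x. embed g (f x))"
  unfolding embed_def by (intro rec_intros recfn_comp[OF assms(1)] assms(2))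

text \<open>One construction for quantifiers and connectives: with equal operators the parity of
  \<open>n\<close> does not matter, with operators that ignore the number only the parity
  does.\<close>

lemma posop_quant:
  fixes ex :: bool
  assumes "posop \<Phi>\<^sub>1" "posop \<Phi>\<^sub>2"
  defines "\<Psi> Q x n \<equiv> (if even n then \<Phi>\<^sub>1 Q (pr x (n div 2)) else \<Phi>\<^sub>2 Q (pr x (n div 2)))"
  shows "posop (\<lambda>Q x. if ex then \<exists>n. \<Psi> Q x n else \<forall>n. \<Psi> Q x n)"
proof -
  obtain k1 s1 f1 where 1: "recpred k1" "recfn (\<lambda>z. s1 (p1 z) (p2 z))" "recfn f1"
    "\<And>Q x. \<Phi>\<^sub>1 Q x \<longleftrightarrow> win k1 s1 Q (f1 x)" using assms(1) unfolding posop_def by blast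
  obtain k2 s2 f2 where 2: "recpred k2" "recfn (\<lambda>z. s2 (p1 z) (p2 z))" "recfn f2"
    "\<And>Q x. \<Phi>\<^sub>2 Q x \<longleftrightarrow> win k2 s2 Q (f2 x)" using assms(2) unfolding posop_def by blast
  \<comment> \<open>Residues \<open>0\<close> and \<open>1\<close> modulo \<open>3\<close> hold
    copies of the two games, residue \<open>2\<close> the new roots.\<close>
  define g1 g2 :: "nat \<Rightarrow> nat" where "g1 = (\<lambda>m. 3 * m)" and "g2 = (\<lambda>m. 3 * m + 1)"
  have g: "recfn g1" "recfn g2" unfolding g1_def g2_def by (intro rec_intros)+
  define k where "k m = (if m mod 3 = 0 then k1 (m div 3) else if m mod 3 = 1 then k2 (m div 3) else ex)" for m
  define s where "s m i = (if m mod 3 = 0 then embed g1 (s1 (m div 3) i)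
    else if m mod 3 = 1 then embed g2 (s2 (m div 3) i)
    else if even i then embed g1 (f1 (pr (m div 3) (i div 2)))
    else embed g2 (f2 (pr (m div 3) (i div 2))))" for m i
  have w1: "win k s Q (embed g1 t) \<longleftrightarrow> win k1 s1 Q t" for Q t
    by (rule win_embed) (simp_all add: g1_def inj_on_def k_def s_def)
  have "(3 * m + 1) div 3 = m" "(3 * m + 1) mod 3 = 1" for m :: nat by presburger+
  then have w2: "win k s Q (embed g2 t) \<longleftrightarrow> win k2 s2 Q t" for Q t
    by (intro win_embed) (simp_all add: g2_def inj_on_def k_def s_def)
  have n3: "(3 * x + 2) div 3 = x" "(3 * x + 2) mod 3 = 2" for x :: nat by presburger+
  have s3: "s (3 * x + 2) i = (if even i then embed g1 (f1 (pr x (i div 2)))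
      else embed g2 (f2 (pr x (i div 2))))" and k3: "k (3 * x + 2) = ex" for x i
    unfolding s_def k_def n3 by simp_all
  have \<Psi>: "\<Psi> Q x i \<longleftrightarrow> win k s Q (s (3 * x + 2) i)" for Q x i
    unfolding s3 \<Psi>_def 1 2 by (simp add: w1 w2)
  have "(if ex then \<exists>n. \<Psi> Q x n else \<forall>n. \<Psi> Q x n) \<longleftrightarrow> win k s Q (node (3 * x + 2))" for Q x
    unfolding win_node_iff \<Psi> k3 ..
  moreover have "recpred k" unfolding k_def
    by (intro rec_intros recpred_comp[OF 1(1)] recpred_comp[OF 2(1)])
  moreover have "recfn (\<lambda>z. s (p1 z) (p2 z))" unfolding s_def
    by (intro rec_intros recfn_embed g recfn_comp[OF 1(3)] recfn_comp[OF 2(3)]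
        recfn_binary[OF 1(2)] recfn_binary[OF 2(2)])
  moreover have "recfn (\<lambda>x. node (3 * x + 2))" by (intro rec_intros)
  ultimately show ?thesis unfolding posop_def by blast
qed

lemma posop_ex [pos_intros]:
  assumes "posop (\<lambda>Q z. \<Phi> Q (p1 z) (p2 z))"
  shows "posop (\<lambda>Q x. \<exists>n. \<Phi> Q x n)"
proof -
  have "(\<exists>n. \<Phi> Q x (n div 2)) \<longleftrightarrow> (\<exists>n. \<Phi> Q x n)" for Q x
    by (metis nonzero_mult_div_cancel_left zero_neq_numeral)
  then show ?thesis using posop_quant[OF assms assms, of True] by simp
qed

lemma posop_all [pos_intros]:
  assumes "posop (\<lambda>Q z. \<Phi> Q (p1 z) (p2 z))"
  shows "posop (\<lambda>Q x. \<forall>n. \<Phi> Q x n)"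
proof -
  have "(\<forall>n. \<Phi> Q x (n div 2)) \<longleftrightarrow> (\<forall>n. \<Phi> Q x n)" for Q x
    by (metis nonzero_mult_div_cancel_left zero_neq_numeral)
  then show ?thesis using posop_quant[OF assms assms, of False] by simp
qed

lemma ex_parity: "(\<exists>n::nat. if even n then P else R) \<longleftrightarrow> P \<or> R"
  "(\<forall>n::nat. if even n then P else R) \<longleftrightarrow> P \<and> R"
  by (metis even_Suc even_zero)+

lemma posop_disj [pos_intros]:
  assumes "posop \<Phi>" "posop \<Psi>"
  shows "posop (\<lambda>Q x. \<Phi> Q x \<or> \<Psi> Q x)"
proof -
  have "posop (\<lambda>Q z. \<Phi> Q (p1 z))" "posop (\<lambda>Q z. \<Psi> Q (p1 z))"
    by (rule posop_comp[OF assms(1) recfn_p1[OF recfn_id]], rule posop_comp[OF assms(2) recfn_p1[OF recfn_id]])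
  from posop_quant[OF this, of True] show ?thesis by (simp add: ex_parity cong: if_cong)
qed

lemma posop_conj [pos_intros]:
  assumes "posop \<Phi>" "posop \<Psi>"
  shows "posop (\<lambda>Q x. \<Phi> Q x \<and> \<Psi> Q x)"
proof -
  have "posop (\<lambda>Q z. \<Phi> Q (p1 z))" "posop (\<lambda>Q z. \<Psi> Q (p1 z))"
    by (rule posop_comp[OF assms(1) recfn_p1[OF recfn_id]], rule posop_comp[OF assms(2) recfn_p1[OF recfn_id]])
  from posop_quant[OF this, of False] show ?thesis by (simp add: ex_parity cong: if_cong)
qed

lemma posop_mono:
  assumes "posop \<Phi>"
  shows "mono \<Phi>"
proof (rule monoI)
  fix Q R :: "nat \<Rightarrow> bool" assume "Q \<le> R"
  then have "win k s Q t \<Longrightarrow> win k s R t" for k s t using win_mono[of k s Q t R] by auto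
  then show "\<Phi> Q \<le> \<Phi> R" using assms unfolding posop_def by (metis predicate1I)
qed

text \<open>Calls are played on: each is replaced by a move to the start of the game for its
  argument. Since \<open>win\<close> is inductive, the recursion unwinds to the least fixed
  point.\<close>

theorem pi11_lfp:
  assumes "posop \<Phi>"
  shows "pi11 (lfp \<Phi>)"
proof -
  obtain k s f where 1: "recpred k" "recfn (\<lambda>z. s (p1 z) (p2 z))" "recfn f"
    and \<Phi>: "\<And>Q x. \<Phi> Q x \<longleftrightarrow> win k s Q (f x)" using assms unfolding posop_def by blast
  \<comment> \<open>A call to \<open>m\<close> becomes an odd-numbered node all of whose moves lead
    to the start for \<open>m\<close>; the old nodes become the even-numbered ones.\<close>
  define e where "e t = (if t = 0 then 0 else if odd t then node (2 * (t div 2) + 1)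
    else node (2 * (t div 2 - 1)))" for t :: nat
  have e: "e 0 = 0" "e (call m) = node (Suc (2 * m))" "e (node m) = node (2 * m)" for m
    unfolding e_def by (simp_all add: call_def) (simp_all add: node_def)
  define k' where "k' m = (if even m then k (m div 2) else True)" for m
  define s' where "s' m i = (if even m then e (s (m div 2) i) else e (f (m div 2)))" for m i
  have even: "k' (2 * m) = k m" "s' (2 * m) i = e (s m i)" for m i
    by (simp_all add: k'_def s'_def)
  have odd: "k' (Suc (2 * m))" "s' (Suc (2 * m)) i = e (f m)" for m i
    by (simp_all add: k'_def s'_def)
  have call: "win k' s' R (e (call m)) \<longleftrightarrow> win k' s' R (e (f m))" for R m
    unfolding e win_node_iff odd by (simp add: odd)
  have step: "win k' s' R (e t)" if "win k s (\<lambda>m. win k' s' R (e (call m))) t" for R t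
    using that
  proof (induction rule: win.induct)
    case (win_or m i)
    then show ?case unfolding e win_node_iff even by auto
  next
    case (win_and m)
    then show ?case unfolding e win_node_iff even by auto
  qed (simp_all only: e(1) win.win_done)
  have "lfp \<Phi> x \<longleftrightarrow> win k' s' R (e (f x))" for R x
  proof
    have "\<Phi> (\<lambda>m. win k' s' R (e (call m))) \<le> (\<lambda>m. win k' s' R (e (call m)))"
      using step by (auto simp: \<Phi> call)
    then have "lfp \<Phi> \<le> (\<lambda>m. win k' s' R (e (call m)))" by (rule lfp_lowerbound)
    then show "lfp \<Phi> x \<Longrightarrow> win k' s' R (e (f x))" unfolding call by auto
  next
    have "win k s (lfp \<Phi>) t" if "win k' s' R (e t)" for t using that
    proof (induction "e t" arbitrary: t rule: win.induct)
      case win_done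
      then show ?case by (cases t rule: position_cases) (auto simp: e intro: win.win_done)
    next
      case (win_call m)
      then show ?case by (cases t rule: position_cases) (auto simp: e)
    next
      case (win_or m i)
      show ?case
      proof (cases t rule: position_cases)
        case 1 then show ?thesis by (simp add: win.win_done)
      next
        case (2 m')
        then have "m = Suc (2 * m')" using win_or(4) by (simp add: e)
        then have "win k s (lfp \<Phi>) (f m')" using win_or(3) odd by simp
        then have "\<Phi> (lfp \<Phi>) m'" by (simp add: \<Phi>)
        then show ?thesis unfolding 2 win_call_iff using lfp_unfold[OF posop_mono[OF assms]] by metis
      next
        case (3 m')
        then have "m = 2 * m'" using win_or(4) by (simp add: e)
        then show ?thesis using win_or even unfolding 3 by (auto intro: win.win_or)
      qed
    next
      case (win_and m)
      show ?case
      proof (cases t rule: position_cases)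
        case 1 then show ?thesis by (simp add: win.win_done)
      next
        case (2 m')
        then have "m = Suc (2 * m')" using win_and(4) by (simp add: e)
        then show ?thesis using win_and(1) odd by simp
      next
        case (3 m')
        then have "m = 2 * m'" using win_and(4) by (simp add: e)
        then show ?thesis using win_and even unfolding 3 by (auto intro: win.win_and)
      qed
    qed
    then show "win k' s' R (e (f x)) \<Longrightarrow> lfp \<Phi> x"
      using lfp_unfold[OF posop_mono[OF assms]] \<Phi> by metis
  qed
  moreover have er: "recfn g \<Longrightarrow> recfn (\<lambda>x. e (g x))" for g
    unfolding e_def by (intro rec_intros)
  moreover have "recpred k'" unfolding k'_def by (intro rec_intros recpred_comp[OF 1(1)])
  moreover have "recfn (\<lambda>z. s' (p1 z) (p2 z))"
    unfolding s'_def by (intro rec_intros er recfn_binary[OF 1(2)] recfn_comp[OF 1(3)])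
  moreover have "recfn (\<lambda>x. e (f x))" by (intro er 1(3))
  ultimately show ?thesis unfolding pi11_def posop_def by blast
qed


section \<open>Predicates with open games for both sides are hyperarithmetic\<close>

text \<open>A strategy of the opponent is recorded by the positions reached against it: entry
  \<open>Suc (pr j c)\<close> is the position after entry \<open>c\<close> when the player proposes the move \<open>j\<close>.\<close>

function play :: "(nat \<Rightarrow> nat \<Rightarrow> nat) \<Rightarrow> nat \<Rightarrow> nat \<Rightarrow> nat" where
  "play F t 0 = t"
| "play F t (Suc z) = F (p1 z) (play F t (p2 z))"
  by pat_completeness auto
termination
proof (relation "measure (\<lambda>(F, t, n). n)")
  fix F :: "nat \<Rightarrow> nat \<Rightarrow> nat" and t z
  have "p2 z \<le> z" using le_prod_encode_2[of "p2 z" "p1 z"] by simp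
  then show "((F, t, p2 z), F, t, Suc z) \<in> measure (\<lambda>(F, t, n). n)" by simp
qed simp

definition chooses :: "(nat \<Rightarrow> bool) \<Rightarrow> nat \<Rightarrow> bool" where
  "chooses k t = k (t div 2 - 1)"

text \<open>Calls stay put: with the parameter constantly \<open>False\<close> they are lost for the
  player, so the opponent may rest there.\<close>

definition advance :: "(nat \<Rightarrow> nat \<Rightarrow> nat) \<Rightarrow> nat \<Rightarrow> nat \<Rightarrow> nat" where
  "advance s t i = (if odd t then t else s (t div 2 - 1) i)"

definition survives :: "(nat \<Rightarrow> bool) \<Rightarrow> (nat \<Rightarrow> nat \<Rightarrow> nat) \<Rightarrow> nat \<Rightarrow> (nat \<Rightarrow> nat) \<Rightarrow> bool" where
  "survives k s t h \<longleftrightarrow> h 0 = t \<and> (\<forall>c. h c \<noteq> 0) \<and>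
     (\<forall>j c. \<exists>n. h (Suc (pr j c)) = advance s (h c) (if chooses k (h c) then j else n))"

abbreviation wins :: "(nat \<Rightarrow> bool) \<Rightarrow> (nat \<Rightarrow> nat \<Rightarrow> nat) \<Rightarrow> nat \<Rightarrow> bool" where
  "wins k s \<equiv> win k s (\<lambda>_. False)"

lemma advance_simps [simp]: "advance s (node m) i = s m i" "chooses k (node m) = k m"
    "advance s (call m) i = call m"
  by (simp_all add: advance_def chooses_def node_def call_def)

text \<open>Determinacy: from a position that is not won, every move of the player and some move of
  the opponent lead to a position that is not won.\<close>

lemma survives_exists:
  assumes "\<not> wins k s t"
  shows "\<exists>h. survives k s t h"
proof -
  define F where "F j p = advance s p (if chooses k p then j else (SOME i. \<not> wins k s (advance s p i)))" for j p
  have F: "\<not> wins k s (F j p)" if "\<not> wins k s p" for j p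
  proof (cases p rule: position_cases)
    case 1 then show ?thesis using that win_done by simp
  next
    case (2 m) then show ?thesis using that by (simp add: F_def)
  next
    case (3 m)
    show ?thesis
    proof (cases "k m")
      case True
      then show ?thesis using that 3 by (simp add: F_def win_node_iff)
    next
      case False
      then have "\<exists>i. \<not> wins k s (advance s p i)" using that 3 by (simp add: win_node_iff)
      from someI_ex[OF this] show ?thesis using False 3 by (simp add: F_def)
    qed
  qed
  have lose: "\<not> wins k s (play F t c)" for c
  proof (induction c rule: less_induct)
    case (less c)
    show ?case
    proof (cases c)
      case 0 then show ?thesis using assms by simp
    next
      case (Suc z)
      have "p2 z \<le> z" using le_prod_encode_2[of "p2 z" "p1 z"] by simp
      then show ?thesis using less[of "p2 z"] F Suc by simp
    qed
  qed
  have "play F t c \<noteq> 0" for c using lose[of c] win_done by metis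
  moreover have "\<exists>n. play F t (Suc (pr j c)) = advance s (play F t c) (if chooses k (play F t c) then j else n)"
    for j c unfolding play.simps F_def by auto
  ultimately show ?thesis unfolding survives_def by (intro exI[of _ "play F t"]) simp
qed

text \<open>By induction on \<open>win\<close>, no entry of a surviving record is a won
  position.\<close>

lemma not_survives:
  assumes "wins k s t" "survives k s t h"
  shows False
proof -
  have "h c \<noteq> u" if "wins k s u" for u c using that
  proof (induction arbitrary: c rule: win.induct)
    case win_done then show ?case using assms(2) by (simp add: survives_def)
  next
    case (win_or m i)
    show ?case
    proof
      assume "h c = node m"
      then have "h (Suc (pr i c)) = s m i"
        using assms(2) win_or(1) unfolding survives_def by (metis advance_simps(1,2))
      then show False using win_or by blast
    qed
  next
    case (win_and m)
    show ?case
    proof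
      assume "h c = node m"
      then have "\<exists>i. h (Suc (pr 0 c)) = s m i"
        using assms(2) win_and(1) unfolding survives_def by (metis advance_simps(1,2))
      then show False using win_and by blast
    qed
  qed simp
  then show False using assms unfolding survives_def by metis
qed

text \<open>Two players extend alternately a surviving strategy of the opponent, each in a game of their
  own; the first who reaches a lost position loses.  Player \<open>0\<close> moves first.\<close>

locale two_games =
  fixes k :: "nat \<Rightarrow> nat \<Rightarrow> bool" and s :: "nat \<Rightarrow> nat \<Rightarrow> nat \<Rightarrow> nat" and f :: "nat \<Rightarrow> nat \<Rightarrow> nat"
begin

text \<open>A record is a length with the entries, latest first, so entry \<open>c\<close> sits at
  \<open>p1 A - 1 - c\<close>. The next entry refers only to an earlier one, and \<open>n\<close> is
  the reply of the opponent, ignored where the player chooses.\<close>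

definition entry :: "nat \<Rightarrow> nat \<Rightarrow> nat \<Rightarrow> nat \<Rightarrow> nat" where
  "entry b x A n = (if p1 A = 0 then f b x else
     advance (s b) (cnth (p2 A) (p1 A - 1 - p2 (p1 A - 1)))
       (if chooses (k b) (cnth (p2 A) (p1 A - 1 - p2 (p1 A - 1))) then p1 (p1 A - 1) else n))"

definition extend :: "nat \<Rightarrow> nat \<Rightarrow> nat \<Rightarrow> nat \<Rightarrow> nat" where
  "extend b x A n = pr (Suc (p1 A)) (ccons (entry b x A n) (p2 A))"

text \<open>A position holds \<open>x\<close>, the player to move, the record of that player and
  that of the other; a move extends the first record and swaps the two.\<close>

definition mv :: "nat \<Rightarrow> nat \<Rightarrow> nat" where
  "mv t n = pr (p1 t) (pr (1 - p1 (p2 t))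
     (pr (p2 (p2 (p2 t))) (extend (p1 (p2 t)) (p1 t) (p1 (p2 (p2 t))) n)))"

text \<open>Inspects the record extended last, which the swap has put second. The guard matters
  because \<open>cnth\<close> also returns \<open>0\<close> on an empty record.\<close>

definition leaf :: "nat \<Rightarrow> bool" where
  "leaf t \<longleftrightarrow> p1 (p2 (p2 (p2 t))) \<noteq> 0 \<and> cnth (p2 (p2 (p2 (p2 t)))) 0 = 0"

definition start :: "nat \<Rightarrow> nat" where
  "start x = pr x (pr 0 (pr (pr 0 0) (pr 0 0)))"

definition records :: "(nat \<Rightarrow> nat) \<Rightarrow> nat \<Rightarrow> bool" where
  "records h A \<longleftrightarrow> (\<forall>c<p1 A. cnth (p2 A) (p1 A - 1 - c) = h c)"

lemma records_extend:
  "records h (extend b x A n) \<longleftrightarrow> records h A \<and> entry b x A n = h (p1 A)"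
proof -
  have "(\<forall>c<Suc m. cnth (ccons y l) (m - c) = h c) \<longleftrightarrow> (\<forall>c<m. cnth l (m - 1 - c) = h c) \<and> y = h m" for m y l
  proof -
    have "cnth (ccons y l) (m - c) = cnth l (m - 1 - c)" if "c < m" for c
      using that by (metis Suc_diff_Suc cnth_simps(2) diff_Suc_eq_diff_pred minus_nat.diff_0)
    then show ?thesis by (auto simp: less_Suc_eq)
  qed
  then show ?thesis by (simp add: records_def extend_def)
qed

lemma entry_records:
  assumes "records h A"
  shows "entry b x A n = (if p1 A = 0 then f b x else advance (s b) (h (p2 (p1 A - 1)))
       (if chooses (k b) (h (p2 (p1 A - 1))) then p1 (p1 A - 1) else n))"
proof (cases "p1 A = 0")
  case False
  have "p2 (p1 A - 1) \<le> p1 A - 1"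
    using le_prod_encode_2[of "p2 (p1 A - 1)" "p1 (p1 A - 1)"] by simp
  then have "p2 (p1 A - 1) < p1 A" using False by linarith
  then have "cnth (p2 A) (p1 A - 1 - p2 (p1 A - 1)) = h (p2 (p1 A - 1))"
    using assms unfolding records_def by blast
  then show ?thesis using False by (simp add: entry_def)
qed (simp add: entry_def)

lemma survives_entry:
  assumes "records h A" "survives (k b) (s b) (f b x) h"
  shows "\<exists>n. entry b x A n = h (p1 A)"
proof (cases "p1 A")
  case 0
  then show ?thesis using assms by (simp add: entry_records survives_def)
next
  case (Suc z)
  have "\<exists>n. h (Suc (pr (p1 z) (p2 z))) =
      advance (s b) (h (p2 z)) (if chooses (k b) (h (p2 z)) then p1 z else n)"
    using assms(2) unfolding survives_def by blast
  then show ?thesis unfolding entry_records[OF assms(1)] Suc by simp metis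
qed

text \<open>A player who keeps copying a surviving \<open>h\<close> does not lose. In terms of
  values: \<open>False\<close> on that player's turn, \<open>True\<close> on the other's.\<close>

lemma value_survives:
  assumes "game_value leaf mv t v" "p1 (p2 t) \<le> 1" "b \<le> 1" "survives (k b) (s b) (f b (p1 t)) h"
  shows "(p1 (p2 t) = b \<longrightarrow> records h (p1 (p2 (p2 t))) \<longrightarrow> \<not> v) \<and>
    (p1 (p2 t) = 1 - b \<longrightarrow> records h (p2 (p2 (p2 t))) \<longrightarrow> v)"
  using assms
proof (induction rule: game_value.induct)
  case (game_value_leaf t)
  have "\<not> records h (p2 (p2 (p2 t)))"
  proof
    assume r: "records h (p2 (p2 (p2 t)))"
    have "cnth (p2 (p2 (p2 (p2 t)))) (p1 (p2 (p2 (p2 t))) - 1 - (p1 (p2 (p2 (p2 t))) - 1)) = h (p1 (p2 (p2 (p2 t))) - 1)"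
      using game_value_leaf(1) unfolding leaf_def
      by (intro r[unfolded records_def, rule_format]) simp
    then show False using game_value_leaf(1,4) unfolding leaf_def survives_def by simp
  qed
  then show ?case by simp
next
  case (game_value_step t v)
  have IH: "(1 - p1 (p2 t) = b \<longrightarrow> records h (p2 (p2 (p2 t))) \<longrightarrow> \<not> v n) \<and>
    (1 - p1 (p2 t) = 1 - b \<longrightarrow> records h (extend (p1 (p2 t)) (p1 t) (p1 (p2 (p2 t))) n) \<longrightarrow> v n)" for n
    using game_value_step.IH[of n] game_value_step.prems by (simp add: mv_def)
  show ?case
  proof (intro conjI impI)
    assume b: "p1 (p2 t) = b" and r: "records h (p1 (p2 (p2 t)))"
    obtain n where "entry b (p1 t) (p1 (p2 (p2 t))) n = h (p1 (p1 (p2 (p2 t))))"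
      using survives_entry[OF r game_value_step.prems(3)] by blast
    then have "v n" using IH[of n] b r by (simp add: records_extend)
    then show "\<not> (\<forall>n. \<not> v n)" by blast
  next
    assume b: "p1 (p2 t) = 1 - b" and r: "records h (p2 (p2 (p2 t)))"
    have "1 - p1 (p2 t) = b" using b game_value_step.prems by simp
    then show "\<forall>n. \<not> v n" using IH r by blast
  qed
qed

text \<open>A start without value yields an infinite play, and an infinite play completes a
  surviving record for each player.\<close>

lemma value_exists:
  assumes "\<not> (\<exists>h. survives (k 0) (s 0) (f 0 x) h) \<or> \<not> (\<exists>h. survives (k 1) (s 1) (f 1 x) h)"
  shows "\<exists>v. game_value leaf mv (start x) v"
proof (rule ccontr)
  let ?none = "\<lambda>t. \<nexists>v. game_value leaf mv t v"
  assume "?none (start x)"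
  define u where "u = rec_nat (start x) (\<lambda>_ t. mv t (SOME n. ?none (mv t n)))"
  have none_step: "\<not> leaf t \<and> ?none (mv t (SOME n. ?none (mv t n)))" if "?none t" for t
  proof
    show nl: "\<not> leaf t" using that game_value_leaf by blast
    have "\<exists>n. ?none (mv t n)"
    proof (rule ccontr)
      assume "\<nexists>n. ?none (mv t n)"
      then obtain v where "\<And>n. game_value leaf mv (mv t n) (v n)" by metis
      then show False using that game_value_step[where leaf = leaf and mv = mv, OF nl] by blast
    qed
    then show "?none (mv t (SOME n. ?none (mv t n)))" by (rule someI_ex)
  qed
  have none: "?none (u i)" for i
    by (induction i) (use \<open>?none (start x)\<close> none_step in \<open>auto simp: u_def\<close>)
  have nl: "\<not> leaf (u i)" for i using none none_step by blast
  define m where "m i = (SOME n. ?none (mv (u i) n))" for i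
  have uS: "u (Suc i) = mv (u i) (m i)" and u0: "u 0 = start x" for i by (simp_all add: u_def m_def)
  \<comment> \<open>Player \<open>b\<close> writes entry \<open>c\<close> in move
    \<open>2 * c + b\<close>; right afterwards it heads the second record.\<close>
  define h where "h b c = cnth (p2 (p2 (p2 (p2 (u (Suc (2 * c + b))))))) 0" for b c
  have inv: "p1 (u i) = x \<and> p1 (p2 (u i)) = i mod 2 \<and>
    p1 (p1 (p2 (p2 (u i)))) = i div 2 \<and> records (h (i mod 2)) (p1 (p2 (p2 (u i)))) \<and>
    p1 (p2 (p2 (p2 (u i)))) = Suc i div 2 \<and> records (h (1 - i mod 2)) (p2 (p2 (p2 (u i))))" for i
  proof (induction i)
    case 0 then show ?case by (simp add: u0 start_def records_def)
  next
    case (Suc i)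
    have m: "Suc i mod 2 = 1 - i mod 2" "1 - Suc i mod 2 = i mod 2" "Suc (Suc i) div 2 = Suc (i div 2)"
      by presburger+
    have "2 * (i div 2) + i mod 2 = i" by presburger
    then have h: "h (i mod 2) (i div 2) = entry (i mod 2) x (p1 (p2 (p2 (u i)))) (m i)"
      unfolding h_def using Suc by (simp add: uS mv_def extend_def)
    show ?case unfolding m using Suc h by (simp add: uS mv_def records_extend) (simp add: extend_def)
  qed
  have "survives (k b) (s b) (f b x) (h b)" if b: "b \<le> 1" for b
  proof -
    have e: "(2 * c + b) mod 2 = b" "(2 * c + b) div 2 = c" "Suc (2 * c + b) div 2 = c + b" for c
      using b by (auto simp: le_Suc_eq)
    have eq: "h b c = (if c = 0 then f b x else advance (s b) (h b (p2 (c - 1)))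
       (if chooses (k b) (h b (p2 (c - 1))) then p1 (c - 1) else m (2 * c + b)))" for c
    proof -
      note i = inv[of "2 * c + b", unfolded e]
      have "h b c = entry b x (p1 (p2 (p2 (u (2 * c + b))))) (m (2 * c + b))"
        unfolding h_def uS using i by (simp add: mv_def extend_def)
      then show ?thesis using entry_records[of "h b"] i by simp
    qed
    have "h b c \<noteq> 0" for c
    proof -
      have "p1 (p2 (p2 (p2 (u (Suc (2 * c + b)))))) \<noteq> 0"
        using inv[of "Suc (2 * c + b)"] by simp
      then show ?thesis using nl[of "Suc (2 * c + b)"] unfolding leaf_def h_def by simp
    qed
    moreover have "h b 0 = f b x" using eq[of 0] by simp
    moreover have "\<exists>n. h b (Suc (pr j c)) = advance (s b) (h b c) (if chooses (k b) (h b c) then j else n)" for j c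
      using eq[of "Suc (pr j c)"] by auto
    ultimately show ?thesis unfolding survives_def by blast
  qed
  from this[of 0] this[of 1] show False using assms by auto
qed

end

text \<open>The Souslin-Kleene theorem. For each \<open>x\<close> exactly one player has a surviving
  record, so the combined game has a value, and player \<open>0\<close>, who moves first, loses it
  exactly if \<open>P x\<close> holds.\<close>

theorem pi11_both_hyp:
  assumes "pi11 P" "pi11 (\<lambda>x. \<not> P x)"
  shows "\<exists>a\<in>KO. \<exists>A p. Hset a A \<and> (\<forall>x. run A p x (of_bool (P x)))"
proof -
  obtain k0 s0 f0 where 0: "recpred k0" "recfn (\<lambda>z. s0 (p1 z) (p2 z))" "recfn f0"
    "\<And>x. P x \<longleftrightarrow> wins k0 s0 (f0 x)" using assms(1) unfolding pi11_def posop_def by metis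
  obtain k1 s1 f1 where 1: "recpred k1" "recfn (\<lambda>z. s1 (p1 z) (p2 z))" "recfn f1"
    "\<And>x. \<not> P x \<longleftrightarrow> wins k1 s1 (f1 x)" using assms(2) unfolding pi11_def posop_def by metis
  define k where "k b = (if b = 0 then k0 else k1)" for b :: nat
  define s where "s b = (if b = 0 then s0 else s1)" for b :: nat
  define f where "f b = (if b = 0 then f0 else f1)" for b :: nat
  have adv: "recfn (\<lambda>z. advance (s (g z)) (u z) (v z))" if "recfn g" "recfn u" "recfn v" for g u v
  proof -
    have "advance (s (g z)) (u z) (v z) = (if odd (u z) then u z else
        if g z = 0 then s0 (u z div 2 - 1) (v z) else s1 (u z div 2 - 1) (v z))" for z
      by (simp add: advance_def s_def)
    moreover have "recfn (\<lambda>z. if odd (u z) then u z else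
        if g z = 0 then s0 (u z div 2 - 1) (v z) else s1 (u z div 2 - 1) (v z))"
      by (intro rec_intros recfn_binary[OF 0(2)] recfn_binary[OF 1(2)] that)
    ultimately show ?thesis by simp
  qed
  have cho: "recpred (\<lambda>z. chooses (k (g z)) (u z))" if "recfn g" "recfn u" for g u
  proof -
    have "chooses (k (g z)) (u z) = (if g z = 0 then k0 (u z div 2 - 1) else k1 (u z div 2 - 1))" for z
      by (simp add: chooses_def k_def)
    moreover have "recpred (\<lambda>z. if g z = 0 then k0 (u z div 2 - 1) else k1 (u z div 2 - 1))"
      by (intro rec_intros recpred_comp[OF 0(1)] recpred_comp[OF 1(1)] that)
    ultimately show ?thesis by simp
  qed
  have ini: "recfn (\<lambda>z. f (g z) (u z))" if "recfn g" "recfn u" for g u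
  proof -
    have "f (g z) (u z) = (if g z = 0 then f0 (u z) else f1 (u z))" for z
      by (simp add: f_def)
    moreover have "recfn (\<lambda>z. if g z = 0 then f0 (u z) else f1 (u z))"
      by (intro rec_intros recfn_comp[OF 0(3)] recfn_comp[OF 1(3)] that)
    ultimately show ?thesis by simp
  qed
  interpret two_games k s f .
  have "recfn (\<lambda>z. mv (p1 z) (p2 z))"
    unfolding mv_def extend_def entry_def by (intro rec_intros adv cho ini)
  moreover have "recpred leaf" unfolding leaf_def by (intro rec_intros)
  moreover have "recfn start" unfolding start_def by (intro rec_intros)
  moreover have "game_value leaf mv (start x) (P x)" for x
  proof -
    have none: "\<not> (\<exists>h. survives (k 0) (s 0) (f 0 x) h)" if "P x"
      using that 0(4) not_survives by (auto simp: k_def s_def f_def)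
    have none': "\<not> (\<exists>h. survives (k 1) (s 1) (f 1 x) h)" if "\<not> P x"
      using that 1(4) not_survives by (auto simp: k_def s_def f_def)
    obtain v where v: "game_value leaf mv (start x) v" using value_exists none none' by blast
    have val: "(b = 0 \<longrightarrow> \<not> v) \<and> (b = 1 \<longrightarrow> v)" if "b \<le> 1" "survives (k b) (s b) (f b x) h" for b h
      using value_survives[OF v, of b h] that by (auto simp: start_def records_def)
    have "v = P x"
    proof (cases "P x")
      case True
      then have "\<not> wins k1 s1 (f1 x)" using 1(4) by blast
      then obtain h where "survives k1 s1 (f1 x) h" using survives_exists by blast
      then show ?thesis using True val[of 1 h] by (simp add: k_def s_def f_def)
    next
      case False
      then have "\<not> wins k0 s0 (f0 x)" using 0(4) by blast
      then obtain h where "survives k0 s0 (f0 x) h" using survives_exists by blast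
      then show ?thesis using False val[of 0 h] by (simp add: k_def s_def f_def)
    qed
    then show ?thesis using v by simp
  qed
  ultimately show ?thesis by (intro hyp_game_value)
qed

section \<open>Hyperarithmetic predicates\<close>

definition hyper :: "(nat \<Rightarrow> bool) \<Rightarrow> bool" where
  "hyper P \<longleftrightarrow> pi11 P \<and> pi11 (\<lambda>x. \<not> P x)"

named_theorems hyp_intros

lemma hyper_recpred: "recpred P \<Longrightarrow> hyper P"
  unfolding hyper_def pi11_def by (intro conjI posop_recpred rec_intros)

lemma hyper_not [hyp_intros]: "hyper P \<Longrightarrow> hyper (\<lambda>x. \<not> P x)"
  unfolding hyper_def by simp

lemma hyper_conj [hyp_intros]: "hyper P \<Longrightarrow> hyper R \<Longrightarrow> hyper (\<lambda>x. P x \<and> R x)"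
  unfolding hyper_def pi11_def de_Morgan_conj by (elim conjE, intro conjI posop_conj posop_disj)

lemma hyper_disj [hyp_intros]: "hyper P \<Longrightarrow> hyper R \<Longrightarrow> hyper (\<lambda>x. P x \<or> R x)"
  unfolding hyper_def pi11_def de_Morgan_disj by (elim conjE, intro conjI posop_conj posop_disj)

lemma hyper_imp [hyp_intros]: "hyper P \<Longrightarrow> hyper R \<Longrightarrow> hyper (\<lambda>x. P x \<longrightarrow> R x)"
  unfolding imp_conv_disj by (intro hyper_disj hyper_not)

lemma hyper_iff [hyp_intros]: "hyper P \<Longrightarrow> hyper R \<Longrightarrow> hyper (\<lambda>x. P x \<longleftrightarrow> R x)"
  unfolding iff_conv_conj_imp by (intro hyp_intros)

lemma hyper_ex [hyp_intros]: "hyper (\<lambda>z. P (p1 z) (p2 z)) \<Longrightarrow> hyper (\<lambda>x. \<exists>n. P x n)"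
  unfolding hyper_def pi11_def not_ex
  using posop_ex[of "\<lambda>Q. P"] posop_all[of "\<lambda>Q x n. \<not> P x n"] by blast

lemma hyper_all [hyp_intros]: "hyper (\<lambda>z. P (p1 z) (p2 z)) \<Longrightarrow> hyper (\<lambda>x. \<forall>n. P x n)"
  unfolding hyper_def pi11_def not_all
  using posop_all[of "\<lambda>Q. P"] posop_ex[of "\<lambda>Q x n. \<not> P x n"] by blast

lemma hyper_comp: "hyper P \<Longrightarrow> recfn f \<Longrightarrow> hyper (\<lambda>x. P (f x))"
  unfolding hyper_def pi11_def using posop_comp[of "\<lambda>_. P"] posop_comp[of "\<lambda>_ x. \<not> P x"] by blast

lemma hyper_binary:
  assumes "hyper (\<lambda>z. P (p1 z) (p2 z))" "recfn f" "recfn g"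
  shows "hyper (\<lambda>x. P (f x) (g x))"
  using hyper_comp[OF assms(1) recfn_pr[OF assms(2,3)]] by simp

lemma hyper_ternary:
  assumes "hyper (\<lambda>z. P (p1 z) (p1 (p2 z)) (p2 (p2 z)))" "recfn f" "recfn g" "recfn h"
  shows "hyper (\<lambda>x. P (f x) (g x) (h x))"
  using hyper_comp[OF assms(1) recfn_pr[OF assms(2) recfn_pr[OF assms(3,4)]]] by simp

lemma hyper_atoms [hyp_intros]:
  "recfn f \<Longrightarrow> recfn g \<Longrightarrow> hyper (\<lambda>x. f x = g x)"
  "recfn f \<Longrightarrow> recfn g \<Longrightarrow> hyper (\<lambda>x. f x < g x)"
  "recfn f \<Longrightarrow> recfn g \<Longrightarrow> hyper (\<lambda>x. f x \<le> g x)"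
  "recfn f \<Longrightarrow> hyper (\<lambda>x. even (f x))"
  "hyper (\<lambda>x. c)"
  by (rule hyper_recpred; intro rec_intros; assumption)+

lemma posop_hyper: "hyper P \<Longrightarrow> posop (\<lambda>Q. P)"
  unfolding hyper_def pi11_def by blast

lemma posop_atoms [pos_intros]:
  "recfn f \<Longrightarrow> recfn g \<Longrightarrow> posop (\<lambda>Q x. f x = g x)"
  "recfn f \<Longrightarrow> recfn g \<Longrightarrow> posop (\<lambda>Q x. f x \<noteq> g x)"
  "recfn f \<Longrightarrow> recfn g \<Longrightarrow> posop (\<lambda>Q x. f x < g x)"
  "recfn f \<Longrightarrow> recfn g \<Longrightarrow> posop (\<lambda>Q x. f x \<le> g x)"
  "recfn f \<Longrightarrow> posop (\<lambda>Q x. even (f x))"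
  "recfn f \<Longrightarrow> posop (\<lambda>Q x. odd (f x))"
  by (rule posop_hyper; intro hyp_intros; assumption)+

lemma posop_imp [pos_intros]: "hyper P \<Longrightarrow> posop \<Phi> \<Longrightarrow> posop (\<lambda>Q x. P x \<longrightarrow> \<Phi> Q x)"
  unfolding imp_conv_disj by (intro posop_disj posop_hyper hyper_not)

lemma hyper_relpowp [hyp_intros]:
  assumes "hyper (\<lambda>z. R (p1 z) (p2 z))" "recfn f" "recfn g" "recfn h"
  shows "hyper (\<lambda>x. (R ^^ f x) (g x) (h x))"
proof -
  have "(R ^^ n) x y \<longleftrightarrow>
    (\<exists>l. cnth l 0 = x \<and> cnth l n = y \<and> (\<forall>i. i < n \<longrightarrow> R (cnth l i) (cnth l (Suc i))))" for n x y
  proof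
    assume "(R ^^ n) x y"
    then obtain d where d: "d 0 = x" "d n = y" "\<forall>i<n. R (d i) (d (Suc i))"
      unfolding relpowp_fun_conv by blast
    obtain l where "\<forall>i\<le>n. cnth l i = d i" using cnth_exists by blast
    then show "\<exists>l. cnth l 0 = x \<and> cnth l n = y \<and> (\<forall>i. i < n \<longrightarrow> R (cnth l i) (cnth l (Suc i)))"
      using d by (intro exI[of _ l]) auto
  qed (auto simp: relpowp_fun_conv)
  then have "hyper (\<lambda>z. (R ^^ p1 z) (p1 (p2 z)) (p2 (p2 z)))"
    by (simp only:) (intro hyp_intros hyper_binary[OF assms(1)] rec_intros)
  from hyper_ternary[where P = "\<lambda>n. R ^^ n", OF this assms(2-4)] show ?thesis .
qed

lemma hyper_rtranclp [hyp_intros]: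
  assumes "hyper (\<lambda>z. R (p1 z) (p2 z))" "recfn f" "recfn g"
  shows "hyper (\<lambda>x. R\<^sup>*\<^sup>* (f x) (g x))"
proof -
  have "hyper (\<lambda>z. R\<^sup>*\<^sup>* (p1 z) (p2 z))"
    unfolding rtranclp_power by (intro hyp_intros assms(1) rec_intros)
  from hyper_binary[OF this assms(2,3)] show ?thesis .
qed

section \<open>Games for the jump hierarchy\<close>

definition ctag :: "nat \<Rightarrow> nat" where "ctag c = (if c < 6 then c else 6 + (c - 6) mod 4)"
definition carg :: "nat \<Rightarrow> nat" where "carg c = (c - 6) div 4"

lemma ctag_simps [simp]:
  "ctag (prog_code Zero) = 0" "ctag (prog_code Succ) = 1" "ctag (prog_code Ident) = 2"
  "ctag (prog_code Fst) = 3" "ctag (prog_code Snd) = 4" "ctag (prog_code Query) = 5"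
  "ctag (prog_code (Comp p q)) = 6" "ctag (prog_code (Pair p q)) = 7"
  "ctag (prog_code (Rec p q)) = 8" "ctag (prog_code (Mu p)) = 9"
  unfolding ctag_def prog_code.simps by (simp; presburger?)+

lemma carg_simps [simp]:
  "carg (prog_code (Comp p q)) = pr (prog_code p) (prog_code q)"
  "carg (prog_code (Pair p q)) = pr (prog_code p) (prog_code q)"
  "carg (prog_code (Rec p q)) = pr (prog_code p) (prog_code q)"
  "carg (prog_code (Mu p)) = prog_code p"
  unfolding carg_def prog_code.simps by presburger+

text \<open>\<open>rq b a c u v\<close> claims that program \<open>c\<close> with oracle \<open>H\<^sub>a\<close> maps \<open>u\<close> to \<open>v\<close>, and \<open>iq b a x\<close> claims
  that \<open>x\<close> is in \<open>H\<^sub>a\<close>, for \<open>b = 1\<close>; for \<open>b = 0\<close> they claim the opposite.\<close>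

definition rq :: "nat \<Rightarrow> nat \<Rightarrow> nat \<Rightarrow> nat \<Rightarrow> nat \<Rightarrow> nat" where
  "rq b a c u v = pr 0 (pr b (pr a (pr c (pr u v))))"
definition iq :: "nat \<Rightarrow> nat \<Rightarrow> nat \<Rightarrow> nat" where
  "iq b a x = pr 1 (pr b (pr a x))"

lemma recfn_queries [rec_intros]:
  "recfn b \<Longrightarrow> recfn a \<Longrightarrow> recfn c \<Longrightarrow> recfn u \<Longrightarrow> recfn v \<Longrightarrow>
    recfn (\<lambda>x. rq (b x) (a x) (c x) (u x) (v x))"
  "recfn b \<Longrightarrow> recfn a \<Longrightarrow> recfn u \<Longrightarrow> recfn (\<lambda>x. iq (b x) (a x) (u x))"
  "recfn c \<Longrightarrow> recfn (\<lambda>x. ctag (c x))" "recfn c \<Longrightarrow> recfn (\<lambda>x. carg (c x))"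
  unfolding rq_def iq_def ctag_def carg_def by (intro rec_intros; assumption)+

definition run_pos :: "(nat \<Rightarrow> bool) \<Rightarrow> nat \<Rightarrow> nat \<Rightarrow> nat \<Rightarrow> nat \<Rightarrow> bool" where
  "run_pos Q a c u v \<longleftrightarrow>
    (ctag c = 0 \<and> v = 0) \<or> (ctag c = 1 \<and> v = Suc u) \<or> (ctag c = 2 \<and> v = u) \<or>
    (ctag c = 3 \<and> v = p1 u) \<or> (ctag c = 4 \<and> v = p2 u) \<or>
    (ctag c = 5 \<and> v = 1 \<and> Q (iq 1 a u)) \<or> (ctag c = 5 \<and> v = 0 \<and> Q (iq 0 a u)) \<or>
    (ctag c = 6 \<and> (\<exists>w. Q (rq 1 a (p2 (carg c)) u w) \<and> Q (rq 1 a (p1 (carg c)) w v))) \<or>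
    (ctag c = 7 \<and> Q (rq 1 a (p1 (carg c)) u (p1 v)) \<and> Q (rq 1 a (p2 (carg c)) u (p2 v))) \<or>
    (ctag c = 8 \<and> p2 u = 0 \<and> Q (rq 1 a (p1 (carg c)) (p1 u) v)) \<or>
    (ctag c = 8 \<and> p2 u \<noteq> 0 \<and> (\<exists>w. Q (rq 1 a c (pr (p1 u) (p2 u - 1)) w) \<and>
       Q (rq 1 a (p2 (carg c)) (pr (p1 u) (pr (p2 u - 1) w)) v))) \<or>
    (ctag c = 9 \<and> (\<forall>i. i < v \<longrightarrow> (\<exists>w. Q (rq 1 a (carg c) (pr u i) (Suc w)))) \<and>
       Q (rq 1 a (carg c) (pr u v) 0))"

text \<open>The de Morgan dual of \<open>run_pos\<close>, expressed by claims of tag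
  \<open>0\<close> because a positive operator cannot negate \<open>Q\<close>.\<close>

definition run_neg :: "(nat \<Rightarrow> bool) \<Rightarrow> nat \<Rightarrow> nat \<Rightarrow> nat \<Rightarrow> nat \<Rightarrow> bool" where
  "run_neg Q a c u v \<longleftrightarrow>
    (ctag c = 0 \<and> v \<noteq> 0) \<or> (ctag c = 1 \<and> v \<noteq> Suc u) \<or> (ctag c = 2 \<and> v \<noteq> u) \<or>
    (ctag c = 3 \<and> v \<noteq> p1 u) \<or> (ctag c = 4 \<and> v \<noteq> p2 u) \<or>
    (ctag c = 5 \<and> (v \<noteq> 1 \<or> Q (iq 0 a u)) \<and> (v \<noteq> 0 \<or> Q (iq 1 a u))) \<or>
    (ctag c = 6 \<and> (\<forall>w. Q (rq 0 a (p2 (carg c)) u w) \<or> Q (rq 0 a (p1 (carg c)) w v))) \<or>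
    (ctag c = 7 \<and> (Q (rq 0 a (p1 (carg c)) u (p1 v)) \<or> Q (rq 0 a (p2 (carg c)) u (p2 v)))) \<or>
    (ctag c = 8 \<and> p2 u = 0 \<and> Q (rq 0 a (p1 (carg c)) (p1 u) v)) \<or>
    (ctag c = 8 \<and> p2 u \<noteq> 0 \<and> (\<forall>w. Q (rq 0 a c (pr (p1 u) (p2 u - 1)) w) \<or>
       Q (rq 0 a (p2 (carg c)) (pr (p1 u) (pr (p2 u - 1) w)) v))) \<or>
    (ctag c = 9 \<and> ((\<exists>i. i < v \<and> (\<forall>w. Q (rq 0 a (carg c) (pr u i) (Suc w)))) \<or>
       Q (rq 0 a (carg c) (pr u v) 0)))"

text \<open>Oracle-free computations are queried at notation \<open>1\<close>, whose set is empty.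
  The guard \<open>b \<noteq> 0\<close> keeps \<open>1 = 2 ^ 0\<close> from counting as a
  successor.\<close>

definition in_pos :: "(nat \<Rightarrow> bool) \<Rightarrow> nat \<Rightarrow> nat \<Rightarrow> bool" where
  "in_pos Q a x \<longleftrightarrow> (\<exists>b. a = 2 ^ b \<and> b \<noteq> 0 \<and> (\<exists>y. Q (rq 1 b x x y))) \<or>
    (\<exists>e. a = 3 * 5 ^ e \<and> (\<exists>b. Q (rq 1 1 e (p2 x) b) \<and> Q (iq 1 b (p1 x))))"

definition in_neg :: "(nat \<Rightarrow> bool) \<Rightarrow> nat \<Rightarrow> nat \<Rightarrow> bool" where
  "in_neg Q a x \<longleftrightarrow> a = 1 \<or> (\<exists>b. a = 2 ^ b \<and> b \<noteq> 0 \<and> (\<forall>y. Q (rq 0 b x x y))) \<or>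
    (\<exists>e. a = 3 * 5 ^ e \<and> (\<forall>b. Q (rq 0 1 e (p2 x) b) \<or> Q (iq 0 b (p1 x))))"

definition oracle_op :: "(nat \<Rightarrow> bool) \<Rightarrow> nat \<Rightarrow> bool" where
  "oracle_op Q z \<longleftrightarrow>
    (p1 z = 0 \<and> p1 (p2 z) = 1 \<and> run_pos Q (p1 (p2 (p2 z))) (p1 (p2 (p2 (p2 z))))
       (p1 (p2 (p2 (p2 (p2 z))))) (p2 (p2 (p2 (p2 (p2 z)))))) \<or>
    (p1 z = 0 \<and> p1 (p2 z) = 0 \<and> run_neg Q (p1 (p2 (p2 z))) (p1 (p2 (p2 (p2 z))))
       (p1 (p2 (p2 (p2 (p2 z))))) (p2 (p2 (p2 (p2 (p2 z)))))) \<or>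
    (p1 z = 1 \<and> p1 (p2 z) = 1 \<and> in_pos Q (p1 (p2 (p2 z))) (p2 (p2 (p2 z)))) \<or>
    (p1 z = 1 \<and> p1 (p2 z) = 0 \<and> in_neg Q (p1 (p2 (p2 z))) (p2 (p2 (p2 z))))"

definition orc :: "nat \<Rightarrow> bool" where "orc = lfp oracle_op"

lemma posop_oracle_op: "posop oracle_op"
  unfolding oracle_op_def[abs_def] run_pos_def run_neg_def in_pos_def in_neg_def
  by (intro pos_intros hyp_intros rec_intros)

lemma pi11_orc: "pi11 orc"
  unfolding orc_def by (rule pi11_lfp[OF posop_oracle_op])

lemma posop_orc [pos_intros]: "recfn f \<Longrightarrow> posop (\<lambda>Q x. orc (f x))"
  using posop_comp[OF pi11_orc[unfolded pi11_def]] .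

lemma orc_unfold: "orc z = oracle_op orc z"
  unfolding orc_def using lfp_unfold[OF posop_mono[OF posop_oracle_op]] by metis

lemma orc_simps:
  "orc (rq 1 a c u v) = run_pos orc a c u v" "orc (rq 0 a c u v) = run_neg orc a c u v"
  "orc (iq 1 a x) = in_pos orc a x" "orc (iq 0 a x) = in_neg orc a x"
  by (subst orc_unfold, simp add: oracle_op_def rq_def iq_def)+

lemma run_iff:
  "run A Zero x y \<longleftrightarrow> y = 0" "run A Succ x y \<longleftrightarrow> y = Suc x" "run A Ident x y \<longleftrightarrow> y = x"
  "run A Fst x y \<longleftrightarrow> y = p1 x" "run A Snd x y \<longleftrightarrow> y = p2 x" "run A Query x y \<longleftrightarrow> y = of_bool (x \<in> A)"
  "run A (Comp p q) x z \<longleftrightarrow> (\<exists>y. run A q x y \<and> run A p y z)"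
  by (blast elim: run_elims intro: run.intros)+

lemma run_Pair_iff: "run A (Pair p q) x y \<longleftrightarrow> run A p x (p1 y) \<and> run A q x (p2 y)"
proof
  assume "run A p x (p1 y) \<and> run A q x (p2 y)"
  then have "run A (Pair p q) x (pr (p1 y) (p2 y))" by (intro run_Pair) auto
  then show "run A (Pair p q) x y" by simp
qed (auto elim: run_elims)

lemma run_Rec_iff:
  "run A (Rec p q) (pr x 0) z \<longleftrightarrow> run A p x z"
  "run A (Rec p q) (pr x (Suc n)) z \<longleftrightarrow>
    (\<exists>y. run A (Rec p q) (pr x n) y \<and> run A q (pr x (pr n y)) z)"
proof -
  show "run A (Rec p q) (pr x 0) z \<longleftrightarrow> run A p x z"
    by (auto elim: run_elims(9) intro: run.intros)
  have "\<exists>y. run A (Rec p q) (pr x n) y \<and> run A q (pr x (pr n y)) z" if "run A (Rec p q) (pr x (Suc n)) z"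
    using that by (rule run_elims(9)) auto
  then show "run A (Rec p q) (pr x (Suc n)) z \<longleftrightarrow>
    (\<exists>y. run A (Rec p q) (pr x n) y \<and> run A q (pr x (pr n y)) z)"
    by (auto intro: run.intros)
qed

lemma oracle_phi_prog_of: "oracle_phi A c u v \<longleftrightarrow> run A (prog_of c) u v"
  unfolding oracle_phi_def by (metis prog_code_prog_of prog_of_prog_code)

text \<open>The fixed-point equation refers to subprograms, which gives an induction on the program;
  \<open>Rec\<close> calls itself and takes an inner induction on the counter.\<close>

lemma orc_run:
  assumes "\<And>x. orc (iq 1 a x) \<longleftrightarrow> x \<in> A" "\<And>x. orc (iq 0 a x) \<longleftrightarrow> x \<notin> A"
  shows "(orc (rq 1 a (prog_code p) u v) \<longleftrightarrow> run A p u v) \<and>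
    (orc (rq 0 a (prog_code p) u v) \<longleftrightarrow> \<not> run A p u v)"
proof (induction p arbitrary: u v)
  case Zero
  show ?case unfolding orc_simps(1,2)[of a "prog_code Zero" u v] run_pos_def run_neg_def run_iff
    by (simp del: prog_code.simps)
next
  case Succ
  show ?case unfolding orc_simps(1,2)[of a "prog_code Succ" u v] run_pos_def run_neg_def run_iff
    by (simp del: prog_code.simps)
next
  case Ident
  show ?case unfolding orc_simps(1,2)[of a "prog_code Ident" u v] run_pos_def run_neg_def run_iff
    by (simp del: prog_code.simps)
next
  case Fst
  show ?case unfolding orc_simps(1,2)[of a "prog_code Fst" u v] run_pos_def run_neg_def run_iff
    by (simp del: prog_code.simps)
next
  case Snd
  show ?case unfolding orc_simps(1,2)[of a "prog_code Snd" u v] run_pos_def run_neg_def run_iff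
    by (simp del: prog_code.simps)
next
  case Query
  show ?case unfolding orc_simps(1,2)[of a "prog_code Query" u v] run_pos_def run_neg_def run_iff
    by (auto simp: assms simp del: prog_code.simps One_nat_def)
next
  case (Comp p q)
  show ?case unfolding orc_simps(1,2)[of a "prog_code (Comp p q)" u v] run_pos_def run_neg_def run_iff
    using Comp by (auto simp del: prog_code.simps)
next
  case (Pair p q)
  show ?case unfolding orc_simps(1,2)[of a "prog_code (Pair p q)" u v] run_pos_def run_neg_def run_Pair_iff
    using Pair by (auto simp del: prog_code.simps)
next
  case (Mu p)
  show ?case unfolding orc_simps(1,2)[of a "prog_code (Mu p)" u v] run_pos_def run_neg_def run_Mu_iff
    using Mu by (auto simp del: prog_code.simps)
next
  case (Rec p q)
  have "(orc (rq 1 a (prog_code (Rec p q)) (pr x n) v) \<longleftrightarrow> run A (Rec p q) (pr x n) v) \<and>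
    (orc (rq 0 a (prog_code (Rec p q)) (pr x n) v) \<longleftrightarrow> \<not> run A (Rec p q) (pr x n) v)" for x n v
  proof (induction n arbitrary: v)
    case 0
    show ?case unfolding orc_simps(1,2)[of a "prog_code (Rec p q)" "pr x 0" v] run_pos_def run_neg_def run_Rec_iff
      using Rec by (simp del: prog_code.simps)
  next
    case (Suc n)
    show ?case unfolding orc_simps(1,2)[of a "prog_code (Rec p q)" "pr x (Suc n)" v] run_pos_def run_neg_def run_Rec_iff
      using Rec Suc by (simp del: prog_code.simps)
  qed
  from this[of "p1 u" "p2 u" v] show ?case by simp
qed

text \<open>Along \<open>KO\<close> the fixed-point equation alone determines the answers of both
  tags.\<close>

lemma orc_Hset:
  assumes "a \<in> KO" "Hset a A"
  shows "(orc (iq 1 a x) \<longleftrightarrow> x \<in> A) \<and> (orc (iq 0 a x) \<longleftrightarrow> x \<notin> A)"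
proof -
  have one: "\<not> orc (iq 1 1 x)" "orc (iq 0 1 x)" for x
    unfolding orc_simps(3,4)[of 1] in_pos_def in_neg_def using two_power_neq_lim[of 0]
    by (auto simp: eq_commute[of "1::nat"] eq_commute[of "Suc 0"])
  have phi: "(orc (rq 1 1 e n b) \<longleftrightarrow> phi e n b) \<and> (orc (rq 0 1 e n b) \<longleftrightarrow> \<not> phi e n b)" for e n b
    using orc_run[of 1 "{}" "prog_of e" n b] one by (simp add: oracle_phi_prog_of)
  show ?thesis using assms(2,1)
  proof (induction arbitrary: x rule: Hset.induct)
    case Hset_one
    then show ?case using one by simp
  next
    case (Hset_succ a A)
    have r: "(orc (rq 1 a x x y) \<longleftrightarrow> oracle_phi A x x y) \<and> (orc (rq 0 a x x y) \<longleftrightarrow> \<not> oracle_phi A x x y)" for y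
      using orc_run[of a A "prog_of x" x y] Hset_succ by (simp add: oracle_phi_prog_of)
    have a: "(\<exists>b. (2::nat) ^ a = 2 ^ b \<and> b \<noteq> 0 \<and> R b) \<longleftrightarrow> R a" "\<not> (\<exists>e. (2::nat) ^ a = 3 * 5 ^ e \<and> R e)"
      "(2::nat) ^ a \<noteq> 1" for R
      using KO_nonzero[OF Hset_succ(1)] by (auto simp: two_power_neq_lim)
    show ?case unfolding orc_simps(3,4)[of "2 ^ a"] in_pos_def in_neg_def jump_def a
      by (simp add: r a(3) two_power_neq_lim del: One_nat_def)
  next
    case (Hset_lim e s A)
    have s: "phi e n b \<longleftrightarrow> b = s n" for n b using Hset_lim(2) oracle_phi_deterministic by blast
    have "s n \<in> KO" for n using KO_less[OF less_star_lim[OF Hset_lim(2)] Hset_lim(1)] .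
    then have IH: "(orc (iq 1 (s n) x) \<longleftrightarrow> x \<in> A n) \<and> (orc (iq 0 (s n) x) \<longleftrightarrow> x \<notin> A n)" for n x
      using Hset_lim.IH by blast
    have mem: "x \<in> {pr x n | x n. x \<in> A n} \<longleftrightarrow> p1 x \<in> A (p2 x)"
    proof
      assume "p1 x \<in> A (p2 x)"
      then have "x = pr (p1 x) (p2 x) \<and> p1 x \<in> A (p2 x)" by simp
      then show "x \<in> {pr x n | x n. x \<in> A n}" by blast
    qed auto
    have e: "(\<exists>e'. (3::nat) * 5 ^ e = 3 * 5 ^ e' \<and> R e') \<longleftrightarrow> R e" "\<not> (\<exists>b. (3::nat) * 5 ^ e = 2 ^ b \<and> R b)"
      "(3::nat) * 5 ^ e \<noteq> 1" for R
      using two_power_neq_lim[of 0 e] by (auto simp: two_power_neq_lim[symmetric])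
    show ?case unfolding orc_simps(3,4)[of "3 * 5 ^ e"] in_pos_def in_neg_def mem e
      using e(3) by (simp add: phi s IH two_power_neq_lim[symmetric] del: One_nat_def)
  qed
qed

lemma orc_oracle_phi:
  assumes "a \<in> KO" "Hset a A"
  shows "orc (rq 1 a c u v) \<longleftrightarrow> oracle_phi A c u v" "orc (rq 0 a c u v) \<longleftrightarrow> \<not> oracle_phi A c u v"
  using orc_run[of a A "prog_of c" u v] orc_Hset[OF assms] by (simp_all add: oracle_phi_prog_of)

lemma hyper_oracle_phi:
  assumes "a \<in> KO" "Hset a A" "recfn f" "recfn g" "recfn h"
  shows "hyper (\<lambda>x. oracle_phi A (f x) (g x) (h x))"
proof -
  have "pi11 (\<lambda>x. orc (rq 1 a (f x) (g x) (h x)))" "pi11 (\<lambda>x. orc (rq 0 a (f x) (g x) (h x)))"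
    unfolding pi11_def by (intro pos_intros rec_intros assms)+
  then show ?thesis unfolding hyper_def orc_oracle_phi[OF assms(1,2)] by blast
qed

lemma hyper_phi [hyp_intros]:
  "recfn f \<Longrightarrow> recfn g \<Longrightarrow> recfn h \<Longrightarrow> hyper (\<lambda>x. phi (f x) (g x) (h x))"
  by (rule hyper_oracle_phi[OF KO_one Hset_one])

section \<open>Hyperarithmetic functions and their graphs\<close>

theorem hyp_fun_hyper:
  assumes "hyp_fun g"
  shows "hyper (\<lambda>z. g (p1 z) = p2 z)"
proof -
  obtain a A c where a: "a \<in> KO" "Hset a A" and c: "\<And>x. oracle_phi A c x (g x)"
    using assms unfolding hyp_fun_def computable_from_def by blast
  have eq: "g x = y \<longleftrightarrow> oracle_phi A c x y" for x y
    using c oracle_phi_deterministic by blast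
  show ?thesis unfolding eq by (intro hyper_oracle_phi[OF a] rec_intros)
qed

text \<open>A single oracle decides the graph by \<open>pi11_both_hyp\<close>; searching for the
  value then computes the function.\<close>

theorem hyper_hyp_fun:
  assumes "hyper (\<lambda>z. g (p1 z) = p2 z)"
  shows "hyp_fun g"
proof -
  obtain a A p where a: "a \<in> KO" "Hset a A" and p: "\<And>z. run A p z (of_bool (g (p1 z) = p2 z))"
    using pi11_both_hyp assms unfolding hyper_def by blast
  have "recfn (\<lambda>x. 1 - x)" by (intro rec_intros)
  then obtain iz where iz: "\<And>A x. run A iz x (1 - x)" unfolding recfn_def by blast
  have "run A (Comp iz p) (pr x n) (1 - of_bool (g x = n))" for x n
    using run_Comp[OF p iz, of "pr x n"] by simp
  then have eq: "run A (Comp iz p) (pr x n) y \<longleftrightarrow> y = 1 - of_bool (g x = n)" for x n y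
    using run_deterministic by blast
  have "run A (Mu (Comp iz p)) x (g x)" for x
    unfolding run_Mu_iff eq by auto
  then have "computable_from A g" unfolding computable_from_def oracle_phi_def by blast
  then show ?thesis unfolding hyp_fun_def using a by blast
qed

section \<open>Definability of Kleene's order and notations\<close>

lemma hyper_star_step [hyp_intros]:
  "recfn f \<Longrightarrow> recfn g \<Longrightarrow> hyper (\<lambda>x. star_step (f x) (g x))"
proof -
  have "star_step a b \<longleftrightarrow> (a \<noteq> 0 \<and> b = 2 ^ a) \<or> (\<exists>e n. b = 3 * 5 ^ e \<and> phi e n a)" for a b
    by (auto elim: star_step.cases intro: star_step.intros)
  then have "hyper (\<lambda>z. star_step (p1 z) (p2 z))"
    by (simp only:) (intro hyp_intros rec_intros)
  from hyper_binary[OF this]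
  show "recfn f \<Longrightarrow> recfn g \<Longrightarrow> hyper (\<lambda>x. star_step (f x) (g x))" .
qed

lemma hyper_less_star [hyp_intros]:
  "recfn f \<Longrightarrow> recfn g \<Longrightarrow> hyper (\<lambda>x. f x <\<^sub>* g x)"
proof -
  have "a <\<^sub>* b \<longleftrightarrow> (\<exists>c. star_step a c \<and> star_step\<^sup>*\<^sup>* c b)" for a b
    unfolding less_star_def by (auto dest: tranclpD intro: rtranclp_into_tranclp2)
  then have "hyper (\<lambda>z. p1 z <\<^sub>* p2 z)"
    by (simp only:) (intro hyp_intros rec_intros)
  from hyper_binary[OF this]
  show "recfn f \<Longrightarrow> recfn g \<Longrightarrow> hyper (\<lambda>x. f x <\<^sub>* g x)" .
qed

lemma hyper_le_star [hyp_intros]: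
  "recfn f \<Longrightarrow> recfn g \<Longrightarrow> hyper (\<lambda>x. f x \<le>\<^sub>* g x)"
  unfolding le_star_def by (intro hyp_intros)

text \<open>The limit clause quantifies over values instead of a sequence; as \<open>phi\<close> is
  single-valued, they fit together to the sequence that \<open>KO_lim\<close> asks for.\<close>

lemma pi11_KO: "pi11 (\<lambda>a. a \<in> KO)"
proof -
  define \<Phi> where "\<Phi> Q a \<longleftrightarrow> a = 1 \<or> (\<exists>b. a = 2 ^ b \<and> Q b) \<or>
    (\<exists>e. a = 3 * 5 ^ e \<and> (\<forall>n. \<exists>y z. phi e n y \<and> phi e (Suc n) z \<and> y <\<^sub>* z \<and> Q y))" for Q and a :: nat
  have pos: "posop \<Phi>" unfolding \<Phi>_def[abs_def]
    by (intro pos_intros rec_intros posop_hyper[OF hyper_phi] posop_hyper[OF hyper_less_star])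
  have "lfp \<Phi> a \<longleftrightarrow> a \<in> KO" for a
  proof
    have "\<Phi> (\<lambda>a. a \<in> KO) \<le> (\<lambda>a. a \<in> KO)"
    proof (rule predicate1I)
      fix a assume "\<Phi> (\<lambda>a. a \<in> KO) a"
      then consider "a = 1" | b where "a = 2 ^ b" "b \<in> KO"
        | e where "a = 3 * 5 ^ e" "\<forall>n. \<exists>y z. phi e n y \<and> phi e (Suc n) z \<and> y <\<^sub>* z \<and> y \<in> KO"
        unfolding \<Phi>_def by blast
      then show "a \<in> KO"
      proof cases
        case 3
        then obtain s where s: "\<And>n. phi e n (s n)" "\<And>n. s n \<in> KO"
            and s': "\<And>n. \<exists>z. phi e (Suc n) z \<and> s n <\<^sub>* z" by metis
        have "s n <\<^sub>* s (Suc n)" for n using s(1) s' oracle_phi_deterministic by metis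
        then show ?thesis using KO_lim[of e s] s 3(1) by blast
      qed (simp_all only: KO_one KO_succ)
    qed
    then have "lfp \<Phi> \<le> (\<lambda>a. a \<in> KO)" by (rule lfp_lowerbound)
    then show "lfp \<Phi> a \<Longrightarrow> a \<in> KO" by auto
  next
    have unf: "\<Phi> (lfp \<Phi>) a \<Longrightarrow> lfp \<Phi> a" for a
      using lfp_unfold[OF posop_mono[OF pos]] by metis
    show "a \<in> KO \<Longrightarrow> lfp \<Phi> a"
    proof (induction rule: KO.induct)
      case KO_one
      show ?case by (rule unf) (simp add: \<Phi>_def)
    next
      case (KO_succ a)
      then have "\<Phi> (lfp \<Phi>) (2 ^ a)" by (subst \<Phi>_def) blast
      then show ?case by (rule unf)
    next
      case (KO_lim e s)
      then have "\<Phi> (lfp \<Phi>) (3 * 5 ^ e)" by (subst \<Phi>_def) blast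
      then show ?case by (rule unf)
    qed
  qed
  then have "lfp \<Phi> = (\<lambda>a. a \<in> KO)" by blast
  then show ?thesis using pi11_lfp[OF pos] by simp
qed

lemma posop_KO [pos_intros]: "recfn f \<Longrightarrow> posop (\<lambda>Q x. f x \<in> KO)"
  using posop_comp[OF pi11_KO[unfolded pi11_def]] .

section \<open>Pseudo-notations\<close>

lemma KO_star_le: "\<alpha> \<in> KO_star \<Longrightarrow> b \<le>\<^sub>* \<alpha> \<Longrightarrow> b \<in> KO_star"
  unfolding KO_star_def using le_star_trans by blast

lemma KO_le: "b \<le>\<^sub>* a \<Longrightarrow> a \<in> KO \<Longrightarrow> b \<in> KO"
  unfolding le_star_def using KO_less by blast

lemma less_star_last: "x <\<^sub>* b \<Longrightarrow> \<exists>c. star_step c b \<and> x \<le>\<^sub>* c"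
  unfolding less_star_def le_star_def by (metis tranclp.cases)

lemma not_less_star_one: "\<not> x <\<^sub>* 1"
  using less_star_last star_step_one by blast

lemma less_star_powerD: "x <\<^sub>* 2 ^ c \<Longrightarrow> x \<le>\<^sub>* c"
  using less_star_last star_step_power by blast

lemma less_star_limD: "x <\<^sub>* 3 * 5 ^ e \<Longrightarrow> \<exists>n y. phi e n y \<and> x \<le>\<^sub>* y"
  using less_star_last star_step_lim by blast

text \<open>Otherwise, passing from each element to the numerically least smaller one in
  \<open>D\<close> is a hyperarithmetic descending sequence, which \<open>KO_star\<close>
  excludes.\<close>

lemma KO_star_minimal:
  assumes "\<alpha> \<in> KO_star" "hyper D" "D b" "b \<le>\<^sub>* \<alpha>"
  shows "\<exists>c. D c \<and> c \<le>\<^sub>* b \<and> (\<forall>d. d <\<^sub>* c \<longrightarrow> \<not> D d)"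
proof (rule ccontr)
  assume "\<nexists>c. D c \<and> c \<le>\<^sub>* b \<and> (\<forall>d. d <\<^sub>* c \<longrightarrow> \<not> D d)"
  then have ex: "\<exists>d. D d \<and> d <\<^sub>* c" if "D c" "c \<le>\<^sub>* b" for c using that by blast
  define F where "F c = (LEAST d. D d \<and> d <\<^sub>* c)" for c
  have F: "D (F c)" "F c <\<^sub>* c" if "D c" "c \<le>\<^sub>* b" for c
    using LeastI_ex[OF ex[OF that]] unfolding F_def by auto
  \<comment> \<open>The graph of \<open>F\<close> without \<open>LEAST\<close>, so that the closure
    rules apply.\<close>
  define R where "R c d \<longleftrightarrow> D d \<and> d <\<^sub>* c \<and> (\<forall>i. i < d \<longrightarrow> \<not> (D i \<and> i <\<^sub>* c))" for c d
  have R: "R c d \<longleftrightarrow> d = F c" if "D c" "c \<le>\<^sub>* b" for c d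
    unfolding R_def F_def using F[OF that, unfolded F_def]
    by (metis (no_types, lifting) linorder_neqE_nat not_less_Least)
  define g where "g = rec_nat b (\<lambda>_. F)"
  have g0: "g 0 = b" and gS: "g (Suc n) = F (g n)" for n by (simp_all add: g_def)
  have g: "D (g n) \<and> g n \<le>\<^sub>* b" for n
  proof (induction n)
    case (Suc n)
    then show ?case unfolding gS using F less_le_star_trans[of "F (g n)" "g n" b] by (auto simp: le_star_def)
  qed (use assms in \<open>simp add: g0 le_star_def\<close>)
  have "(R ^^ n) b y \<longleftrightarrow> g n = y" for n y
  proof (induction n arbitrary: y)
    case (Suc n)
    then show ?case using R g by (auto simp: gS relcompp_apply)
  qed (auto simp: g0)
  moreover have "hyper (\<lambda>z. R (p1 z) (p2 z))"
    unfolding R_def by (intro hyp_intros hyper_comp[OF assms(2)] rec_intros)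
  then have "hyper (\<lambda>z. (R ^^ p1 z) b (p2 z))" by (intro hyp_intros rec_intros)
  ultimately have "hyp_fun g" by (intro hyper_hyp_fun) simp
  moreover have "g (Suc n) <\<^sub>* g n" for n unfolding gS using F g by blast
  ultimately show False using assms(1,4) g0 unfolding KO_star_def by blast
qed

lemma KO_star_well_formed: "\<alpha> \<in> KO_star \<Longrightarrow> b \<le>\<^sub>* \<alpha> \<Longrightarrow> well_formed b"
  unfolding KO_star_def by blast

text \<open>A minimal common upper bound of two incomparable elements lies strictly above both. It
  cannot be \<open>1\<close>, and a successor or the limit of an increasing sequence has a smaller
  common bound.\<close>

lemma KO_star_linear:
  assumes \<alpha>: "\<alpha> \<in> KO_star" and x: "x \<le>\<^sub>* \<alpha>" and y: "y \<le>\<^sub>* \<alpha>"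
  shows "x \<le>\<^sub>* y \<or> y <\<^sub>* x"
proof (rule ccontr)
  assume no: "\<not> (x \<le>\<^sub>* y \<or> y <\<^sub>* x)"
  have "hyper (\<lambda>b. x \<le>\<^sub>* b \<and> y \<le>\<^sub>* b)" by (intro hyp_intros rec_intros)
  from KO_star_minimal[OF \<alpha> this, of \<alpha>] obtain b where b: "x \<le>\<^sub>* b" "y \<le>\<^sub>* b" "b \<le>\<^sub>* \<alpha>"
    and min: "\<And>d. d <\<^sub>* b \<Longrightarrow> \<not> (x \<le>\<^sub>* d \<and> y \<le>\<^sub>* d)"
    using x y by (auto simp: le_star_def)
  have less: "x <\<^sub>* b" "y <\<^sub>* b" using no b unfolding le_star_def by auto
  have "well_formed b" using KO_star_well_formed[OF \<alpha> b(3)] .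
  then consider "b = 1" | c where "c \<noteq> 0" "b = 2 ^ c"
    | e s where "b = 3 * 5 ^ e" "\<And>n. phi e n (s n)" "\<And>n. s n <\<^sub>* s (Suc n)"
    unfolding well_formed_def by blast
  then show False
  proof cases
    case 1
    then show ?thesis using less not_less_star_one by simp
  next
    case (2 c)
    then show ?thesis using min[of c] less less_star_powerD less_star_succ by auto
  next
    case (3 e s)
    have mono: "s m \<le>\<^sub>* s (m + k)" for m k
    proof (induction k)
      case (Suc k)
      then show ?case using 3(3)[of "m + k"] le_less_star_trans by (auto simp: le_star_def)
    qed (simp add: le_star_def)
    obtain m n where "x \<le>\<^sub>* s m" "y \<le>\<^sub>* s n"
      using less_star_limD[of _ e] less 3 oracle_phi_deterministic by metis
    then have "x \<le>\<^sub>* s (m + n)" "y \<le>\<^sub>* s (m + n)"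
      using mono[of m n] mono[of n m] le_star_trans by (auto simp: add.commute)
    moreover have "s (m + n) <\<^sub>* b" using less_star_lim[OF 3(2)] 3(1) by simp
    ultimately show ?thesis using min by blast
  qed
qed

lemma one_le_star:
  assumes \<alpha>: "\<alpha> \<in> KO_star"
  shows "1 \<le>\<^sub>* \<alpha>"
proof -
  have "hyper (\<lambda>b. b \<le>\<^sub>* \<alpha>)" by (intro hyp_intros rec_intros)
  from KO_star_minimal[OF \<alpha> this, of \<alpha>] obtain b where b: "b \<le>\<^sub>* \<alpha>"
    and min: "\<And>d. d <\<^sub>* b \<Longrightarrow> \<not> d \<le>\<^sub>* \<alpha>" by (auto simp: le_star_def)
  have min': "\<not> d <\<^sub>* b" for d using min b less_le_star_trans by (auto simp: le_star_def)
  have "well_formed b" using KO_star_well_formed[OF \<alpha> b] .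
  then have "b = 1"
    unfolding well_formed_def using min' less_star_succ less_star_lim by blast
  then show ?thesis using b by simp
qed

text \<open>Since \<open>KO\<close> is closed under its formation clauses, a failure to belong to it
  goes back to an earlier failure.\<close>

lemma non_KO_predecessor:
  assumes \<alpha>: "\<alpha> \<in> KO_star" and b: "b \<le>\<^sub>* \<alpha>" "b \<notin> KO"
  shows "\<exists>c. c <\<^sub>* b \<and> c \<notin> KO"
proof -
  have "well_formed b" using KO_star_well_formed[OF \<alpha> b(1)] .
  then consider "b = 1" | c where "c \<noteq> 0" "b = 2 ^ c"
    | e s where "b = 3 * 5 ^ e" "\<And>n. phi e n (s n)" "\<And>n. s n <\<^sub>* s (Suc n)"
    unfolding well_formed_def by blast
  then show ?thesis
  proof cases
    case 1
    then show ?thesis using b KO_one by simp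
  next
    case (2 c)
    then show ?thesis using b KO_succ less_star_succ by blast
  next
    case (3 e s)
    then show ?thesis using b KO_lim[of e s] less_star_lim[of e] by metis
  qed
qed

text \<open>If every \<delta> outside \<open>KO\<close> had an element of \<open>Q\<close> at or
  below it, lying outside \<open>KO\<close> would itself be Pi-1-1 below \<alpha>, hence
  hyperarithmetic, and there would be a minimal notation outside \<open>KO\<close>.\<close>

theorem overspill:
  assumes \<alpha>: "\<alpha> \<in> KO_star - KO" and Q: "pi11 Q" and KO: "\<And>b. b \<le>\<^sub>* \<alpha> \<Longrightarrow> Q b \<Longrightarrow> b \<notin> KO"
  shows "\<exists>\<delta>. \<delta> \<le>\<^sub>* \<alpha> \<and> \<delta> \<notin> KO \<and> (\<forall>b. b \<le>\<^sub>* \<delta> \<longrightarrow> \<not> Q b)"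
proof (rule ccontr)
  assume no: "\<nexists>\<delta>. \<delta> \<le>\<^sub>* \<alpha> \<and> \<delta> \<notin> KO \<and> (\<forall>b. b \<le>\<^sub>* \<delta> \<longrightarrow> \<not> Q b)"
  define D where "D \<delta> \<longleftrightarrow> \<delta> \<le>\<^sub>* \<alpha> \<and> \<delta> \<notin> KO" for \<delta>
  have pos: "D \<delta> \<longleftrightarrow> \<delta> \<le>\<^sub>* \<alpha> \<and> (\<exists>b. b \<le>\<^sub>* \<delta> \<and> Q b)" for \<delta>
    unfolding D_def using no KO KO_le le_star_trans by blast
  have neg: "\<not> D \<delta> \<longleftrightarrow> \<not> \<delta> \<le>\<^sub>* \<alpha> \<or> \<delta> \<in> KO" for \<delta> unfolding D_def by blast
  have "pi11 (\<lambda>\<delta>. \<delta> \<le>\<^sub>* \<alpha> \<and> (\<exists>b. b \<le>\<^sub>* \<delta> \<and> Q b))"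
    unfolding pi11_def
    by (intro pos_intros posop_hyper[OF hyper_le_star] rec_intros posop_comp[OF Q[unfolded pi11_def]])
  moreover have "pi11 (\<lambda>\<delta>. \<not> \<delta> \<le>\<^sub>* \<alpha> \<or> \<delta> \<in> KO)"
    unfolding pi11_def
    by (intro pos_intros posop_hyper[OF hyper_not[OF hyper_le_star]] rec_intros)
  ultimately have "hyper D" unfolding hyper_def pos[symmetric, abs_def] neg[symmetric] by simp
  moreover have "D \<alpha>" using \<alpha> by (simp add: D_def le_star_def)
  ultimately obtain b where "D b" "\<And>d. d <\<^sub>* b \<Longrightarrow> \<not> D d"
    using KO_star_minimal[of \<alpha> D \<alpha>] \<alpha> by (auto simp: le_star_def)
  then show False using non_KO_predecessor[of \<alpha> b] \<alpha> less_le_star_trans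
    unfolding D_def by (auto simp: le_star_def)
qed

section \<open>Inductive evaluation of codes\<close>

text \<open>Derivability of the value \<open>b\<close> at a node; on an ill-founded tree possibly
  neither value is derivable. One relation serves both values, so negating a code flips
  \<open>b\<close>.\<close>

inductive evt :: "nat set \<Rightarrow> code \<Rightarrow> bool \<Rightarrow> nat list \<Rightarrow> bool" for X S where
  evt_leaf: "S \<tau> = Some (Clopen c, r) \<Longrightarrow> b = (X \<in> clopen_set c) \<Longrightarrow> evt X S b \<tau>"
| evt_ex: "S \<tau> = Some (if b then Union else Inter, r) \<Longrightarrow> \<tau> @ [m] \<in> dom S \<Longrightarrow>
    evt X S b (\<tau> @ [m]) \<Longrightarrow> evt X S b \<tau>"
| evt_all: "S \<tau> = Some (if b then Inter else Union, r) \<Longrightarrow>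
    (\<And>m. \<tau> @ [m] \<in> dom S \<Longrightarrow> evt X S b (\<tau> @ [m])) \<Longrightarrow> evt X S b \<tau>"

lemma evt_unfold:
  assumes "S \<tau> = Some (l, r)"
  shows "evt X S b \<tau> \<longleftrightarrow> (case l of Clopen c \<Rightarrow> b = (X \<in> clopen_set c)
    | Union \<Rightarrow> if b then \<exists>m. \<tau> @ [m] \<in> dom S \<and> evt X S b (\<tau> @ [m])
        else \<forall>m. \<tau> @ [m] \<in> dom S \<longrightarrow> evt X S b (\<tau> @ [m])
    | Inter \<Rightarrow> if b then \<forall>m. \<tau> @ [m] \<in> dom S \<longrightarrow> evt X S b (\<tau> @ [m])
        else \<exists>m. \<tau> @ [m] \<in> dom S \<and> evt X S b (\<tau> @ [m]))" (is "_ \<longleftrightarrow> ?R")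
proof
  assume "evt X S b \<tau>"
  then show ?R
  proof cases
    case evt_leaf
    then show ?thesis using assms by simp
  next
    case (evt_ex r m)
    then show ?thesis using assms by (cases b) auto
  next
    case (evt_all r)
    then show ?thesis using assms by (cases b) auto
  qed
next
  assume ?R
  then show "evt X S b \<tau>"
    using assms evt_leaf[of S \<tau> _ r b X] evt_ex[of S \<tau> b r _ X] evt_all[of S \<tau> b r X]
    by (cases l; cases b) auto
qed

lemma dom_neg_code [simp]: "dom (neg_code S) = dom S"
  by (auto simp: neg_code_def dom_def)

lemma neg_code_Some: "neg_code S \<tau> = Some (l, r) \<longleftrightarrow> (\<exists>l'. S \<tau> = Some (l', r) \<and> l = neg_label l')"
  by (auto simp: neg_code_def)

lemma neg_label_iff [simp]:
  "neg_label l = Union \<longleftrightarrow> l = Inter" "neg_label l = Inter \<longleftrightarrow> l = Union"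
  "Union = neg_label l \<longleftrightarrow> l = Inter" "Inter = neg_label l \<longleftrightarrow> l = Union"
  by (cases l; simp)+

lemma evt_neg_code: "evt X (neg_code S) b \<tau> \<longleftrightarrow> evt X S (\<not> b) \<tau>"
proof
  assume "evt X (neg_code S) b \<tau>"
  then show "evt X S (\<not> b) \<tau>"
  proof (induction rule: evt.induct)
    case (evt_leaf \<tau> c r b)
    then obtain l where l: "S \<tau> = Some (l, r)" "neg_label l = Clopen c" by (auto simp: neg_code_Some)
    then obtain c' where "l = Clopen c'" "c = clopen_compl c'" by (cases l) auto
    then show ?case using evt_leaf l by (auto simp: clopen_set_compl intro: evt.evt_leaf)
  next
    case (evt_ex \<tau> b r m)
    then show ?case by (intro evt.evt_ex[of S \<tau> _ r m]) (cases b; auto simp: neg_code_Some)+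
  next
    case (evt_all \<tau> b r)
    then show ?case by (intro evt.evt_all[of S \<tau> _ r]) (cases b; auto simp: neg_code_Some)+
  qed
next
  have "evt X S b \<tau> \<Longrightarrow> evt X (neg_code S) (\<not> b) \<tau>" for b
  proof (induction rule: evt.induct)
    case (evt_leaf \<tau> c r b)
    then show ?case
      by (intro evt.evt_leaf[of _ _ "clopen_compl c" r]) (auto simp: neg_code_Some clopen_set_compl)
  next
    case (evt_ex \<tau> b r m)
    then show ?case by (intro evt.evt_ex[of _ \<tau> _ r m]) (cases b; auto simp: neg_code_Some)+
  next
    case (evt_all \<tau> b r)
    then show ?case by (intro evt.evt_all[of _ \<tau> _ r]) (cases b; auto simp: neg_code_Some)+
  qed
  from this[of "\<not> b"] show "evt X S (\<not> b) \<tau> \<Longrightarrow> evt X (neg_code S) b \<tau>" by simp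
qed

lemma rk_Some: "S \<tau> = Some (l, r) \<Longrightarrow> rk S \<tau> = r" "S \<tau> = Some (l, r) \<Longrightarrow> lab S \<tau> = l"
  by (simp_all add: rk_def lab_def)

lemma ranked_neg_code:
  assumes "ranked_Borel_code \<alpha> S"
  shows "ranked_Borel_code \<alpha> (neg_code S)"
proof -
  have rk: "rk (neg_code S) \<tau> = rk S \<tau>" for \<tau>
    by (cases "S \<tau>") (auto simp: rk_def neg_code_def)
  have lab: "lab (neg_code S) \<tau> = neg_label (lab S \<tau>)" if "\<tau> \<in> dom S" for \<tau>
    using that by (auto simp: lab_def neg_code_def)
  have leaf: "neg_label l \<in> range Clopen" if "l \<in> range Clopen" for l using that by auto
  have "if \<exists>n. \<tau> @ [n] \<in> dom S then lab (neg_code S) \<tau> \<in> {Union, Inter}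
      else lab (neg_code S) \<tau> \<in> range Clopen" if d: "\<tau> \<in> dom S" for \<tau>
  proof -
    have "if \<exists>n. \<tau> @ [n] \<in> dom S then lab S \<tau> \<in> {Union, Inter} else lab S \<tau> \<in> range Clopen"
      using assms d unfolding ranked_Borel_code_def labeled_Borel_code_def by blast
    then show ?thesis using leaf by (simp add: lab[OF d] split: if_splits) blast
  qed
  then show ?thesis using assms
    unfolding ranked_Borel_code_def labeled_Borel_code_def dom_neg_code rk by blast
qed

lemma KO_less_induct [consumes 1, case_names less]:
  assumes "a \<in> KO" "\<And>a. a \<in> KO \<Longrightarrow> (\<And>b. b <\<^sub>* a \<Longrightarrow> R b) \<Longrightarrow> R a"
  shows "R a"
proof -
  \<comment> \<open>Accessibility concerns single steps, so the claim is carried for everything at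
    or below \<open>a\<close>.\<close>
  have "\<forall>b. b \<le>\<^sub>* a \<longrightarrow> R b" if "Wellfounded.accp star_step a" "a \<in> KO" for a using that
  proof (induction rule: accp.induct)
    case (accI a)
    have "R b" if "b <\<^sub>* a" for b
      using less_star_last[OF that] accI.IH KO_step[OF accI.prems] by blast
    then show ?case using assms(2)[OF accI.prems] by (auto simp: le_star_def)
  qed
  then show ?thesis using KO_accp[OF assms(1)] assms(1) by (simp add: le_star_def)
qed

lemma KO_less_irrefl: "a \<in> KO \<Longrightarrow> \<not> a <\<^sub>* a"
  by (erule KO_less_induct) blast

lemma evt_determined:
  assumes S: "ranked_Borel_code \<alpha> S" and "S \<tau> = Some (l, r)" "r \<in> KO"
  shows "evt X S False \<tau> \<longleftrightarrow> \<not> evt X S True \<tau>"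
  using assms(3,2)
proof (induction arbitrary: \<tau> l rule: KO_less_induct)
  case (less r)
  have "evt X S False (\<tau> @ [m]) \<longleftrightarrow> \<not> evt X S True (\<tau> @ [m])" if d: "\<tau> @ [m] \<in> dom S" for m
  proof -
    obtain l' r' where 1: "S (\<tau> @ [m]) = Some (l', r')" using d by auto
    have "rk S (\<tau> @ [m]) <\<^sub>* rk S \<tau>" using S d unfolding ranked_Borel_code_def by blast
    then have "r' <\<^sub>* r" using 1 less(3) by (simp add: rk_def)
    then show ?thesis using less(2) 1 by blast
  qed
  then show ?case unfolding evt_unfold[of S \<tau> l r, OF less(3)] by (auto split: label.split)
qed

text \<open>Ranks in \<open>KO\<close> admit induction, so the local clauses have only one solution
  there.\<close>

lemma evaluation_map_evt:
  assumes S: "ranked_Borel_code \<alpha> S" and f: "evaluation_map X S f" and "S \<tau> = Some (l, r)" "r \<in> KO"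
  shows "f \<tau> = Some True \<longleftrightarrow> evt X S True \<tau>"
  using assms(4,3)
proof (induction arbitrary: \<tau> l rule: KO_less_induct)
  case (less r)
  have "f (\<tau> @ [m]) = Some True \<longleftrightarrow> evt X S True (\<tau> @ [m])" if d: "\<tau> @ [m] \<in> dom S" for m
  proof -
    obtain l' r' where 1: "S (\<tau> @ [m]) = Some (l', r')" using d by auto
    have "rk S (\<tau> @ [m]) <\<^sub>* rk S \<tau>" using S d unfolding ranked_Borel_code_def by blast
    then have "r' <\<^sub>* r" using 1 less(3) by (simp add: rk_def)
    then show ?thesis using less(2) 1 by blast
  qed
  note children = this
  have "\<tau> \<in> dom S" using less(3) by blast
  then have "f \<tau> = Some True \<longleftrightarrow> (case l of Clopen c \<Rightarrow> X \<in> clopen_set c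
      | Union \<Rightarrow> \<exists>n. \<tau> @ [n] \<in> dom S \<and> f (\<tau> @ [n]) = Some True
      | Inter \<Rightarrow> \<forall>n. \<tau> @ [n] \<in> dom S \<longrightarrow> f (\<tau> @ [n]) = Some True)"
    using f rk_Some(2)[of S \<tau> l r, OF less(3)] unfolding evaluation_map_def by blast
  then show ?case unfolding evt_unfold[of S \<tau> l r, OF less(3)] using children
    by (cases l; simp; blast?)
qed

section \<open>Evaluation in terms of indices\<close>

text \<open>Names for points: a quantifier over \<open>HYP\<close> becomes one over two numbers
  subject to a Pi-1-1 condition.\<close>

definition index_of :: "nat \<Rightarrow> nat \<Rightarrow> nat set \<Rightarrow> bool" where
  "index_of a c X \<longleftrightarrow> a \<in> KO \<and> (\<exists>A. Hset a A \<and> (\<forall>x. oracle_phi A c x (of_bool (x \<in> X))))"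

lemma HYP_index: "X \<in> HYP \<longleftrightarrow> (\<exists>a c. index_of a c X)"
  unfolding HYP_def hyp_fun_def computable_from_def index_of_def by blast

lemma index_of_orc:
  assumes "index_of a c X"
  shows "orc (rq 1 a c x y) \<longleftrightarrow> y = of_bool (x \<in> X)"
proof -
  obtain A where A: "a \<in> KO" "Hset a A" "\<And>x. oracle_phi A c x (of_bool (x \<in> X))"
    using assms unfolding index_of_def by blast
  show ?thesis unfolding orc_oracle_phi[OF A(1,2)] using A(3) oracle_phi_deterministic by blast
qed

lemma index_ofI:
  assumes "a \<in> KO" "\<And>x. orc (rq 1 a c x 0) \<or> orc (rq 1 a c x 1)"
  shows "\<exists>X. index_of a c X"
proof -
  obtain A where A: "Hset a A" using Hset_total assms(1) by blast
  have "oracle_phi A c x (of_bool (x \<in> {x. oracle_phi A c x 1}))" for x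
    using assms(2)[of x] unfolding orc_oracle_phi[OF assms(1) A] by auto
  then show ?thesis unfolding index_of_def using assms(1) A by blast
qed

text \<open>The first \<open>p1 k\<close> bits of the point are guessed as \<open>w\<close>, and
  bits of either value are confirmed by positive queries; so both truth values are Pi-1-1 in the
  index.\<close>

definition clopen_op :: "nat \<Rightarrow> nat \<Rightarrow> nat \<Rightarrow> nat \<Rightarrow> bool" where
  "clopen_op a c k b \<longleftrightarrow> (\<exists>w. w < 2 ^ p1 k \<and>
    (\<forall>i. i < p1 k \<longrightarrow> (odd (w div 2 ^ i) \<and> orc (rq 1 a c i 1)) \<or> (even (w div 2 ^ i) \<and> orc (rq 1 a c i 0))) \<and>
    ((b = 1 \<and> odd (p2 k div 2 ^ w)) \<or> (b = 0 \<and> even (p2 k div 2 ^ w))))"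

lemma clopen_op_index:
  assumes "index_of a c X"
  shows "clopen_op a c k (of_bool b) \<longleftrightarrow> b = (X \<in> clopen_set k)"
proof -
  have o: "orc (rq 1 a c i 1) \<longleftrightarrow> i \<in> X" "orc (rq 1 a c i 0) \<longleftrightarrow> i \<notin> X" for i
    unfolding index_of_orc[OF assms] by auto
  have bits: "(w < 2 ^ n \<and> (\<forall>i. i < n \<longrightarrow> (odd (w div 2 ^ i) \<and> i \<in> X) \<or> (even (w div 2 ^ i) \<and> i \<notin> X)))
      \<longleftrightarrow> w = set_encode (X \<inter> {..<n})" for w n
  proof
    assume w: "w < 2 ^ n \<and> (\<forall>i. i < n \<longrightarrow> (odd (w div 2 ^ i) \<and> i \<in> X) \<or> (even (w div 2 ^ i) \<and> i \<notin> X))"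
    have "even (w div 2 ^ i)" if "\<not> i < n" for i
    proof -
      have "w < 2 ^ i" using w that by (meson less_le_trans not_less one_le_numeral power_increasing)
      then show ?thesis by simp
    qed
    then have "set_decode w = X \<inter> {..<n}" using w by (auto simp: set_decode_def)
    then show "w = set_encode (X \<inter> {..<n})" by (metis set_decode_inverse)
  next
    assume w: "w = set_encode (X \<inter> {..<n})"
    then have "set_decode w = X \<inter> {..<n}" by simp
    then have "odd (w div 2 ^ i) \<longleftrightarrow> i \<in> X \<and> i < n" for i unfolding set_decode_def by blast
    then show "w < 2 ^ n \<and> (\<forall>i. i < n \<longrightarrow> (odd (w div 2 ^ i) \<and> i \<in> X) \<or> (even (w div 2 ^ i) \<and> i \<notin> X))"
      using set_encode_less[of X n] w by blast
  qed
  have "clopen_op a c k (of_bool b) \<longleftrightarrow>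
      ((b \<and> odd (p2 k div 2 ^ set_encode (X \<inter> {..<p1 k}))) \<or>
       (\<not> b \<and> even (p2 k div 2 ^ set_encode (X \<inter> {..<p1 k}))))"
    unfolding clopen_op_def o conj_assoc[symmetric] bits by auto
  then show ?thesis by (auto simp: clopen_set_def set_decode_def split: prod.splits)
qed

lemma label_encode_cases:
  "label_encode l = 0 \<longleftrightarrow> l = Union" "label_encode l = 1 \<longleftrightarrow> l = Inter"
  "label_encode l = c + 2 \<longleftrightarrow> l = Clopen c"
  by (cases l; simp)+

lemma code_fun_eq:
  "code_fun S s = 0 \<longleftrightarrow> list_decode s \<notin> dom S"
  "code_fun S s = Suc y \<longleftrightarrow> (\<exists>l r. S (list_decode s) = Some (l, r) \<and> y = pr (label_encode l) r)"
  by (auto simp: code_fun_def string_fun_def split: option.splits)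

lemma list_decode_csnoc: "list_decode (csnoc s m) = list_decode s @ [m]"
  using csnoc_list_encode[of "list_decode s" m] by (metis list_decode_inverse list_encode_inverse)

definition evq :: "nat \<Rightarrow> nat \<Rightarrow> nat \<Rightarrow> nat \<Rightarrow> nat \<Rightarrow> nat" where
  "evq a c n b s = pr a (pr c (pr n (pr b s)))"

lemma recfn_evq [rec_intros]:
  "recfn b \<Longrightarrow> recfn a \<Longrightarrow> recfn c \<Longrightarrow> recfn u \<Longrightarrow> recfn v \<Longrightarrow>
    recfn (\<lambda>x. evq (b x) (a x) (c x) (u x) (v x))"
  unfolding evq_def by (intro rec_intros)

lemma hyper_code_fun:
  assumes "hyp_code_seq S" "recfn f" "recfn g" "recfn h"
  shows "hyper (\<lambda>x. code_fun (S (f x)) (g x) = h x)"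
proof -
  have "hyp_fun (\<lambda>x. code_fun (S (p1 x)) (p2 x))"
    using assms(1) unfolding hyp_code_seq_def by (simp add: case_prod_beta)
  from hyper_comp[OF hyp_fun_hyper[OF this], of "\<lambda>x. pr (pr (f x) (g x)) (h x)"]
  show ?thesis by (simp add: rec_intros assms)
qed

text \<open>The uniformity in the index is what lets \<open>pi11_clash\<close> quantify over all
  points.\<close>

lemma pi11_evt:
  assumes "hyp_code_seq S"
  shows "\<exists>E. pi11 E \<and> (\<forall>a c X n b \<tau>. index_of a c X \<longrightarrow>
    (E (evq a c n (of_bool b) (list_encode \<tau>)) \<longleftrightarrow> evt X (S n) b \<tau>))"
proof -
  define \<Phi> where "\<Phi> Q z \<longleftrightarrow> (\<exists>a c n b s l r. z = evq a c n b s \<and> code_fun (S n) s = Suc (pr l r) \<and>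
    ((\<exists>k. l = k + 2 \<and> clopen_op a c k b) \<or>
     ((l = 0 \<and> b = 1 \<or> l = 1 \<and> b = 0) \<and>
       (\<exists>m y. code_fun (S n) (csnoc s m) = Suc y \<and> Q (evq a c n b (csnoc s m)))) \<or>
     ((l = 1 \<and> b = 1 \<or> l = 0 \<and> b = 0) \<and>
       (\<forall>m. code_fun (S n) (csnoc s m) = 0 \<or> Q (evq a c n b (csnoc s m))))))" for Q and z :: nat
  have pos: "posop \<Phi>" unfolding \<Phi>_def[abs_def] clopen_op_def
    by (intro pos_intros hyp_intros posop_hyper[OF hyper_code_fun[OF assms]] rec_intros)
  have unf: "lfp \<Phi> z \<longleftrightarrow> \<Phi> (lfp \<Phi>) z" for z
    using lfp_unfold[OF posop_mono[OF pos]] by metis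
  have inj: "evq a c n b s = evq a' c' n' b' s' \<longleftrightarrow> a = a' \<and> c = c' \<and> n = n' \<and> b = b' \<and> s = s'"
    for a c n b s a' c' n' b' s' unfolding evq_def by simp
  have step: "\<Phi> Q (evq a c n (of_bool b) s) \<longleftrightarrow> (\<exists>l r. S n (list_decode s) = Some (l, r) \<and>
    (case l of Clopen k \<Rightarrow> b = (X \<in> clopen_set k)
     | Union \<Rightarrow> if b then \<exists>m. list_decode s @ [m] \<in> dom (S n) \<and> Q (evq a c n (of_bool b) (csnoc s m))
        else \<forall>m. list_decode s @ [m] \<in> dom (S n) \<longrightarrow> Q (evq a c n (of_bool b) (csnoc s m))
     | Inter \<Rightarrow> if b then \<forall>m. list_decode s @ [m] \<in> dom (S n) \<longrightarrow> Q (evq a c n (of_bool b) (csnoc s m))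
        else \<exists>m. list_decode s @ [m] \<in> dom (S n) \<and> Q (evq a c n (of_bool b) (csnoc s m))))"
    if ix: "index_of a c X" for Q a c X n b s
  proof -
    have d0: "code_fun (S n) (csnoc s m) = 0 \<longleftrightarrow> list_decode s @ [m] \<notin> dom (S n)" for m
      unfolding code_fun_eq list_decode_csnoc ..
    have d1: "(\<exists>y. code_fun (S n) (csnoc s m) = Suc y) \<longleftrightarrow> list_decode s @ [m] \<in> dom (S n)" for m
      using d0[of m] by (metis not0_implies_Suc old.nat.distinct(2))
    show ?thesis
    proof (cases "S n (list_decode s)")
      case None
      then have "code_fun (S n) s = 0" by (simp add: code_fun_eq dom_def)
      then show ?thesis unfolding \<Phi>_def inj using None by simp
    next
      case (Some lr)
      obtain l r where lr: "lr = (l, r)" by fastforce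
      have sp: "code_fun (S n) s = Suc (pr l' r') \<longleftrightarrow> l' = label_encode l \<and> r' = r" for l' r'
        unfolding code_fun_eq using Some lr by auto
      have "\<Phi> Q (evq a c n (of_bool b) s) \<longleftrightarrow>
        ((\<exists>k. label_encode l = k + 2 \<and> clopen_op a c k (of_bool b)) \<or>
         ((label_encode l = 0 \<and> b \<or> label_encode l = 1 \<and> \<not> b) \<and>
           (\<exists>m. list_decode s @ [m] \<in> dom (S n) \<and> Q (evq a c n (of_bool b) (csnoc s m)))) \<or>
         ((label_encode l = 1 \<and> b \<or> label_encode l = 0 \<and> \<not> b) \<and>
           (\<forall>m. list_decode s @ [m] \<notin> dom (S n) \<or> Q (evq a c n (of_bool b) (csnoc s m)))))"
        by (cases b) (simp_all add: \<Phi>_def inj d0 d1 sp)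
      then show ?thesis using Some lr by (cases l) (auto simp: clopen_op_index[OF ix])
    qed
  qed
  have "lfp \<Phi> (evq a c n (of_bool b) (list_encode \<tau>)) \<longleftrightarrow> evt X (S n) b \<tau>"
    if ix: "index_of a c X" for a c X n b \<tau>
  proof
    \<comment> \<open>Queries about other points or codes satisfy \<open>R\<close>
      vacuously.\<close>
    define R where "R z \<longleftrightarrow> (\<forall>b s. z = evq a c n (of_bool b) s \<longrightarrow> evt X (S n) b (list_decode s))" for z
    have "\<Phi> R z \<Longrightarrow> R z" for z
    proof -
      assume z: "\<Phi> R z"
      show "R z" unfolding R_def
      proof (intro allI impI)
        fix b s assume "z = evq a c n (of_bool b) s"
        then have "\<Phi> R (evq a c n (of_bool b) s)" using z by simp
        then obtain l r where lr: "S n (list_decode s) = Some (l, r)"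
          and C: "case l of Clopen k \<Rightarrow> b = (X \<in> clopen_set k)
     | Union \<Rightarrow> if b then \<exists>m. list_decode s @ [m] \<in> dom (S n) \<and> R (evq a c n (of_bool b) (csnoc s m))
        else \<forall>m. list_decode s @ [m] \<in> dom (S n) \<longrightarrow> R (evq a c n (of_bool b) (csnoc s m))
     | Inter \<Rightarrow> if b then \<forall>m. list_decode s @ [m] \<in> dom (S n) \<longrightarrow> R (evq a c n (of_bool b) (csnoc s m))
        else \<exists>m. list_decode s @ [m] \<in> dom (S n) \<and> R (evq a c n (of_bool b) (csnoc s m))"
          unfolding step[OF ix] by blast
        have "R (evq a c n (of_bool b) (csnoc s m)) \<Longrightarrow> evt X (S n) b (list_decode s @ [m])" for m
          unfolding R_def using list_decode_csnoc by metis
        then show "evt X (S n) b (list_decode s)"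
          unfolding evt_unfold[of "S n" "list_decode s" l r, OF lr] using C by (cases l; cases b; simp; blast?)
      qed
    qed
    then have "lfp \<Phi> \<le> R" by (intro lfp_lowerbound) auto
    moreover assume "lfp \<Phi> (evq a c n (of_bool b) (list_encode \<tau>))"
    ultimately have "R (evq a c n (of_bool b) (list_encode \<tau>))" by auto
    then show "evt X (S n) b \<tau>" unfolding R_def by (metis list_encode_inverse)
  next
    have cs: "csnoc (list_encode \<tau>) m = list_encode (\<tau> @ [m])" for \<tau> m by (rule csnoc_list_encode)
    show "evt X (S n) b \<tau> \<Longrightarrow> lfp \<Phi> (evq a c n (of_bool b) (list_encode \<tau>))"
    proof (induction rule: evt.induct)
      case (evt_leaf \<tau> k r b)
      then show ?case by (subst unf, unfold step[OF ix]) simp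
    next
      case (evt_ex \<tau> b r m)
      then show ?case
        by (subst unf, unfold step[OF ix] cs) (cases b; auto)
    next
      case (evt_all \<tau> b r)
      then show ?case
        by (subst unf, unfold step[OF ix] cs) (cases b; auto)
    qed
  qed
  then show ?thesis using pi11_lfp[OF pos] by blast
qed

lemma pi11_evt_HYP:
  assumes "hyp_code_seq S" "X \<in> HYP" "recfn f" "recfn g"
  shows "pi11 (\<lambda>x. evt X (S (f x)) b (list_decode (g x)))"
proof -
  obtain a c where ix: "index_of a c X" using assms(2) HYP_index by blast
  obtain E where E: "pi11 E" "\<And>n b \<tau>. E (evq a c n (of_bool b) (list_encode \<tau>)) \<longleftrightarrow> evt X (S n) b \<tau>"
    using pi11_evt[OF assms(1)] ix by blast
  have "pi11 (\<lambda>x. E (evq a c (f x) (of_bool b) (g x)))"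
    unfolding pi11_def by (intro posop_comp[OF E(1)[unfolded pi11_def]] rec_intros assms)
  then show ?thesis using E(2)[of _ b "list_decode _"] by simp
qed

section \<open>Hyperarithmetic evaluation maps\<close>

lemma string_fun_of_bool:
  "string_fun of_bool f s = y \<longleftrightarrow> (y = 0 \<and> f (list_decode s) = None) \<or>
    (y = 1 \<and> f (list_decode s) = Some False) \<or> (y = 2 \<and> f (list_decode s) = Some True)"
  by (auto simp: string_fun_def split: option.splits)

text \<open>For a rank in \<open>KO\<close> the two values of \<open>evt\<close> are complementary
  and both Pi-1-1, so \<open>evt\<close> itself is a hyperarithmetic evaluation map; any other map
  agrees with it.\<close>

lemma HYP_interp_evt:
  assumes S: "hyp_code_seq S" and "ranked_Borel_code \<alpha> (S n)" and KO: "rank (S n) \<in> KO" and X: "X \<in> HYP"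
  shows "X \<in> HYP_interp (S n) \<longleftrightarrow> evt X (S n) True []"
proof -
  have root: "[] \<in> dom (S n)" and less: "\<And>\<tau> m. \<tau> @ [m] \<in> dom (S n) \<Longrightarrow> \<tau> \<in> dom (S n) \<and> rk (S n) (\<tau> @ [m]) <\<^sub>* rk (S n) \<tau>"
    using assms(2) unfolding ranked_Borel_code_def labeled_Borel_code_def by blast+
  have dom_KO: "rk (S n) \<tau> \<in> KO" if "\<tau> \<in> dom (S n)" for \<tau> using that
    by (induction \<tau> rule: rev_induct) (use KO less KO_less in blast)+
  show ?thesis
  proof
    assume "X \<in> HYP_interp (S n)"
    then obtain f where "evaluation_map X (S n) f" "f [] = Some True"
      unfolding HYP_interp_def HYP_evaluation_map_def by blast
    moreover obtain l r where "S n [] = Some (l, r)" using root by auto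
    ultimately show "evt X (S n) True []"
      using evaluation_map_evt[OF assms(2)] KO rk_Some(1) by metis
  next
    assume ev: "evt X (S n) True []"
    define f where "f \<tau> = (if \<tau> \<in> dom (S n) then Some (evt X (S n) True \<tau>) else None)" for \<tau>
    have "evaluation_map X (S n) f"
      unfolding evaluation_map_def
    proof (intro conjI ballI)
      show "dom f = dom (S n)" by (auto simp: f_def dom_def)
      fix \<tau> assume d: "\<tau> \<in> dom (S n)"
      then obtain l r where lr: "S n \<tau> = Some (l, r)" by auto
      show "(f \<tau> = Some True) = (case lab (S n) \<tau> of Union \<Rightarrow> \<exists>m. \<tau> @ [m] \<in> dom (S n) \<and> f (\<tau> @ [m]) = Some True
         | Inter \<Rightarrow> \<forall>m. \<tau> @ [m] \<in> dom (S n) \<longrightarrow> f (\<tau> @ [m]) = Some True | Clopen c \<Rightarrow> X \<in> clopen_set c)"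
        using d unfolding f_def rk_Some(2)[of "S n" \<tau> l r, OF lr] by (auto simp: evt_unfold[of "S n" \<tau> l r, OF lr] split: label.splits)
    qed
    moreover have "hyp_fun (string_fun of_bool f)"
    proof (rule hyper_hyp_fun)
      define D where "D z \<longleftrightarrow> list_decode (p1 z) \<in> dom (S n)" for z
      have D: "hyper D"
      proof -
        have "hyper (\<lambda>z. \<not> code_fun (S n) (p1 z) = 0)"
          by (intro hyp_intros hyper_code_fun[OF S] rec_intros)
        then show ?thesis unfolding D_def[abs_def] code_fun_eq by simp
      qed
      define V where "V z \<longleftrightarrow> D z \<and> evt X (S n) True (list_decode (p1 z))" for z
      have neg: "\<not> V z \<longleftrightarrow> \<not> D z \<or> evt X (S n) False (list_decode (p1 z))" for z
        unfolding V_def D_def using evt_determined[OF assms(2)] dom_KO rk_Some(1) by (metis domD surj_pair)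
      have V: "hyper V"
        unfolding hyper_def neg unfolding V_def[abs_def] pi11_def
        by (intro conjI pos_intros posop_hyper[OF D] posop_hyper[OF hyper_not[OF D]]
            pi11_evt_HYP[OF S X, unfolded pi11_def] rec_intros)
      have "string_fun of_bool f (p1 z) = p2 z \<longleftrightarrow>
        (p2 z = 0 \<and> \<not> D z) \<or> (p2 z = 1 \<and> D z \<and> \<not> V z) \<or> (p2 z = 2 \<and> V z)" for z
        unfolding string_fun_of_bool f_def V_def D_def by auto
      then show "hyper (\<lambda>z. string_fun of_bool f (p1 z) = p2 z)"
        by (simp only:) (intro hyp_intros D V rec_intros)
    qed
    moreover have "f [] = Some True" using ev root by (simp add: f_def)
    ultimately show "X \<in> HYP_interp (S n)"
      unfolding HYP_interp_def HYP_evaluation_map_def using X by blast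
  qed
qed

lemma HYP_evaluation_unique:
  assumes \<alpha>: "\<alpha> \<in> KO_star"
    and le: "\<And>\<sigma>. \<sigma> \<in> dom D \<Longrightarrow> rk D \<sigma> \<le>\<^sub>* \<alpha>"
    and less: "\<And>\<sigma> n. \<sigma> @ [n] \<in> dom D \<Longrightarrow> rk D (\<sigma> @ [n]) <\<^sub>* rk D \<sigma>"
    and D: "hyper (\<lambda>z. list_decode (p1 z) \<in> dom D \<and> rk D (list_decode (p1 z)) = p2 z)"
    and f: "HYP_evaluation_map X D f" and g: "HYP_evaluation_map X D g"
  shows "f = g"
proof (rule ccontr)
  have fe: "evaluation_map X D f" and ge: "evaluation_map X D g"
    and fh: "hyp_fun (string_fun of_bool f)" and gh: "hyp_fun (string_fun of_bool g)"
    using f g unfolding HYP_evaluation_map_def by blast+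
  have df: "dom f = dom D" and dg: "dom g = dom D"
    using fe ge unfolding evaluation_map_def by blast+
  \<comment> \<open>Disagreement is expressed through the graphs of the two maps, so
    \<open>B\<close> is hyperarithmetic and a minimal rank of disagreement is available.\<close>
  define B where "B b \<longleftrightarrow> (\<exists>s. (list_decode s \<in> dom D \<and> rk D (list_decode s) = b) \<and>
    (\<exists>y z. string_fun of_bool f s = y \<and> string_fun of_bool g s = z \<and> y \<noteq> z))" for b
  have B: "hyper B" unfolding B_def[abs_def]
    by (intro hyp_intros hyper_binary[OF D] hyper_binary[OF hyp_fun_hyper[OF fh]]
        hyper_binary[OF hyp_fun_hyper[OF gh]] rec_intros)
  have neq: "(\<exists>y z. string_fun of_bool f s = y \<and> string_fun of_bool g s = z \<and> y \<noteq> z) \<longleftrightarrow>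
      f (list_decode s) \<noteq> g (list_decode s)" for s
    by (auto simp: string_fun_def split: option.splits)
  have BD: "B b \<longleftrightarrow> (\<exists>\<sigma>\<in>dom D. rk D \<sigma> = b \<and> f \<sigma> \<noteq> g \<sigma>)" for b
    unfolding B_def neq by (metis list_encode_inverse)
  assume "f \<noteq> g"
  then obtain \<sigma> where "f \<sigma> \<noteq> g \<sigma>" by blast
  moreover from this have "\<sigma> \<in> dom D" using df dg by (metis domIff)
  ultimately obtain b where "B b" "b \<le>\<^sub>* \<alpha>" using BD le by blast
  then obtain b where "B b" and min: "\<And>d. d <\<^sub>* b \<Longrightarrow> \<not> B d"
    using KO_star_minimal[OF \<alpha> B] by blast
  then obtain \<sigma> where \<sigma>: "\<sigma> \<in> dom D" "rk D \<sigma> = b" "f \<sigma> \<noteq> g \<sigma>" using BD by blast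
  have children: "f (\<sigma> @ [n]) = g (\<sigma> @ [n])" if "\<sigma> @ [n] \<in> dom D" for n
    using min[OF less[OF that, unfolded \<sigma>(2)]] that BD by blast
  have clause: "h \<sigma> = Some True \<longleftrightarrow> (case lab D \<sigma> of Clopen c \<Rightarrow> X \<in> clopen_set c
      | Union \<Rightarrow> \<exists>n. \<sigma> @ [n] \<in> dom D \<and> h (\<sigma> @ [n]) = Some True
      | Inter \<Rightarrow> \<forall>n. \<sigma> @ [n] \<in> dom D \<longrightarrow> h (\<sigma> @ [n]) = Some True)"
    if "evaluation_map X D h" for h
    using that \<sigma>(1) unfolding evaluation_map_def by blast
  have "f \<sigma> = Some True \<longleftrightarrow> g \<sigma> = Some True"
    unfolding clause[OF fe] clause[OF ge] using children by (cases "lab D \<sigma>"; simp; metis)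
  moreover have "\<sigma> \<in> dom f" "\<sigma> \<in> dom g" using df dg \<sigma> by auto
  ultimately show False using \<sigma>(3) by (metis (full_types) domD)
qed

section \<open>Positions of a decorated code\<close>

text \<open>Every node of \<open>decorate P N T\<close> sits above a node of \<open>T\<close>, of some \<open>P n\<close> or of some
  \<open>neg_code (N n)\<close>; these three kinds of codes have the indices \<open>0\<close>, \<open>2 * n + 1\<close> and \<open>2 * n + 2\<close>.\<close>

locale decoration =
  fixes \<alpha> :: nat and P N :: "nat \<Rightarrow> code" and T :: code
  assumes \<alpha>: "\<alpha> \<in> KO_star"
    and P: "\<And>n. ranked_Borel_code \<alpha> (P n)" and N: "\<And>n. ranked_Borel_code \<alpha> (N n)"
    and T: "ranked_Borel_code \<alpha> T"
    and hP: "hyp_code_seq P" and hN: "hyp_code_seq N" and hT: "computable_code T"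
begin

text \<open>The codes before negation form a hyperarithmetic sequence; negation is left to the
  labels and to the truth value in \<open>evt\<close>.\<close>

definition base :: "nat \<Rightarrow> code" where
  "base i = (if i = 0 then T else if odd i then P (i div 2) else N (i div 2 - 1))"

definition negated :: "nat \<Rightarrow> bool" where
  "negated i \<longleftrightarrow> i \<noteq> 0 \<and> even i"

definition source :: "nat \<Rightarrow> code" where
  "source i = (if negated i then neg_code (base i) else base i)"

definition node_at :: "nat \<Rightarrow> (label \<times> nat) option" where
  "node_at q = source (p1 q) (list_decode (p2 q))"

text \<open>A position is the index of a code with a node of it, so unfolding
  \<open>decorate\<close> becomes a walk on numbers. An attached code is entered at its root, the
  string coded by \<open>0\<close>.\<close>

definition pstep :: "nat \<Rightarrow> nat \<Rightarrow> nat option" where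
  "pstep q m = (case node_at q of
      None \<Rightarrow> None
    | Some (Clopen c, r) \<Rightarrow> None
    | Some (l, r) \<Rightarrow>
        if even m then
          (if node_at (pr (p1 q) (csnoc (p2 q) (m div 2))) \<noteq> None
           then Some (pr (p1 q) (csnoc (p2 q) (m div 2))) else None)
        else if l = Union then
          (if rank (P (m div 2)) <\<^sub>* r then Some (pr (2 * (m div 2) + 1) 0) else None)
        else
          (if rank (N (m div 2)) <\<^sub>* r then Some (pr (2 * (m div 2) + 2) 0) else None))"

primrec walk :: "nat \<Rightarrow> nat list \<Rightarrow> nat option" where
  "walk q [] = Some q"
| "walk q (m # \<sigma>) = Option.bind (pstep q m) (\<lambda>q'. walk q' \<sigma>)"

abbreviation start :: nat where "start \<equiv> pr 0 0"

lemma source_simps [simp]: "source 0 = T" "source (2 * n + 1) = P n" "source (2 * n + 2) = neg_code (N n)"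
  by (simp_all add: source_def base_def negated_def)

lemma ranked_base: "ranked_Borel_code \<alpha> (base i)"
  by (simp add: base_def P N T)

lemma ranked_source: "ranked_Borel_code \<alpha> (source i)"
  by (simp add: source_def ranked_base ranked_neg_code)

lemma walk_snoc: "walk q (\<sigma> @ [m]) = Option.bind (walk q \<sigma>) (\<lambda>q'. pstep q' m)"
  by (induction \<sigma> arbitrary: q) (auto split: bind_split)

text \<open>Stated for the part of a code that starts at the node of \<open>q\<close>, because the
  recursion of \<open>decorate\<close> passes to subtrees.\<close>

lemma decorate_walk:
  "decorate P N (\<lambda>\<rho>. source (p1 q) (list_decode (p2 q) @ \<rho>)) \<sigma> = Option.bind (walk q \<sigma>) node_at"
proof (induction \<sigma> arbitrary: q)
  case Nil
  then show ?case by (simp add: node_at_def)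
next
  case (Cons m \<sigma>)
  have sub: "subtree (\<lambda>\<rho>. source (p1 q) (list_decode (p2 q) @ \<rho>)) k =
      (\<lambda>\<rho>. source (p1 (pr (p1 q) (csnoc (p2 q) k))) (list_decode (p2 (pr (p1 q) (csnoc (p2 q) k))) @ \<rho>))" for k
    by (simp add: subtree_def list_decode_csnoc)
  have dom: "[k] \<in> dom (\<lambda>\<rho>. source (p1 q) (list_decode (p2 q) @ \<rho>)) \<longleftrightarrow>
      node_at (pr (p1 q) (csnoc (p2 q) k)) \<noteq> None" for k
    by (simp add: node_at_def list_decode_csnoc dom_def)
  have PP: "P k = (\<lambda>\<rho>. source (p1 (pr (2 * k + 1) 0)) (list_decode (p2 (pr (2 * k + 1) 0)) @ \<rho>))" for k
    using source_simps(2)[of k] by simp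
  have NN: "neg_code (N k) = (\<lambda>\<rho>. source (p1 (pr (2 * k + 2) 0)) (list_decode (p2 (pr (2 * k + 2) 0)) @ \<rho>))" for k
    using source_simps(3)[of k] by simp
  have root: "source (p1 q) (list_decode (p2 q) @ []) = node_at q" by (simp add: node_at_def)
  show ?case
  proof (cases "node_at q")
    case None
    then show ?thesis using root by (simp add: pstep_def)
  next
    case (Some lr)
    obtain l r where lr: "lr = (l, r)" by fastforce
    note IHs = Cons[of "pr (p1 q) (csnoc (p2 q) (m div 2))"]
      Cons[of "pr (2 * (m div 2) + 1) 0", folded PP] Cons[of "pr (2 * (m div 2) + 2) 0", folded NN]
    show ?thesis using Some lr root IHs
      by (cases l) (simp_all add: pstep_def sub dom del: mult_Suc_right)
  qed
qed

lemma decorate_eq: "decorate P N T \<sigma> = Option.bind (walk start \<sigma>) node_at"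
  using decorate_walk[of start \<sigma>] by simp

lemma pstep_cases:
  assumes "pstep q m = Some q'"
  obtains l r where "node_at q = Some (l, r)" "l = Union \<or> l = Inter"
    "q' = pr (p1 q) (csnoc (p2 q) (m div 2))" "node_at q' \<noteq> None" "even m"
  | r where "node_at q = Some (Union, r)" "rank (P (m div 2)) <\<^sub>* r" "q' = pr (2 * (m div 2) + 1) 0" "odd m"
  | r where "node_at q = Some (Inter, r)" "rank (N (m div 2)) <\<^sub>* r" "q' = pr (2 * (m div 2) + 2) 0" "odd m"
proof (cases "node_at q")
  case None
  then show ?thesis using assms by (simp add: pstep_def)
next
  case (Some lr)
  obtain l r where lr: "lr = (l, r)" by fastforce
  show ?thesis using assms Some lr that
    by (cases l) (auto simp: pstep_def split: if_splits)
qed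

lemma pstep_iff:
  "pstep q m = Some q' \<longleftrightarrow> (\<exists>r. (node_at q = Some (Union, r) \<or> node_at q = Some (Inter, r)) \<and>
    ((even m \<and> q' = pr (p1 q) (csnoc (p2 q) (m div 2)) \<and> node_at q' \<noteq> None) \<or>
     (odd m \<and> node_at q = Some (Union, r) \<and> rank (P (m div 2)) <\<^sub>* r \<and> q' = pr (2 * (m div 2) + 1) 0) \<or>
     (odd m \<and> node_at q = Some (Inter, r) \<and> rank (N (m div 2)) <\<^sub>* r \<and> q' = pr (2 * (m div 2) + 2) 0)))"
proof
  assume "pstep q m = Some q'"
  then show "\<exists>r. (node_at q = Some (Union, r) \<or> node_at q = Some (Inter, r)) \<and>
    ((even m \<and> q' = pr (p1 q) (csnoc (p2 q) (m div 2)) \<and> node_at q' \<noteq> None) \<or>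
     (odd m \<and> node_at q = Some (Union, r) \<and> rank (P (m div 2)) <\<^sub>* r \<and> q' = pr (2 * (m div 2) + 1) 0) \<or>
     (odd m \<and> node_at q = Some (Inter, r) \<and> rank (N (m div 2)) <\<^sub>* r \<and> q' = pr (2 * (m div 2) + 2) 0))"
    by (rule pstep_cases) blast+
qed (auto simp: pstep_def)

lemma ranked_root:
  assumes "ranked_Borel_code \<alpha> S"
  shows "\<exists>l. S [] = Some (l, rank S)" and "rank S \<le>\<^sub>* \<alpha>"
  using assms unfolding ranked_Borel_code_def labeled_Borel_code_def by (auto simp: rk_def)

lemma node_at_P: "\<exists>l. node_at (pr (2 * n + 1) 0) = Some (l, rank (P n))"
  using ranked_root(1)[OF P, of n] source_simps(2)[of n] by (simp add: node_at_def)

lemma node_at_N: "\<exists>l. node_at (pr (2 * n + 2) 0) = Some (l, rank (N n))"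
  using ranked_root(1)[OF N, of n] source_simps(3)[of n] by (auto simp: node_at_def neg_code_Some)

lemma node_at_le: "node_at q = Some (l, r) \<Longrightarrow> r \<le>\<^sub>* \<alpha>"
  using ranked_source[of "p1 q"] unfolding ranked_Borel_code_def node_at_def by (force simp: rk_def)

text \<open>Only codes of smaller rank are attached, so the ranks of the underlying nodes also rank
  the decorated tree.\<close>

lemma pstep_less:
  assumes "pstep q m = Some q'" "node_at q = Some (l, r)"
  shows "\<exists>l' r'. node_at q' = Some (l', r') \<and> r' <\<^sub>* r"
  using assms(1)
proof (cases rule: pstep_cases)
  case (1 l' r')
  then obtain l'' r'' where q': "node_at q' = Some (l'', r'')" by auto
  have eq: "source (p1 q) (list_decode (p2 q) @ [m div 2]) = Some (l'', r'')"
    using q' 1(3) by (simp add: node_at_def list_decode_csnoc)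
  then have "rk (source (p1 q)) (list_decode (p2 q) @ [m div 2]) <\<^sub>* rk (source (p1 q)) (list_decode (p2 q))"
    using ranked_source[of "p1 q"] unfolding ranked_Borel_code_def by blast
  then show ?thesis using q' eq assms(2) by (simp add: rk_def node_at_def)
next
  case (2 r')
  then show ?thesis using node_at_P[of "m div 2"] assms(2) by auto
next
  case (3 r')
  then show ?thesis using node_at_N[of "m div 2"] assms(2) by auto
qed

lemma walk_node_at: "walk start \<sigma> = Some q \<Longrightarrow> \<exists>l r. node_at q = Some (l, r)"
proof (induction \<sigma> arbitrary: q rule: rev_induct)
  case Nil
  then show ?case using ranked_root(1)[OF T] by (auto simp: node_at_def)
next
  case (snoc m \<sigma>)
  then show ?case using pstep_less by (fastforce simp: walk_snoc bind_eq_Some_conv)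
qed

lemma decorate_Some: "walk start \<sigma> = Some q \<Longrightarrow> decorate P N T \<sigma> = node_at q"
  by (simp add: decorate_eq)

lemma dom_decorate: "\<sigma> \<in> dom (decorate P N T) \<longleftrightarrow> (\<exists>q. walk start \<sigma> = Some q)"
  using walk_node_at by (auto simp: decorate_eq bind_eq_Some_conv)

subsection \<open>Definability\<close>

lemma hyper_base: "recfn f \<Longrightarrow> recfn g \<Longrightarrow> recfn h \<Longrightarrow> hyper (\<lambda>x. code_fun (base (f x)) (g x) = h x)"
proof -
  have "hyp_fun (code_fun T)"
    using hT KO_one Hset_one unfolding computable_code_def hyp_fun_def by blast
  then have t: "hyper (\<lambda>z. code_fun T (p1 z) = p2 z)" by (rule hyp_fun_hyper)
  have eq: "code_fun (base i) s = y \<longleftrightarrow> (i = 0 \<and> code_fun T s = y) \<or> (odd i \<and> code_fun (P (i div 2)) s = y) \<or>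
    (i \<noteq> 0 \<and> even i \<and> code_fun (N (i div 2 - 1)) s = y)" for i s y
    by (auto simp: base_def)
  have "hyper (\<lambda>z. code_fun (base (p1 z)) (p1 (p2 z)) = p2 (p2 z))"
    unfolding eq by (intro hyp_intros hyper_code_fun[OF hP] hyper_code_fun[OF hN] hyper_binary[OF t] rec_intros)
  from hyper_ternary[OF this]
  show "recfn f \<Longrightarrow> recfn g \<Longrightarrow> recfn h \<Longrightarrow> hyper (\<lambda>x. code_fun (base (f x)) (g x) = h x)" .
qed

lemma hyp_code_seq_base: "hyp_code_seq base"
proof -
  have "hyper (\<lambda>z. code_fun (base (p1 (p1 z))) (p2 (p1 z)) = p2 z)" by (intro hyper_base rec_intros)
  then have "hyp_fun (\<lambda>x. code_fun (base (p1 x)) (p2 x))" by (rule hyper_hyp_fun)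
  then show ?thesis unfolding hyp_code_seq_def by (simp add: case_prod_beta)
qed

lemma hyper_negated: "recfn f \<Longrightarrow> hyper (\<lambda>x. negated (f x))"
  unfolding negated_def by (intro hyp_intros rec_intros)

lemma base_Some: "code_fun (base i) s = Suc (pr k r) \<longleftrightarrow>
    (\<exists>l. base i (list_decode s) = Some (l, r) \<and> k = label_encode l)"
  unfolding code_fun_eq by auto

lemma node_at_Union: "node_at q = Some (Union, r) \<longleftrightarrow>
    (if negated (p1 q) then code_fun (base (p1 q)) (p2 q) = Suc (pr 1 r)
     else code_fun (base (p1 q)) (p2 q) = Suc (pr 0 r))"
  unfolding base_Some node_at_def source_def
  by (auto simp: neg_code_Some label_encode_cases eq_commute[of 0] eq_commute[of "Suc 0"] label_encode_cases(2)[simplified])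

lemma node_at_Inter: "node_at q = Some (Inter, r) \<longleftrightarrow>
    (if negated (p1 q) then code_fun (base (p1 q)) (p2 q) = Suc (pr 0 r)
     else code_fun (base (p1 q)) (p2 q) = Suc (pr 1 r))"
  unfolding base_Some node_at_def source_def
  by (auto simp: neg_code_Some label_encode_cases eq_commute[of 0] eq_commute[of "Suc 0"] label_encode_cases(2)[simplified])

text \<open>Negation changes the label but not the rank, so this can be read off \<open>base\<close>
  directly.\<close>

definition rank_at :: "nat \<Rightarrow> nat \<Rightarrow> bool" where
  "rank_at q r \<longleftrightarrow> (\<exists>l. node_at q = Some (l, r))"

lemma rank_at_base: "rank_at q r \<longleftrightarrow> (\<exists>k. code_fun (base (p1 q)) (p2 q) = Suc (pr k r))"
  unfolding base_Some rank_at_def node_at_def source_def by (auto simp: neg_code_Some)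

lemma hyper_node_at [hyp_intros]:
  assumes "recfn f" "recfn g"
  shows "hyper (\<lambda>x. node_at (f x) = Some (Union, g x))" "hyper (\<lambda>x. node_at (f x) = Some (Inter, g x))"
    "hyper (\<lambda>x. rank_at (f x) (g x))"
proof -
  have "hyper (\<lambda>z. node_at (p1 z) = Some (Union, p2 z))" "hyper (\<lambda>z. node_at (p1 z) = Some (Inter, p2 z))"
    unfolding node_at_Union node_at_Inter if_bool_eq_conj
    by (intro hyp_intros hyper_base hyper_negated rec_intros)+
  from this[THEN hyper_binary, OF assms]
  show "hyper (\<lambda>x. node_at (f x) = Some (Union, g x))" "hyper (\<lambda>x. node_at (f x) = Some (Inter, g x))" .
  have "hyper (\<lambda>z. rank_at (p1 z) (p2 z))"
    unfolding rank_at_base by (intro hyp_intros hyper_base rec_intros)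
  from hyper_binary[OF this assms] show "hyper (\<lambda>x. rank_at (f x) (g x))" .
qed

lemma node_at_None: "node_at q \<noteq> None \<longleftrightarrow> (\<exists>r. rank_at q r)"
  unfolding rank_at_def by auto

lemma rank_at_P: "rank_at (pr (2 * n + 1) 0) r \<longleftrightarrow> rank (P n) = r"
  using node_at_P[of n] by (auto simp: rank_at_def)

lemma rank_at_N: "rank_at (pr (2 * n + 2) 0) r \<longleftrightarrow> rank (N n) = r"
  using node_at_N[of n] by (auto simp: rank_at_def)

lemma hyper_pstep [hyp_intros]:
  assumes "recfn f" "recfn g" "recfn h"
  shows "hyper (\<lambda>x. pstep (f x) (g x) = Some (h x))"
proof -
  have less: "rank (P n) <\<^sub>* r \<longleftrightarrow> (\<exists>r'. rank_at (pr (2 * n + 1) 0) r' \<and> r' <\<^sub>* r)"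
    "rank (N n) <\<^sub>* r \<longleftrightarrow> (\<exists>r'. rank_at (pr (2 * n + 2) 0) r' \<and> r' <\<^sub>* r)" for n r
    unfolding rank_at_P rank_at_N by auto
  have "hyper (\<lambda>z. pstep (p1 z) (p1 (p2 z)) = Some (p2 (p2 z)))"
    unfolding pstep_iff node_at_None less by (intro hyp_intros rec_intros)
  from hyper_ternary[where P = "\<lambda>q m q'. pstep q m = Some q'", OF this assms] show ?thesis .
qed

text \<open>\<open>R\<close> consumes the first entry of the path and moves the position; a walk is
  then reachability under a hyperarithmetic relation.\<close>

lemma hyper_walk [hyp_intros]:
  assumes "recfn f" "recfn g" "recfn h"
  shows "hyper (\<lambda>x. walk (f x) (list_decode (g x)) = Some (h x))"
proof -
  define R where "R w w' \<longleftrightarrow> p1 w \<noteq> 0 \<and> p1 w' = ctl (p1 w) \<and> pstep (p2 w) (chd (p1 w)) = Some (p2 w')" for w w'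
  have R: "hyper (\<lambda>z. R (p1 z) (p2 z))" unfolding R_def by (intro hyp_intros rec_intros)
  have Rc: "R (pr (list_encode (m # \<sigma>)) q) w \<longleftrightarrow> (\<exists>q'. w = pr (list_encode \<sigma>) q' \<and> pstep q m = Some q')" for m \<sigma> q w
    unfolding R_def ccons_list_encode[symmetric]
    by (auto intro!: exI[of _ "p2 w"] simp del: list_encode.simps) (metis prod.collapse prod_decode_inverse)
  have R0: "\<not> R (pr 0 q) w" for q w by (simp add: R_def)
  have "walk q \<sigma> = Some q' \<longleftrightarrow> R\<^sup>*\<^sup>* (pr (list_encode \<sigma>) q) (pr 0 q')" for q \<sigma> q'
  proof (induction \<sigma> arbitrary: q)
    case Nil
    have "R\<^sup>*\<^sup>* (pr 0 q) w \<longleftrightarrow> w = pr 0 q" for w using R0 by (auto elim: converse_rtranclpE)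
    then show ?case by auto
  next
    case (Cons m \<sigma>)
    have "R\<^sup>*\<^sup>* (pr (list_encode (m # \<sigma>)) q) (pr 0 q') \<longleftrightarrow>
        (\<exists>w. R (pr (list_encode (m # \<sigma>)) q) w \<and> R\<^sup>*\<^sup>* w (pr 0 q'))"
      by (auto elim: converse_rtranclpE intro: converse_rtranclp_into_rtranclp)
    then show ?case unfolding Rc using Cons by (auto simp: bind_eq_Some_conv)
  qed
  from this[of _ "list_decode _"]
  have "walk q (list_decode s) = Some q' \<longleftrightarrow> R\<^sup>*\<^sup>* (pr s q) (pr 0 q')" for q s q' by simp
  then show ?thesis by (simp only:) (intro hyp_intros R rec_intros assms)
qed

lemma hyper_rank_decorate:
  "hyper (\<lambda>z. list_decode (p1 z) \<in> dom (decorate P N T) \<and> rk (decorate P N T) (list_decode (p1 z)) = p2 z)"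
proof -
  have "(\<sigma> \<in> dom (decorate P N T) \<and> rk (decorate P N T) \<sigma> = r) \<longleftrightarrow>
      (\<exists>q. walk start \<sigma> = Some q \<and> rank_at q r)" for \<sigma> r
    unfolding dom_decorate rank_at_def using walk_node_at by (fastforce simp: rk_def decorate_Some)
  then show ?thesis by (simp only:) (intro hyp_intros rec_intros)
qed

lemma decorate_evaluation_unique:
  assumes "HYP_evaluation_map X (decorate P N T) f" "HYP_evaluation_map X (decorate P N T) g"
  shows "f = g"
proof (rule HYP_evaluation_unique[OF \<alpha> _ _ hyper_rank_decorate assms])
  fix \<sigma> assume "\<sigma> \<in> dom (decorate P N T)"
  then obtain q where "walk start \<sigma> = Some q" unfolding dom_decorate by blast
  moreover from walk_node_at[OF this] obtain l r where "node_at q = Some (l, r)" by blast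
  ultimately show "rk (decorate P N T) \<sigma> \<le>\<^sub>* \<alpha>" using node_at_le by (simp add: rk_def decorate_Some)
next
  fix \<sigma> n assume "\<sigma> @ [n] \<in> dom (decorate P N T)"
  then obtain q q' where q: "walk start \<sigma> = Some q" "walk start (\<sigma> @ [n]) = Some q'" "pstep q n = Some q'"
    unfolding dom_decorate by (auto simp: walk_snoc bind_eq_Some_conv)
  moreover from walk_node_at[OF q(1)] obtain l r where "node_at q = Some (l, r)" by blast
  ultimately show "rk (decorate P N T) (\<sigma> @ [n]) <\<^sub>* rk (decorate P N T) \<sigma>"
    using pstep_less[of q n q' l r] by (auto simp: rk_def decorate_Some)
qed

end

section \<open>The evaluation map of a decorated code\<close>

text \<open>The point \<open>X\<close> is decided by a code of rank \<open>\<gamma>\<close> in \<open>P\<close> (if \<open>s\<close>) or in \<open>N\<close>.  Codes attached below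
  rank \<open>\<gamma>\<close> are then neutral, and above \<open>\<gamma>\<close> every node whose label matches \<open>s\<close> has value \<open>s\<close>, since
  the deciding code is attached to it.\<close>

locale decided_point = decoration +
  fixes X :: "nat set" and \<gamma> :: nat and s :: bool
  assumes X: "X \<in> HYP" and \<gamma>: "\<gamma> \<in> KO" "\<gamma> \<le>\<^sub>* \<alpha>"
    and low_P: "\<And>n. rank (P n) <\<^sub>* \<gamma> \<Longrightarrow> \<not> evt X (P n) True []"
    and low_N: "\<And>n. rank (N n) <\<^sub>* \<gamma> \<Longrightarrow> \<not> evt X (N n) True []"
    and decided: "if s then \<exists>n. rank (P n) = \<gamma> \<and> evt X (P n) True []
      else \<exists>n. rank (N n) = \<gamma> \<and> evt X (N n) True []"
begin

definition val :: "nat \<Rightarrow> bool \<Rightarrow> bool" where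
  "val q b \<longleftrightarrow> evt X (source (p1 q)) b (list_decode (p2 q))"

text \<open>The positions whose value is left to derivability, which is two-valued for ranks in
  \<open>KO\<close> and at leaves.\<close>

definition bottom :: "nat \<Rightarrow> bool" where
  "bottom q \<longleftrightarrow> (\<exists>l r. node_at q = Some (l, r) \<and> (r \<le>\<^sub>* \<gamma> \<or> l \<in> range Clopen))"

text \<open>The deciding code is not attached at these labels; such a node has value
  \<open>\<not> s\<close> as soon as one child has.\<close>

definition pass :: "nat \<Rightarrow> bool" where
  "pass q \<longleftrightarrow> (\<exists>r. \<gamma> <\<^sub>* r \<and> node_at q = Some (if s then Inter else Union, r))"

definition edge :: "nat \<Rightarrow> nat \<Rightarrow> bool" where
  "edge q q' \<longleftrightarrow> pass q \<and> (\<exists>m. pstep q m = Some q')"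

definition bad :: "nat \<Rightarrow> bool" where
  "bad q \<longleftrightarrow> bottom q \<and> val q (\<not> s)"

text \<open>The default is \<open>s\<close>, refuted only by a path through pass positions to a
  bottom position of value \<open>\<not> s\<close>. An endless path of pass positions leaves it in
  force, which settles the ill-founded part.\<close>

definition V :: "nat \<Rightarrow> bool" where
  "V q \<longleftrightarrow> (s \<longleftrightarrow> \<not> (\<exists>q'. edge\<^sup>*\<^sup>* q q' \<and> bad q'))"

lemma \<gamma>_less: "\<gamma> <\<^sub>* r \<Longrightarrow> \<not> r \<le>\<^sub>* \<gamma>"
  using less_le_star_trans KO_less_irrefl[OF \<gamma>(1)] by blast

lemma high: "node_at q = Some (l, r) \<Longrightarrow> \<not> r \<le>\<^sub>* \<gamma> \<Longrightarrow> \<gamma> <\<^sub>* r"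
  using KO_star_linear[OF \<alpha> node_at_le \<gamma>(2)] by blast

lemma bottom_determined:
  assumes "bottom q"
  shows "val q False \<longleftrightarrow> \<not> val q True"
proof -
  obtain l r where lr: "source (p1 q) (list_decode (p2 q)) = Some (l, r)" "r \<le>\<^sub>* \<gamma> \<or> l \<in> range Clopen"
    using assms unfolding bottom_def node_at_def by blast
  from lr(2) show ?thesis
  proof
    assume "r \<le>\<^sub>* \<gamma>"
    then show ?thesis
      unfolding val_def using evt_determined[OF ranked_source lr(1)] KO_le \<gamma>(1) by blast
  next
    assume "l \<in> range Clopen"
    then show ?thesis
      unfolding val_def evt_unfold[of "source (p1 q)" "list_decode (p2 q)" l r, OF lr(1)] by auto
  qed
qed

lemma bad_iff: "bad q \<longleftrightarrow> bottom q \<and> (val q True \<longleftrightarrow> \<not> s)"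
  unfolding bad_def using bottom_determined by (cases s) auto

lemma edge_not_pass: "\<not> pass q \<Longrightarrow> edge\<^sup>*\<^sup>* q q' \<longleftrightarrow> q' = q"
  by (auto simp: edge_def elim: converse_rtranclpE)

lemma bottom_not_pass: "bottom q \<Longrightarrow> \<not> pass q"
  unfolding bottom_def pass_def using \<gamma>_less by auto

lemma V_bottom: "bottom q \<Longrightarrow> V q \<longleftrightarrow> val q True"
  unfolding V_def using edge_not_pass[OF bottom_not_pass] bad_iff by auto

lemma V_match:
  assumes "node_at q = Some (if s then Union else Inter, r)" "\<gamma> <\<^sub>* r"
  shows "V q = s"
proof -
  have "\<not> pass q" "\<not> bottom q"
    using assms \<gamma>_less[OF assms(2)] unfolding pass_def bottom_def by (auto split: if_splits)
  then show ?thesis unfolding V_def using edge_not_pass bad_def by auto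
qed

lemma V_pass:
  assumes "pass q"
  shows "V q = s \<longleftrightarrow> (\<forall>m q'. pstep q m = Some q' \<longrightarrow> V q' = s)"
proof -
  have not_bad: "\<not> bad q" using bottom_not_pass assms bad_def by blast
  have unfold: "edge\<^sup>*\<^sup>* q q' \<longleftrightarrow> q' = q \<or> (\<exists>m q1. pstep q m = Some q1 \<and> edge\<^sup>*\<^sup>* q1 q')" for q'
  proof
    show "edge\<^sup>*\<^sup>* q q' \<Longrightarrow> q' = q \<or> (\<exists>m q1. pstep q m = Some q1 \<and> edge\<^sup>*\<^sup>* q1 q')"
      by (erule converse_rtranclpE) (auto simp: edge_def)
    have "edge q q1" if "pstep q m = Some q1" for m q1 using assms that unfolding edge_def by blast
    then show "q' = q \<or> (\<exists>m q1. pstep q m = Some q1 \<and> edge\<^sup>*\<^sup>* q1 q') \<Longrightarrow> edge\<^sup>*\<^sup>* q q'"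
      using converse_rtranclp_into_rtranclp[of edge q] by blast
  qed
  have "(\<exists>q'. edge\<^sup>*\<^sup>* q q' \<and> bad q') \<longleftrightarrow>
      (\<exists>m q1. pstep q m = Some q1 \<and> (\<exists>q'. edge\<^sup>*\<^sup>* q1 q' \<and> bad q'))"
    unfolding unfold using not_bad by blast
  then show ?thesis unfolding V_def by blast
qed

lemma val_P: "val (pr (2 * n + 1) 0) b \<longleftrightarrow> evt X (P n) b []"
  using source_simps(2)[of n] by (simp add: val_def)

lemma val_N: "val (pr (2 * n + 2) 0) b \<longleftrightarrow> evt X (N n) (\<not> b) []"
  using source_simps(3)[of n] by (simp add: val_def evt_neg_code)

lemma bottom_P: "rank (P n) \<le>\<^sub>* \<gamma> \<Longrightarrow> bottom (pr (2 * n + 1) 0)"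
  using node_at_P[of n] unfolding bottom_def by blast

lemma bottom_N: "rank (N n) \<le>\<^sub>* \<gamma> \<Longrightarrow> bottom (pr (2 * n + 2) 0)"
  using node_at_N[of n] unfolding bottom_def by blast

lemma val_N_True:
  assumes "rank (N n) \<le>\<^sub>* \<gamma>"
  shows "val (pr (2 * n + 2) 0) True \<longleftrightarrow> \<not> evt X (N n) True []"
  using bottom_determined[OF bottom_N[OF assms]] unfolding val_N by auto

text \<open>Codes attached here have rank below \<gamma>. Those from \<open>P\<close> are false and
  hang under unions, the negations from \<open>N\<close> are true and hang under intersections, so
  no value changes.\<close>

lemma V_low:
  assumes q: "node_at q = Some (l, r)" and r: "r \<le>\<^sub>* \<gamma>" and l: "l = Union \<or> l = Inter"
  shows "V q \<longleftrightarrow> (if l = Union then \<exists>m q'. pstep q m = Some q' \<and> V q' else \<forall>m q'. pstep q m = Some q' \<longrightarrow> V q')"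
proof -
  let ?c = "\<lambda>m. pr (p1 q) (csnoc (p2 q) m)"
  have child: "V q' \<longleftrightarrow> val q' True" if st: "pstep q m = Some q'" for m q'
  proof -
    obtain l' r' where "node_at q' = Some (l', r')" "r' <\<^sub>* r" using pstep_less[OF st q] by blast
    moreover from this have "r' <\<^sub>* \<gamma>" using less_le_star_trans[OF _ r] by blast
    ultimately have "bottom q'" unfolding bottom_def le_star_def by blast
    then show ?thesis by (rule V_bottom)
  qed
  have even: "pstep q (2 * m) = Some (?c m) \<longleftrightarrow> node_at (?c m) \<noteq> None" for m
    unfolding pstep_iff using q l by auto
  have dom: "node_at (?c m) \<noteq> None \<longleftrightarrow> list_decode (p2 q) @ [m] \<in> dom (source (p1 q))"
    and valc: "val (?c m) b \<longleftrightarrow> evt X (source (p1 q)) b (list_decode (p2 q) @ [m])" for m b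
    by (auto simp: node_at_def val_def list_decode_csnoc)
  have "V q \<longleftrightarrow> val q True" using q r by (intro V_bottom) (auto simp: bottom_def)
  also have "\<dots> \<longleftrightarrow> (if l = Union then \<exists>m. pstep q (2 * m) = Some (?c m) \<and> val (?c m) True
      else \<forall>m. pstep q (2 * m) = Some (?c m) \<longrightarrow> val (?c m) True)"
    unfolding even dom valc val_def
      evt_unfold[of "source (p1 q)" "list_decode (p2 q)" l r, OF q[unfolded node_at_def]]
    using l by (elim disjE) (simp_all add: list_decode_csnoc)
  also have "\<dots> \<longleftrightarrow> (if l = Union then \<exists>m q'. pstep q m = Some q' \<and> val q' True
      else \<forall>m q'. pstep q m = Some q' \<longrightarrow> val q' True)"
  proof -
    have "(\<exists>k. pstep q (2 * k) = Some (?c k) \<and> q' = ?c k) \<or> (l = Union \<and> \<not> val q' True) \<or> (l = Inter \<and> val q' True)"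
      if "pstep q m = Some q'" for m q'
      using that
    proof (cases rule: pstep_cases)
      case (1 l' r')
      then show ?thesis using that by (metis even_two_times_div_two)
    next
      case (2 r')
      then have "rank (P (m div 2)) <\<^sub>* \<gamma>" using q r less_le_star_trans by auto
      then have "\<not> val q' True" unfolding 2(3) val_P by (rule low_P)
      then show ?thesis using 2(1) q by simp
    next
      case (3 r')
      then have "rank (N (m div 2)) <\<^sub>* \<gamma>" using q r less_le_star_trans by auto
      then show ?thesis using low_N val_N_True[of "m div 2"] 3 q by (auto simp: le_star_def)
    qed
    note st = this
    show ?thesis
    proof (cases "l = Union")
      case True
      have "\<exists>k. pstep q (2 * k) = Some (?c k) \<and> q' = ?c k" if "pstep q m = Some q'" "val q' True" for m q'
        using st[OF that(1)] that(2) True by simp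
      then show ?thesis unfolding if_P[OF True] by blast
    next
      case False
      have "\<exists>k. pstep q (2 * k) = Some (?c k) \<and> q' = ?c k" if "pstep q m = Some q'" "\<not> val q' True" for m q'
        using st[OF that(1)] that(2) False by simp
      then show ?thesis unfolding if_not_P[OF False] by blast
    qed
  qed
  finally show ?thesis using child by (auto split: if_splits)
qed

lemma V_clause:
  assumes q: "node_at q = Some (l, r)"
  shows "V q \<longleftrightarrow> (case l of Clopen c \<Rightarrow> X \<in> clopen_set c
    | Union \<Rightarrow> \<exists>m q'. pstep q m = Some q' \<and> V q'
    | Inter \<Rightarrow> \<forall>m q'. pstep q m = Some q' \<longrightarrow> V q')"
proof -
  consider c where "l = Clopen c" | "l = Union \<or> l = Inter" "r \<le>\<^sub>* \<gamma>"
    | "l = (if s then Union else Inter)" "\<gamma> <\<^sub>* r" | "l = (if s then Inter else Union)" "\<gamma> <\<^sub>* r"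
    using high[OF q] by (cases l; cases s) auto
  then show ?thesis
  proof cases
    case (1 c)
    then have "bottom q" unfolding bottom_def using q by blast
    then show ?thesis using 1
      evt_unfold[of "source (p1 q)" "list_decode (p2 q)" l r, OF q[unfolded node_at_def]]
      by (simp add: V_bottom val_def)
  next
    case 2
    then show ?thesis using V_low[OF q 2(2,1)] by auto
  next
    case 3
    have Vq: "V q = s" using V_match q 3 by simp
    show ?thesis
    proof (cases s)
      case True
      then obtain n where n: "rank (P n) = \<gamma>" "evt X (P n) True []" using decided by auto
      \<comment> \<open>The deciding code hangs here as child \<open>2 * n + 1\<close>; its rank is
        \<gamma>, so its root is a bottom position.\<close>
      have "pstep q (2 * n + 1) = Some (pr (2 * n + 1) 0)" unfolding pstep_iff using q 3 True n by auto
      moreover have "V (pr (2 * n + 1) 0)"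
        using V_bottom[OF bottom_P] val_P n by (simp add: le_star_def)
      ultimately show ?thesis using Vq True 3 by auto
    next
      case False
      then obtain n where n: "rank (N n) = \<gamma>" "evt X (N n) True []" using decided by auto
      have "pstep q (2 * n + 1) = Some (pr (2 * n + 2) 0)" unfolding pstep_iff using q 3 False n by auto
      moreover have "\<not> V (pr (2 * n + 2) 0)"
        using V_bottom[OF bottom_N, of n] val_N_True[of n] n by (simp add: le_star_def)
      ultimately show ?thesis using Vq False 3 by auto
    qed
  next
    case 4
    then have "pass q" unfolding pass_def using q by blast
    from V_pass[OF this] show ?thesis using 4 by (cases s) auto
  qed
qed

lemma hyper_V [hyp_intros]:
  assumes "recfn f"
  shows "hyper (\<lambda>x. V (f x))"
proof -
  have val: "val q b \<longleftrightarrow> (negated (p1 q) \<and> evt X (base (p1 q)) (\<not> b) (list_decode (p2 q))) \<or>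
      (\<not> negated (p1 q) \<and> evt X (base (p1 q)) b (list_decode (p2 q)))" for q b
    unfolding val_def source_def by (auto simp: evt_neg_code)
  have pos_val: "posop (\<lambda>Q q. val q b)" for b
    unfolding val by (intro pos_intros posop_hyper[OF hyper_negated] posop_hyper[OF hyper_not[OF hyper_negated]]
      pi11_evt_HYP[OF hyp_code_seq_base X, unfolded pi11_def] rec_intros)
  have bottom_eq: "bottom q \<longleftrightarrow> (\<exists>r. rank_at q r \<and> (r \<le>\<^sub>* \<gamma> \<or>
      \<not> (node_at q = Some (Union, r) \<or> node_at q = Some (Inter, r))))" for q
  proof -
    have "l \<in> range Clopen \<longleftrightarrow> \<not> (l = Union \<or> l = Inter)" for l by (cases l) auto
    then show ?thesis unfolding bottom_def rank_at_def by auto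
  qed
  have bottom: "hyper bottom" unfolding bottom_eq[abs_def] by (intro hyp_intros rec_intros)
  \<comment> \<open>On bottom positions the two values are complementary, so the complement of
    \<open>bad\<close> is Pi-1-1 as well.\<close>
  have "\<not> bad q \<longleftrightarrow> \<not> bottom q \<or> val q s" for q
    unfolding bad_iff using bottom_determined by (cases s) auto
  then have bad: "hyper bad"
    unfolding hyper_def pi11_def bad_def[abs_def]
    by (simp only:) (intro conjI pos_intros posop_hyper[OF bottom] posop_hyper[OF hyper_not[OF bottom]] pos_val)
  have pass_eq: "pass q \<longleftrightarrow> (\<exists>r. \<gamma> <\<^sub>* r \<and> ((s \<and> node_at q = Some (Inter, r)) \<or> (\<not> s \<and> node_at q = Some (Union, r))))" for q
    unfolding pass_def by auto
  have pass: "hyper pass" unfolding pass_eq[abs_def] by (intro hyp_intros rec_intros)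
  have "hyper (\<lambda>z. edge (p1 z) (p2 z))"
    unfolding edge_def by (intro hyp_intros hyper_comp[OF pass] rec_intros)
  then have "hyper V"
    unfolding V_def[abs_def] by (intro hyp_intros hyper_comp[OF bad] rec_intros)
  from hyper_comp[OF this assms] show ?thesis .
qed

definition evaluation :: "nat list \<rightharpoonup> bool" where
  "evaluation \<sigma> = map_option V (walk start \<sigma>)"

lemma HYP_evaluation: "HYP_evaluation_map X (decorate P N T) evaluation"
  unfolding HYP_evaluation_map_def evaluation_map_def
proof (intro conjI ballI)
  show "dom evaluation = dom (decorate P N T)"
    unfolding set_eq_iff dom_decorate by (auto simp: evaluation_def)
next
  fix \<sigma> assume "\<sigma> \<in> dom (decorate P N T)"
  then obtain q where q: "walk start \<sigma> = Some q" unfolding dom_decorate by blast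
  then obtain l r where lr: "node_at q = Some (l, r)" using walk_node_at by blast
  have lab: "lab (decorate P N T) \<sigma> = l" using decorate_Some[OF q] lr by (simp add: lab_def)
  have dom: "\<sigma> @ [n] \<in> dom (decorate P N T) \<longleftrightarrow> (\<exists>q'. pstep q n = Some q')"
    and ev: "evaluation (\<sigma> @ [n]) = map_option V (pstep q n)" for n
    unfolding dom_decorate using q by (simp_all add: walk_snoc evaluation_def)
  have "evaluation \<sigma> = Some (V q)" using q by (simp add: evaluation_def)
  then show "(evaluation \<sigma> = Some True) = (case lab (decorate P N T) \<sigma> of
      Union \<Rightarrow> \<exists>n. \<sigma> @ [n] \<in> dom (decorate P N T) \<and> evaluation (\<sigma> @ [n]) = Some True
    | Inter \<Rightarrow> \<forall>n. \<sigma> @ [n] \<in> dom (decorate P N T) \<longrightarrow> evaluation (\<sigma> @ [n]) = Some True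
    | Clopen c \<Rightarrow> X \<in> clopen_set c)"
    unfolding lab dom ev using V_clause[OF lr] by (cases l) auto
next
  show "hyp_fun (string_fun of_bool evaluation)"
  proof (rule hyper_hyp_fun)
    have "string_fun of_bool evaluation s' = y \<longleftrightarrow>
      (y = 0 \<and> \<not> (\<exists>q. walk start (list_decode s') = Some q)) \<or>
      (y = 1 \<and> (\<exists>q. walk start (list_decode s') = Some q \<and> \<not> V q)) \<or>
      (y = 2 \<and> (\<exists>q. walk start (list_decode s') = Some q \<and> V q))" for s' y
      unfolding string_fun_of_bool evaluation_def by auto
    then show "hyper (\<lambda>z. string_fun of_bool evaluation (p1 z) = p2 z)"
      by (simp only:) (intro hyp_intros rec_intros)
  qed
qed

text \<open>Uniqueness reduces the existence of a map with root value \<open>True\<close> to the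
  root value of this one.\<close>

lemma HYP_interp_decorate: "X \<in> HYP_interp (decorate P N T) \<longleftrightarrow> V start"
proof -
  have root: "evaluation [] = Some (V start)" by (simp add: evaluation_def)
  have "f = evaluation" if "HYP_evaluation_map X (decorate P N T) f" for f
    using decorate_evaluation_unique[OF that HYP_evaluation] .
  then have "HYP_evaluation_map X (decorate P N T) f \<longleftrightarrow> f = evaluation" for f
    using HYP_evaluation by blast
  then show ?thesis unfolding HYP_interp_def using X root by simp
qed

end

text \<open>\<open>pr 0 0\<close> codes the empty clopen set. A childless node cannot be labeled
  \<open>Union\<close>, hence the leaf; being empty, it adds nothing to the union.\<close>

definition seed_code :: "nat \<Rightarrow> code" where
  "seed_code \<delta> = [[] \<mapsto> (Union, \<delta>), [0] \<mapsto> (Clopen (pr 0 0), 1)]"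

lemma seed_code_simps: "seed_code \<delta> [] = Some (Union, \<delta>)" "seed_code \<delta> [0] = Some (Clopen (pr 0 0), 1)"
    "dom (seed_code \<delta>) = {[], [0]}"
  by (auto simp: seed_code_def)

lemma ranked_seed_code:
  assumes "\<alpha> \<in> KO_star" "\<delta> \<le>\<^sub>* \<alpha>" "\<delta> \<notin> KO"
  shows "ranked_Borel_code \<alpha> (seed_code \<delta>)"
proof -
  have \<delta>: "\<delta> \<in> KO_star" using KO_star_le assms by blast
  have "1 \<noteq> \<delta>" using assms(3) KO_one by blast
  then have "1 <\<^sub>* \<delta>" using one_le_star[OF \<delta>] unfolding le_star_def by blast
  moreover have "1 \<in> KO_star" using KO_one KO_subset_KO_star by blast
  moreover have "rk (seed_code \<delta>) [] = \<delta>" "rk (seed_code \<delta>) [0] = 1"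
      "lab (seed_code \<delta>) [] = Union" "lab (seed_code \<delta>) [0] = Clopen (pr 0 0)"
    by (simp_all add: rk_def lab_def seed_code_simps)
  ultimately show ?thesis using assms \<delta> one_le_star[OF assms(1)]
    unfolding ranked_Borel_code_def labeled_Borel_code_def seed_code_simps by auto
qed

lemma computable_seed_code: "computable_code (seed_code \<delta>)"
proof -
  have dec: "list_decode s = \<sigma> \<longleftrightarrow> s = list_encode \<sigma>" for s \<sigma> by auto
  have eq: "code_fun (seed_code \<delta>) s = (if s = list_encode [] then Suc (pr 0 \<delta>)
      else if s = list_encode [0] then Suc (pr (pr 0 0 + 2) 1) else 0)" for s
    unfolding code_fun_def string_fun_def seed_code_def dec[symmetric] by auto
  have "recfn (code_fun (seed_code \<delta>))" unfolding eq[abs_def] by (intro rec_intros)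
  then show ?thesis
    unfolding computable_code_def computable_from_def recfn_def oracle_phi_def by blast
qed

text \<open>For \<open>b\<close> in \<^const>\<open>KO\<close> this contradicts the uniqueness assumption, so it overspills.\<close>

lemma pi11_clash:
  assumes "hyp_code_seq P" "hyp_code_seq N"
  shows "\<exists>Q. pi11 Q \<and> (\<forall>b. Q b \<longleftrightarrow> (\<exists>X\<in>HYP. \<exists>n k r. P n [] \<noteq> None \<and> rank (P n) = b \<and>
    N k [] \<noteq> None \<and> rank (N k) = r \<and> r \<in> KO \<and> r \<noteq> b \<and> evt X (P n) True [] \<and> evt X (N k) True []))"
proof -
  obtain E where E: "pi11 E" "\<And>a c X n b \<tau>. index_of a c X \<Longrightarrow>
    E (evq a c n (of_bool b) (list_encode \<tau>)) \<longleftrightarrow> evt X (P n) b \<tau>" using pi11_evt[OF assms(1)] by blast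
  obtain F where F: "pi11 F" "\<And>a c X n b \<tau>. index_of a c X \<Longrightarrow>
    F (evq a c n (of_bool b) (list_encode \<tau>)) \<longleftrightarrow> evt X (N n) b \<tau>" using pi11_evt[OF assms(2)] by blast
  define Q where "Q b \<longleftrightarrow> (\<exists>a c n k r. a \<in> KO \<and> (\<forall>x. orc (rq 1 a c x 0) \<or> orc (rq 1 a c x 1)) \<and>
    (\<exists>l. code_fun (P n) 0 = Suc (pr l b)) \<and> (\<exists>l. code_fun (N k) 0 = Suc (pr l r)) \<and> r \<in> KO \<and> r \<noteq> b \<and>
    E (evq a c n 1 0) \<and> F (evq a c k 1 0))" for b
  have "pi11 Q" unfolding Q_def[abs_def] pi11_def
    by (intro pos_intros posop_hyper[OF hyper_code_fun[OF assms(1)]] posop_hyper[OF hyper_code_fun[OF assms(2)]]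
        posop_comp[OF E(1)[unfolded pi11_def]] posop_comp[OF F(1)[unfolded pi11_def]] rec_intros)
  moreover have root: "(\<exists>l. code_fun S 0 = Suc (pr l r)) \<longleftrightarrow> S [] \<noteq> None \<and> rank S = r" for S r
    unfolding code_fun_eq by (auto simp: rk_def)
  have "Q b \<longleftrightarrow> (\<exists>X\<in>HYP. \<exists>n k r. P n [] \<noteq> None \<and> rank (P n) = b \<and>
    N k [] \<noteq> None \<and> rank (N k) = r \<and> r \<in> KO \<and> r \<noteq> b \<and> evt X (P n) True [] \<and> evt X (N k) True [])" for b
  proof
    assume "Q b"
    then obtain a c n k r where *: "a \<in> KO" "\<And>x. orc (rq 1 a c x 0) \<or> orc (rq 1 a c x 1)"
      "P n [] \<noteq> None \<and> rank (P n) = b" "N k [] \<noteq> None \<and> rank (N k) = r" "r \<in> KO" "r \<noteq> b"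
      "E (evq a c n 1 0)" "F (evq a c k 1 0)" unfolding Q_def root by blast
    obtain X where ix: "index_of a c X" using index_ofI[OF *(1,2)] by blast
    have "evt X (P n) True []" "evt X (N k) True []"
      using *(7,8) E(2)[OF ix, of n True "[]"] F(2)[OF ix, of k True "[]"] by simp_all
    moreover have "X \<in> HYP" using ix HYP_index by blast
    ultimately show "\<exists>X\<in>HYP. \<exists>n k r. P n [] \<noteq> None \<and> rank (P n) = b \<and>
      N k [] \<noteq> None \<and> rank (N k) = r \<and> r \<in> KO \<and> r \<noteq> b \<and> evt X (P n) True [] \<and> evt X (N k) True []"
      using * by blast
  next
    assume "\<exists>X\<in>HYP. \<exists>n k r. P n [] \<noteq> None \<and> rank (P n) = b \<and>
      N k [] \<noteq> None \<and> rank (N k) = r \<and> r \<in> KO \<and> r \<noteq> b \<and> evt X (P n) True [] \<and> evt X (N k) True []"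
    then obtain X n k r where X: "X \<in> HYP" and *: "P n [] \<noteq> None \<and> rank (P n) = b"
      "N k [] \<noteq> None \<and> rank (N k) = r" "r \<in> KO" "r \<noteq> b" "evt X (P n) True []" "evt X (N k) True []" by blast
    obtain a c where ix: "index_of a c X" using X HYP_index by blast
    have "a \<in> KO" using ix unfolding index_of_def by blast
    moreover have "orc (rq 1 a c x 0) \<or> orc (rq 1 a c x 1)" for x
      unfolding index_of_orc[OF ix] by (cases "x \<in> X") auto
    moreover have "E (evq a c n 1 0)" "F (evq a c k 1 0)"
      using *(5,6) E(2)[OF ix, of n True "[]"] F(2)[OF ix, of k True "[]"] by simp_all
    ultimately show "Q b" unfolding Q_def root using * by blast
  qed
  ultimately show ?thesis by blast
qed

theorem theorem3p3:
  fixes \<alpha> :: nat and \<P> \<N> :: "code set" and P N :: "nat \<Rightarrow> code"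
  assumes "\<alpha> \<in> KO_star - KO"
    and "\<forall>Q\<in>\<P> \<union> \<N>. ranked_Borel_code \<alpha> Q"
    and "hyp_code_seq P" and "\<P> = range P"
    and "hyp_code_seq N" and "\<N> = range N"
    and "\<forall>X\<in>HYP. \<exists>!Q. Q \<in> with_rank_in_KO \<P> \<union> with_rank_in_KO \<N> \<and> X \<in> HYP_interp Q"
  shows "\<exists>T. ranked_Borel_code \<alpha> T \<and> computable_code T \<and>
    HYP_completely_determined (decorate P N T) \<and>
    HYP_interp (decorate P N T) = (\<Union>Q\<in>with_rank_in_KO \<P>. HYP_interp Q)"
proof -
  have \<alpha>: "\<alpha> \<in> KO_star" "\<alpha> \<notin> KO" using assms(1) by auto
  have rP: "ranked_Borel_code \<alpha> (P n)" and rN: "ranked_Borel_code \<alpha> (N n)" for n using assms(2,4,6) by auto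
  have iP: "X \<in> HYP_interp (P n) \<longleftrightarrow> evt X (P n) True []" if "rank (P n) \<in> KO" "X \<in> HYP" for X n
    using HYP_interp_evt[of P \<alpha> n X] assms(3) rP that by blast
  have iN: "X \<in> HYP_interp (N n) \<longleftrightarrow> evt X (N n) True []" if "rank (N n) \<in> KO" "X \<in> HYP" for X n
    using HYP_interp_evt[of N \<alpha> n X] assms(5) rN that by blast
  have KO_iff: "Q \<in> with_rank_in_KO \<P> \<longleftrightarrow> Q \<in> range P \<and> rank Q \<in> KO"
    "Q \<in> with_rank_in_KO \<N> \<longleftrightarrow> Q \<in> range N \<and> rank Q \<in> KO" for Q
    by (auto simp: with_rank_in_KO_def assms(4,6))
  have unique: "Q = Q'" if "X \<in> HYP" "Q \<in> range P \<union> range N" "rank Q \<in> KO" "X \<in> HYP_interp Q"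
    "Q' \<in> range P \<union> range N" "rank Q' \<in> KO" "X \<in> HYP_interp Q'" for X Q Q'
    using assms(7) that KO_iff by (metis UnE UnI1 UnI2)
  obtain C where C: "pi11 C" "\<And>b. C b \<longleftrightarrow> (\<exists>X\<in>HYP. \<exists>n k r. P n [] \<noteq> None \<and> rank (P n) = b \<and>
    N k [] \<noteq> None \<and> rank (N k) = r \<and> r \<in> KO \<and> r \<noteq> b \<and> evt X (P n) True [] \<and> evt X (N k) True [])"
    using pi11_clash[OF assms(3,5)] by blast
  have "b \<notin> KO" if clash: "C b" for b
  proof
    assume b: "b \<in> KO"
    obtain X n k where *: "X \<in> HYP" "rank (P n) = b" "rank (N k) \<in> KO" "rank (N k) \<noteq> b"
      "evt X (P n) True []" "evt X (N k) True []" using clash C(2)[of b] by blast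
    \<comment> \<open>A code may lie in both ranges, so uniqueness alone is no contradiction; this
      is why a clash asks for different ranks.\<close>
    then have "P n = N k" using unique[of X "P n" "N k"] iP iN b by blast
    then show False using * by simp
  qed
  then obtain \<delta> where \<delta>: "\<delta> \<le>\<^sub>* \<alpha>" "\<delta> \<notin> KO" and noC: "\<And>b. b \<le>\<^sub>* \<delta> \<Longrightarrow> \<not> C b"
    using overspill[OF assms(1) C(1)] by blast
  define T where "T = seed_code \<delta>"
  have rT: "ranked_Borel_code \<alpha> T" and cT: "computable_code T"
    unfolding T_def using ranked_seed_code \<alpha> \<delta> computable_seed_code by blast+
  interpret decoration \<alpha> P N T
    by unfold_locales (use \<alpha> rP rN rT cT assms in auto)
  have root: "P n [] \<noteq> None" "N n [] \<noteq> None" for n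
    using ranked_root(1)[OF rP] ranked_root(1)[OF rN] by (metis option.distinct(1))+
  have main: "(\<exists>f. HYP_evaluation_map X (decorate P N T) f) \<and>
    (X \<in> HYP_interp (decorate P N T) \<longleftrightarrow> (\<exists>Q\<in>with_rank_in_KO \<P>. X \<in> HYP_interp Q))" if X: "X \<in> HYP" for X
  proof -
    from ex1_implies_ex[OF bspec[OF assms(7) X]]
    obtain Q where "Q \<in> with_rank_in_KO \<P> \<union> with_rank_in_KO \<N> \<and> X \<in> HYP_interp Q" ..
    then have Q: "Q \<in> range P \<union> range N" "rank Q \<in> KO" "X \<in> HYP_interp Q"
      unfolding Un_iff KO_iff by blast+
    \<comment> \<open>A \<open>Q\<close> in both ranges counts as positive, as the union over
      \<open>with_rank_in_KO \<P>\<close> demands.\<close>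
    define s where "s \<longleftrightarrow> Q \<in> range P"
    have uP: "P n = Q" if "rank (P n) \<in> KO" "evt X (P n) True []" for n
      using unique[OF X _ _ _ Q, of "P n"] iP that X by blast
    have uN: "N n = Q" if "rank (N n) \<in> KO" "evt X (N n) True []" for n
      using unique[OF X _ _ _ Q, of "N n"] iN that X by blast
    have Q\<alpha>: "rank Q \<le>\<^sub>* \<alpha>" using Q(1) ranked_root(2)[OF rP] ranked_root(2)[OF rN] by auto
    interpret decided_point \<alpha> P N T X "rank Q" s
    proof unfold_locales
      show "X \<in> HYP" "rank Q \<in> KO" "rank Q \<le>\<^sub>* \<alpha>" using X Q Q\<alpha> by auto
      show "\<not> evt X (P n) True []" if "rank (P n) <\<^sub>* rank Q" for n
        using uP[of n] KO_less[OF that Q(2)] KO_less_irrefl[OF Q(2)] that by auto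
      show "\<not> evt X (N n) True []" if "rank (N n) <\<^sub>* rank Q" for n
        using uN[of n] KO_less[OF that Q(2)] KO_less_irrefl[OF Q(2)] that by auto
      show "if s then \<exists>n. rank (P n) = rank Q \<and> evt X (P n) True []
        else \<exists>n. rank (N n) = rank Q \<and> evt X (N n) True []"
        using Q iP iN X unfolding s_def by auto
    qed
    \<comment> \<open>\<delta> is outside \<open>KO\<close>, so it cannot lie at or below
      \<open>rank Q\<close>; linearity puts the root above the deciding rank.\<close>
    have Q\<delta>: "rank Q <\<^sub>* \<delta>"
      using KO_star_linear[OF \<alpha>(1) Q\<alpha> \<delta>(1)] KO_less[OF _ Q(2)] Q(2) \<delta>(2) by (auto simp: le_star_def)
    have start: "node_at start = Some (Union, \<delta>)"
      using seed_code_simps(1)[of \<delta>, folded T_def] by (simp add: node_at_def)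
    have leaf: "node_at (pr 0 (csnoc 0 0)) = Some (Clopen (pr 0 0), 1)"
      using seed_code_simps(2)[of \<delta>, folded T_def] by (simp add: node_at_def list_decode_csnoc)
    have only_leaf: "m = 0" if "node_at (pr 0 (csnoc 0 m)) \<noteq> None" for m
      using that seed_code_simps(3)[of \<delta>, folded T_def] by (auto simp: node_at_def list_decode_csnoc)
    have "V start = s"
    proof (cases s)
      case True
      then show ?thesis using V_match[of start \<delta>] start Q\<delta> by simp
    next
      case False
      have noP: "\<not> evt X (P n) True []" if n: "rank (P n) <\<^sub>* \<delta>" for n
      proof
        assume ev: "evt X (P n) True []"
        show False
        proof (cases "rank (P n) \<in> KO")
          case True
          then show ?thesis using uP[OF True ev] False s_def by auto
        next
          case nKO: False
          \<comment> \<open>\<open>rank (P n)\<close> is outside \<open>KO\<close> and thus differs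
            from \<open>rank Q\<close>: a clash below \<delta>, contrary to the choice of
            \<delta>.\<close>
          obtain k where "N k = Q" using Q(1) False s_def by auto
          moreover from this have "evt X (N k) True []" using iN Q X by blast
          ultimately have "C (rank (P n))" unfolding C(2) using X ev nKO Q(2) root by metis
          then show ?thesis using noC n by (simp add: le_star_def)
        qed
      qed
      \<comment> \<open>Here only unions are passed, and truth moves up through them: a true
        position reached inside \<open>P n\<close> makes the root of \<open>P n\<close> derivably
        true. Entering another attached code replaces \<open>n\<close>.\<close>
      have reach: "q = start \<or> q = pr 0 (csnoc 0 0) \<or> (\<exists>n. p1 q = 2 * n + 1 \<and> rank (P n) <\<^sub>* \<delta> \<and>
          (\<forall>l r. node_at q = Some (l, r) \<longrightarrow> r <\<^sub>* \<delta>) \<and> (val q True \<longrightarrow> evt X (P n) True []))"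
        if "edge\<^sup>*\<^sup>* start q" for q
        using that
      proof (induction rule: rtranclp_induct)
        case (step q q')
        obtain r m where r: "node_at q = Some (Union, r)" and m: "pstep q m = Some q'"
          using step(2) False unfolding edge_def pass_def by auto
        have le: "r \<le>\<^sub>* \<delta>"
          using step.IH r start leaf by (auto simp: le_star_def)
        from m show ?case
        proof (cases rule: pstep_cases)
          case (1 l' r')
          from step.IH show ?thesis
          proof (elim disjE exE conjE)
            assume "q = start"
            then show ?thesis using 1(3,4) only_leaf[of "m div 2"] by auto
          next
            assume "q = pr 0 (csnoc 0 0)"
            then show ?thesis using r leaf by simp
          next
            fix n assume n: "p1 q = 2 * n + 1" "rank (P n) <\<^sub>* \<delta>" "val q True \<longrightarrow> evt X (P n) True []"
            have "r'' <\<^sub>* \<delta>" if "node_at q' = Some (l'', r'')" for l'' r''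
              using pstep_less[OF m r] that le less_le_star_trans by auto
            moreover have "val q True" if "val q' True"
            proof -
              have "evt X (source (p1 q)) True (list_decode (p2 q) @ [m div 2])"
                "list_decode (p2 q) @ [m div 2] \<in> dom (source (p1 q))"
                using that 1 by (auto simp: val_def list_decode_csnoc node_at_def)
              then show ?thesis unfolding val_def
                using evt_unfold[of "source (p1 q)" "list_decode (p2 q)" Union r X True] r
                by (auto simp: node_at_def)
            qed
            ultimately show ?thesis using n 1 by auto
          qed
        next
          case (2 r')
          then have less: "rank (P (m div 2)) <\<^sub>* \<delta>" using r le less_le_star_trans by auto
          then show ?thesis using 2 node_at_P[of "m div 2"] val_P[of "m div 2" True] by auto
        next
          case (3 r')
          then show ?thesis using r by simp
        qed
      qed simp
      have "\<not> bad q" if "edge\<^sup>*\<^sup>* start q" for q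
      proof
        assume bad: "bad q"
        then have v: "val q True" "bottom q" using False unfolding bad_iff by blast+
        from reach[OF that] show False
        proof (elim disjE exE conjE)
          assume "q = start"
          then show False using v(2) start \<gamma>_less[OF Q\<delta>] by (auto simp: bottom_def)
        next
          assume "q = pr 0 (csnoc 0 0)"
          then show False
            using v(1) evt_unfold[of T "[0]", OF seed_code_simps(2)[of \<delta>, folded T_def], of X True]
            by (simp add: val_def list_decode_csnoc clopen_set_def)
        next
          fix n assume "rank (P n) <\<^sub>* \<delta>" "val q True \<longrightarrow> evt X (P n) True []"
          then show False using noP v(1) by blast
        qed
      qed
      then show ?thesis using False unfolding V_def by auto
    qed
    moreover have "(\<exists>Q'\<in>with_rank_in_KO \<P>. X \<in> HYP_interp Q') \<longleftrightarrow> s"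
    proof
      assume "\<exists>Q'\<in>with_rank_in_KO \<P>. X \<in> HYP_interp Q'"
      then obtain Q' where Q': "Q' \<in> range P" "rank Q' \<in> KO" "X \<in> HYP_interp Q'"
        unfolding Bex_def KO_iff by blast
      then have "Q' = Q" by (intro unique[OF X _ _ _ Q]) auto
      then show s using Q'(1) by (simp add: s_def)
    next
      assume s
      then have "Q \<in> with_rank_in_KO \<P>" unfolding KO_iff s_def using Q(2) by blast
      then show "\<exists>Q'\<in>with_rank_in_KO \<P>. X \<in> HYP_interp Q'" using Q(3) by blast
    qed
    ultimately show ?thesis using HYP_evaluation HYP_interp_decorate by blast
  qed
  have "HYP_completely_determined (decorate P N T)"
    unfolding HYP_completely_determined_def using main by blast
  moreover have "HYP_interp Q \<subseteq> HYP" for Q unfolding HYP_interp_def by blast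
  then have "HYP_interp (decorate P N T) = (\<Union>Q\<in>with_rank_in_KO \<P>. HYP_interp Q)"
    using main by blast
  ultimately show ?thesis using rT cT by blast
qed

end
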